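(* Let $V = (V_x)_{x \in X}$ be a Borel field of Polish spaces. Assume that every $V_x$ is locally compact. The family $C_0(V) = (C_0(V_x))_{x \in X}$ of spaces of continuous functions from $V_x$ to $\mathbb{C}$ tending to zero at infinity admits a unique standard Borel structure such that the maps $\pi : C_0(V) \to X$ and $C_0(V) \times_\pi V \to \mathbb{C} : (F,v) \mapsto F(v)$ are Borel. In this way, $C_0(V)$ is a Borel field of the separable C$^*$-algebras $C_0(V_x)$ with the supremum norm. Also, the family $C_c(V) = (C_c(V_x))_{x \in X}$ of spaces of compactly supported continuous functions is a Borel subset of $C_0(V)$ and becomes (with the restricted Borel structure and the supremum norm) a Borel field of separable normed spaces.
   Context: Conventions. A standard Borel space is a measurable space isomorphic to a Borel subset of a Polish space. Product spaces carry the product $\sigma$-algebra and subsets the restricted $\sigma$-algebra. For a family of sets $V = (V_x)_{x\in X}$, the symbol $V$ also denotes the disjoint union of the $V_x$, and $\pi : V \to X$ is the map with $\pi(v) = x$ for $v \in V_x$. For two families over $X$, $V \times_\pi W = \{(v,w) \in V \times W \mid \pi(v)=\pi(w)\}$. A section is a map $\varphi : X \to V$ with $\varphi(x)\in V_x$ for all $x$. A sequence of Borel sections $\varphi_n : X \to V$ is dense if $\{\varphi_n(x) \mid n\in\mathbb{N}\}$ is dense in $V_x$ for every $x\in X$. A Borel field of Polish spaces consists of a standard Borel space $X$, a family $V=(V_x)_{x\in X}$ of Polish spaces and a standard Borel structure on $V$ such that: (1) $\pi : V\to X$ is Borel; (2) there is a Borel map $d : V\times_\pi V\to[0,+\infty)$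 whose restriction to each $V_x\times V_x$ is a separable complete metric inducing the topology of $V_x$; (3) there is a dense sequence of Borel sections $X\to V$. A Borel field of separable normed spaces (complex scalars) consists of a standard Borel space $X$, a family $E=(E_x)_{x\in X}$ of normed spaces and a standard Borel structure on $E$ such that $\pi : E\to X$, the norm $E\to[0,+\infty)$, the addition $E\times_\pi E\to E$ and the scalar multiplication $\mathbb{C}\times E\to E$ are Borel, and there is a norm dense sequence of Borel sections $X\to E$. It is a Borel field of separable Banach spaces if moreover every $E_x$ is complete. A Borel field of separable C$^*$-algebras is a Borel field $A=(A_x)_{x\in X}$ of separable Banach spaces in which every $A_x$ is a C$^*$-algebra and the multiplication $A\times_\pi A\to A$ and adjoint $A\to A$ are Borel. *)

theory Defs
  imports "HOL-Analysis.Analysis" "HOL-Algebra.Module"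
begin

text \<open>Measurable spaces are rendered by the type \<^typ>\<open>'a measure\<close>; only \<^const>\<open>space\<close> and
  \<^const>\<open>sets\<close> matter, so two Borel structures on a set are equal iff they have the same
  \<^const>\<open>sets\<close>.\<close>

section \<open>Standard Borel spaces\<close>

definition polish_top :: "'a topology \<Rightarrow> bool" where
  "polish_top T \<longleftrightarrow> completely_metrizable_space T \<and> separable_space T"

definition borel_of :: "'a topology \<Rightarrow> 'a measure" where
  "borel_of T = sigma (topspace T) {U. openin T U}"

definition measurable_isomorphic :: "'a measure \<Rightarrow> 'b measure \<Rightarrow> bool" where
  "measurable_isomorphic M N \<longleftrightarrow>
     (\<exists>f g. f \<in> measurable M N \<and> g \<in> measurable N M \<and>
        (\<forall>x\<in>space M. g (f x) = x) \<and> (\<forall>y\<in>space N. f (g y) = y))"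

text \<open>One cannot quantify over all Polish spaces of all types in a definition, so the Polish space
  ranges over all Polish topologies on sets of reals. As a Polish space has at most continuum many
  points, this is no restriction; see lemma \<open>standard_borelI\<close> below.\<close>

definition standard_borel :: "'a measure \<Rightarrow> bool" where
  "standard_borel M \<longleftrightarrow>
     (\<exists>(P :: real topology) S. polish_top P \<and> S \<in> sets (borel_of P) \<and>
        measurable_isomorphic M (restrict_space (borel_of P) S))"

lemma space_borel_of [simp]: "space (borel_of T) = topspace T"
  by (simp add: borel_of_def space_measure_of_conv)

lemma sets_borel_of: "sets (borel_of T) = sigma_sets (topspace T) {U. openin T U}"
  unfolding borel_of_def by (rule sets_measure_of) (auto dest: openin_subset)

lemma continuous_map_measurable_borel_of:
  assumes "continuous_map T T' f"
  shows "f \<in> measurable (borel_of T) (borel_of T')"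
  unfolding borel_of_def[of T']
proof (rule measurable_measure_of)
  show "{U. openin T' U} \<subseteq> Pow (topspace T')" by (auto dest: openin_subset)
  show "f \<in> space (borel_of T) \<rightarrow> topspace T'"
    using continuous_map_image_subset_topspace[OF assms] by auto
  fix U assume "U \<in> {U. openin T' U}"
  then have "openin T {x \<in> topspace T. f x \<in> U}"
    using openin_continuous_map_preimage[OF assms] by simp
  moreover have "f -` U \<inter> space (borel_of T) = {x \<in> topspace T. f x \<in> U}" by auto
  ultimately show "f -` U \<inter> space (borel_of T) \<in> sets (borel_of T)"
    unfolding sets_borel_of by (metis mem_Collect_eq sigma_sets.Basic)
qed

lemma polish_top_lepoll_real:
  assumes "polish_top T"
  shows "topspace T \<lesssim> (UNIV :: real set)"
proof -
  obtain M d where "Metric_space M d" and T: "T = Metric_space.mtopology M d"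
    using assms by (auto simp: polish_top_def completely_metrizable_space_def)
  then interpret Metric_space M d by simp
  obtain C where C: "countable C" "C \<subseteq> M" "mtopology closure_of C = M"
    using assms by (auto simp: polish_top_def separable_space_def T)
  define f where "f x = {k. case prod_decode k of (n, m) \<Rightarrow>
      from_nat_into C n \<in> M \<and> d x (from_nat_into C n) < inverse (Suc m)}" for x
  have "inj_on f M"
  proof (rule inj_onI, rule ccontr)
    fix x y assume xy: "x \<in> M" "y \<in> M" "f x = f y" "x \<noteq> y"
    then obtain m where m: "inverse (real (Suc m)) < d x y / 2"
      using reals_Archimedean[of "d x y / 2"] by auto
    have "x \<in> mtopology closure_of C" using C xy by simp
    then have "\<forall>r>0. \<exists>c\<in>C. c \<in> mball x r"
      unfolding metric_closure_of by blast
    moreover have "0 < inverse (real (Suc m))" by simp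
    ultimately obtain c where c: "c \<in> C" "c \<in> mball x (inverse (Suc m))"
      by blast
    then obtain n where n: "c = from_nat_into C n"
      using from_nat_into_surj[OF C(1)] by metis
    have cM: "c \<in> M" and dx: "d x c < inverse (Suc m)" using c by auto
    then have "prod_encode (n, m) \<in> f x" using n by (simp add: f_def)
    then have "prod_encode (n, m) \<in> f y" using xy by simp
    then have "d y c < inverse (Suc m)" using n by (simp add: f_def)
    then show False
      using dx m triangle'[OF xy(1) cM xy(2)] by linarith
  qed
  then have "topspace T \<lesssim> (UNIV :: nat set set)" unfolding T topspace_mtopology lepoll_def by blast
  then show ?thesis using lepoll_trans2 nat_sets_eqpoll_reals by blast
qed

lemma standard_borelI:
  fixes P :: "'p topology"
  assumes P: "polish_top P" and S: "S \<in> sets (borel_of P)"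
    and iso: "measurable_isomorphic M (restrict_space (borel_of P) S)"
  shows "standard_borel M"
proof -
  obtain h :: "'p \<Rightarrow> real" where h: "inj_on h (topspace P)"
    using polish_top_lepoll_real[OF P] unfolding lepoll_def by blast
  define k where "k = inv_into (topspace P) h"
  define Q where "Q = pullback_topology (h ` topspace P) k P"
  have kh: "k (h x) = x" if "x \<in> topspace P" for x
    using h that by (simp add: k_def)
  have topQ: "topspace Q = h ` topspace P"
    unfolding Q_def topspace_pullback_topology using kh by auto
  have ck: "continuous_map Q P k"
    unfolding Q_def using continuous_map_pullback[OF continuous_map_id] by simp
  have ch: "continuous_map P Q h"
    unfolding Q_def
  proof (rule continuous_map_pullback')
    show "continuous_map P P (k \<circ> h)"
      by (rule continuous_map_eq[OF continuous_map_id]) (simp add: kh)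
  qed auto
  have "homeomorphic_maps P Q h k"
    unfolding homeomorphic_maps_def using ck ch kh topQ by auto
  then have hs: "P homeomorphic_space Q" unfolding homeomorphic_space_def by blast
  then have Q: "polish_top Q"
    using P homeomorphic_completely_metrizable_space homeomorphic_separable_space
    unfolding polish_top_def by blast
  have mh: "h \<in> measurable (borel_of P) (borel_of Q)"
    and mk: "k \<in> measurable (borel_of Q) (borel_of P)"
    using ch ck continuous_map_measurable_borel_of by auto
  define S' where "S' = k -` S \<inter> space (borel_of Q)"
  have S': "S' \<in> sets (borel_of Q)"
    unfolding S'_def using measurable_sets[OF mk S] .
  have SP: "S \<subseteq> topspace P" using sets.sets_into_space[OF S] by simp
  have hS: "h x \<in> S'" if "x \<in> S" for x
    using that SP kh topQ by (auto simp: S'_def)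
  have kS: "k y \<in> S" "h (k y) = y" if "y \<in> S'" for y
    using that SP kh topQ by (auto simp: S'_def)
  from iso obtain f g where f: "f \<in> measurable M (restrict_space (borel_of P) S)"
    and g: "g \<in> measurable (restrict_space (borel_of P) S) M"
    and fg: "\<And>x. x \<in> space M \<Longrightarrow> g (f x) = x"
      "\<And>y. y \<in> space (restrict_space (borel_of P) S) \<Longrightarrow> f (g y) = y"
    unfolding measurable_isomorphic_def by blast
  have spS: "space (restrict_space (borel_of P) S) = S"
    using SP by (auto simp: space_restrict_space)
  have spS': "space (restrict_space (borel_of Q) S') = S'"
    by (auto simp: space_restrict_space S'_def)
  have mh': "h \<in> measurable (restrict_space (borel_of P) S) (restrict_space (borel_of Q) S')"
    using mh hS by (intro measurable_restrict_space3) auto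
  have mk': "k \<in> measurable (restrict_space (borel_of Q) S') (restrict_space (borel_of P) S)"
    using mk kS by (intro measurable_restrict_space3) auto
  have fS: "f x \<in> S" if "x \<in> space M" for x
    using measurable_space[OF f that] spS by simp
  have "measurable_isomorphic M (restrict_space (borel_of Q) S')"
    unfolding measurable_isomorphic_def
  proof (intro exI conjI ballI)
    show "h \<circ> f \<in> measurable M (restrict_space (borel_of Q) S')"
      using measurable_comp[OF f mh'] .
    show "g \<circ> k \<in> measurable (restrict_space (borel_of Q) S') M"
      using measurable_comp[OF mk' g] .
    show "(g \<circ> k) ((h \<circ> f) x) = x" if "x \<in> space M" for x
      using fS[OF that] SP kh fg(1)[OF that] by auto
    show "(h \<circ> f) ((g \<circ> k) y) = y" if "y \<in> space (restrict_space (borel_of Q) S')" for y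
      using that kS fg(2) spS spS' by auto
  qed
  then show ?thesis using Q S' unfolding standard_borel_def by blast
qed

section \<open>Borel fields of Polish spaces\<close>

text \<open>The disjoint union of a family is the dependent sum \<^const>\<open>Sigma\<close>, and \<open>\<pi>\<close> is \<^const>\<open>fst\<close>.
  A section \<open>X \<rightarrow> V\<close> is given by its second component \<open>s\<close>, the section itself being
  \<open>\<lambda>x. (x, s x)\<close>.\<close>

definition fibre_product ::
    "('x \<times> 'a) measure \<Rightarrow> ('x \<times> 'b) measure \<Rightarrow> (('x \<times> 'a) \<times> ('x \<times> 'b)) measure" where
  "fibre_product B B' = restrict_space (B \<Otimes>\<^sub>M B') {(v, w). fst v = fst w}"

definition borel_section :: "'x measure \<Rightarrow> ('x \<times> 'a) measure \<Rightarrow> ('x \<Rightarrow> 'a) \<Rightarrow> bool" where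
  "borel_section X B s \<longleftrightarrow> (\<lambda>x. (x, s x)) \<in> measurable X B"

definition dense_borel_sections ::
    "'x measure \<Rightarrow> ('x \<Rightarrow> 'a topology) \<Rightarrow> ('x \<times> 'a) measure \<Rightarrow> (nat \<Rightarrow> 'x \<Rightarrow> 'a) \<Rightarrow> bool" where
  "dense_borel_sections X T B s \<longleftrightarrow>
     (\<forall>n. borel_section X B (s n)) \<and>
     (\<forall>x\<in>space X. T x closure_of (range (\<lambda>n. s n x)) = topspace (T x))"

text \<open>The locale \<^locale>\<open>Metric_space\<close> asks for nonnegativity and symmetry of \<open>d x\<close> also outside the
  fibre. This is harmless, because \<open>d x\<close> is existentially quantified and can be put to \<open>0\<close> there.\<close>

definition borel_field_polish ::
    "'x measure \<Rightarrow> ('x \<Rightarrow> 'v topology) \<Rightarrow> ('x \<times> 'v) measure \<Rightarrow> bool" where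
  "borel_field_polish X V B \<longleftrightarrow>
     standard_borel X \<and>
     (\<forall>x\<in>space X. polish_top (V x)) \<and>
     standard_borel B \<and> space B = Sigma (space X) (\<lambda>x. topspace (V x)) \<and>
     fst \<in> measurable B X \<and>
     (\<exists>d :: 'x \<Rightarrow> 'v \<Rightarrow> 'v \<Rightarrow> real.
        (\<lambda>((x, v), (y, w)). d x v w) \<in> borel_measurable (fibre_product B B) \<and>
        (\<forall>x\<in>space X.
           Metric_space (topspace (V x)) (d x) \<and>
           Metric_space.mcomplete (topspace (V x)) (d x) \<and>
           separable_space (Metric_space.mtopology (topspace (V x)) (d x)) \<and>
           Metric_space.mtopology (topspace (V x)) (d x) = V x)) \<and>
     (\<exists>s. dense_borel_sections X V B s)"

section \<open>Normed spaces and C*-algebras with explicit carriers\<close>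

text \<open>The fibres of a field vary with the base point, so they are structures with a carrier set: a
  complex vector space is a module over the field \<open>\<complex>\<close> in the sense of \<open>HOL-Algebra\<close>. The field
  \<^const>\<open>one\<close> of the underlying record is never constrained, so nothing is assumed to be unital;
  \<^const>\<open>mult\<close> is only constrained for algebras.\<close>

definition complex_ring :: "complex ring" where
  "complex_ring = \<lparr>carrier = UNIV, mult = (*), one = 1, zero = 0, add = (+)\<rparr>"

record 'e normed_star = "(complex, 'e) module" +
  nrm :: "'e \<Rightarrow> real"
  adj :: "'e \<Rightarrow> 'e"

definition complex_normed_space :: "('e, 'm) normed_star_scheme \<Rightarrow> bool" where
  "complex_normed_space E \<longleftrightarrow>
     Module.module complex_ring E \<and>
     (\<forall>u\<in>carrier E. 0 \<le> nrm E u \<and> (nrm E u = 0 \<longleftrightarrow> u = \<zero>\<^bsub>E\<^esub>)) \<and>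
     (\<forall>c. \<forall>u\<in>carrier E. nrm E (c \<odot>\<^bsub>E\<^esub> u) = cmod c * nrm E u) \<and>
     (\<forall>u\<in>carrier E. \<forall>w\<in>carrier E. nrm E (u \<oplus>\<^bsub>E\<^esub> w) \<le> nrm E u + nrm E w)"

text \<open>The value \<open>0\<close> off the carrier is needed for the locale \<^locale>\<open>Metric_space\<close>.\<close>

definition norm_dist :: "('e, 'm) normed_star_scheme \<Rightarrow> 'e \<Rightarrow> 'e \<Rightarrow> real" where
  "norm_dist E u w = (if u \<in> carrier E \<and> w \<in> carrier E then nrm E (u \<ominus>\<^bsub>E\<^esub> w) else 0)"

definition norm_topology :: "('e, 'm) normed_star_scheme \<Rightarrow> 'e topology" where
  "norm_topology E = Metric_space.mtopology (carrier E) (norm_dist E)"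

definition complex_banach_space :: "('e, 'm) normed_star_scheme \<Rightarrow> bool" where
  "complex_banach_space E \<longleftrightarrow>
     complex_normed_space E \<and> Metric_space.mcomplete (carrier E) (norm_dist E)"

definition cstar_algebra :: "('e, 'm) normed_star_scheme \<Rightarrow> bool" where
  "cstar_algebra A \<longleftrightarrow>
     complex_banach_space A \<and>
     (\<forall>a\<in>carrier A. \<forall>b\<in>carrier A.
        a \<otimes>\<^bsub>A\<^esub> b \<in> carrier A \<and> nrm A (a \<otimes>\<^bsub>A\<^esub> b) \<le> nrm A a * nrm A b) \<and>
     (\<forall>a\<in>carrier A. \<forall>b\<in>carrier A. \<forall>c\<in>carrier A.
        (a \<otimes>\<^bsub>A\<^esub> b) \<otimes>\<^bsub>A\<^esub> c = a \<otimes>\<^bsub>A\<^esub> (b \<otimes>\<^bsub>A\<^esub> c) \<and>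
        (a \<oplus>\<^bsub>A\<^esub> b) \<otimes>\<^bsub>A\<^esub> c = (a \<otimes>\<^bsub>A\<^esub> c) \<oplus>\<^bsub>A\<^esub> (b \<otimes>\<^bsub>A\<^esub> c) \<and>
        c \<otimes>\<^bsub>A\<^esub> (a \<oplus>\<^bsub>A\<^esub> b) = (c \<otimes>\<^bsub>A\<^esub> a) \<oplus>\<^bsub>A\<^esub> (c \<otimes>\<^bsub>A\<^esub> b)) \<and>
     (\<forall>z. \<forall>a\<in>carrier A. \<forall>b\<in>carrier A.
        (z \<odot>\<^bsub>A\<^esub> a) \<otimes>\<^bsub>A\<^esub> b = z \<odot>\<^bsub>A\<^esub> (a \<otimes>\<^bsub>A\<^esub> b) \<and>
        a \<otimes>\<^bsub>A\<^esub> (z \<odot>\<^bsub>A\<^esub> b) = z \<odot>\<^bsub>A\<^esub> (a \<otimes>\<^bsub>A\<^esub> b)) \<and>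
     (\<forall>a\<in>carrier A. adj A a \<in> carrier A \<and> adj A (adj A a) = a) \<and>
     (\<forall>a\<in>carrier A. \<forall>b\<in>carrier A.
        adj A (a \<oplus>\<^bsub>A\<^esub> b) = adj A a \<oplus>\<^bsub>A\<^esub> adj A b \<and>
        adj A (a \<otimes>\<^bsub>A\<^esub> b) = adj A b \<otimes>\<^bsub>A\<^esub> adj A a) \<and>
     (\<forall>z. \<forall>a\<in>carrier A. adj A (z \<odot>\<^bsub>A\<^esub> a) = cnj z \<odot>\<^bsub>A\<^esub> adj A a) \<and>
     (\<forall>a\<in>carrier A. nrm A (adj A a \<otimes>\<^bsub>A\<^esub> a) = (nrm A a)\<^sup>2)"

section \<open>Borel fields of normed spaces, Banach spaces and C*-algebras\<close>

definition borel_field_normed ::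
    "'x measure \<Rightarrow> ('x \<Rightarrow> ('e, 'm) normed_star_scheme) \<Rightarrow> ('x \<times> 'e) measure \<Rightarrow> bool" where
  "borel_field_normed X E B \<longleftrightarrow>
     standard_borel X \<and>
     (\<forall>x\<in>space X. complex_normed_space (E x)) \<and>
     standard_borel B \<and> space B = Sigma (space X) (\<lambda>x. carrier (E x)) \<and>
     fst \<in> measurable B X \<and>
     (\<lambda>(x, u). nrm (E x) u) \<in> borel_measurable B \<and>
     (\<lambda>((x, u), (y, w)). (x, u \<oplus>\<^bsub>E x\<^esub> w)) \<in> measurable (fibre_product B B) B \<and>
     (\<lambda>(c, (x, u)). (x, c \<odot>\<^bsub>E x\<^esub> u)) \<in> measurable ((borel :: complex measure) \<Otimes>\<^sub>M B) B \<and>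
     (\<exists>s. dense_borel_sections X (\<lambda>x. norm_topology (E x)) B s)"

definition borel_field_banach ::
    "'x measure \<Rightarrow> ('x \<Rightarrow> ('e, 'm) normed_star_scheme) \<Rightarrow> ('x \<times> 'e) measure \<Rightarrow> bool" where
  "borel_field_banach X E B \<longleftrightarrow>
     borel_field_normed X E B \<and> (\<forall>x\<in>space X. complex_banach_space (E x))"

definition borel_field_cstar ::
    "'x measure \<Rightarrow> ('x \<Rightarrow> ('e, 'm) normed_star_scheme) \<Rightarrow> ('x \<times> 'e) measure \<Rightarrow> bool" where
  "borel_field_cstar X A B \<longleftrightarrow>
     borel_field_banach X A B \<and> (\<forall>x\<in>space X. cstar_algebra (A x)) \<and>
     (\<lambda>((x, a), (y, b)). (x, a \<otimes>\<^bsub>A x\<^esub> b)) \<in> measurable (fibre_product B B) B \<and>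
     (\<lambda>(x, a). (x, adj (A x) a)) \<in> measurable B B"

section \<open>The spaces \<open>C\<^sub>0\<close> and \<open>C\<^sub>c\<close>\<close>

text \<open>A function on \<^term>\<open>topspace T\<close> is represented by its unique extension in
  \<^term>\<open>extensional (topspace T)\<close>.\<close>

definition C0_set :: "'v topology \<Rightarrow> ('v \<Rightarrow> complex) set" where
  "C0_set T = {F \<in> extensional (topspace T). continuous_map T euclidean F \<and>
     (\<forall>\<epsilon>>0. \<exists>K. compactin T K \<and> (\<forall>v \<in> topspace T - K. cmod (F v) < \<epsilon>))}"

definition Cc_set :: "'v topology \<Rightarrow> ('v \<Rightarrow> complex) set" where
  "Cc_set T = {F \<in> extensional (topspace T). continuous_map T euclidean F \<and>
     compactin T (T closure_of {v \<in> topspace T. F v \<noteq> 0})}"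

text \<open>The supremum below is meaningful only for nonempty \<^term>\<open>T\<close>; the fibres of a Borel field of
  Polish spaces are nonempty, since they contain the values of sections.\<close>

definition C0_alg :: "'v topology \<Rightarrow> ('v \<Rightarrow> complex) normed_star" where
  "C0_alg T = \<lparr>
     carrier = C0_set T,
     mult = (\<lambda>F G. \<lambda>v\<in>topspace T. F v * G v),
     one = (\<lambda>v\<in>topspace T. 1),
     zero = (\<lambda>v\<in>topspace T. 0),
     add = (\<lambda>F G. \<lambda>v\<in>topspace T. F v + G v),
     smult = (\<lambda>c F. \<lambda>v\<in>topspace T. c * F v),
     nrm = (\<lambda>F. SUP v\<in>topspace T. cmod (F v)),
     adj = (\<lambda>F. \<lambda>v\<in>topspace T. cnj (F v)) \<rparr>"

definition Cc_alg :: "'v topology \<Rightarrow> ('v \<Rightarrow> complex) normed_star" where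
  "Cc_alg T = (C0_alg T)\<lparr>carrier := Cc_set T\<rparr>"

definition C0_borel_structure ::
    "'x measure \<Rightarrow> ('x \<Rightarrow> 'v topology) \<Rightarrow> ('x \<times> 'v) measure \<Rightarrow>
     ('x \<times> ('v \<Rightarrow> complex)) measure \<Rightarrow> bool" where
  "C0_borel_structure X V BV B \<longleftrightarrow>
     standard_borel B \<and> space B = Sigma (space X) (\<lambda>x. C0_set (V x)) \<and>
     fst \<in> measurable B X \<and>
     (\<lambda>((x, F), (y, v)). F v) \<in> borel_measurable (fibre_product B BV)"

end

theory Submission
  imports Defs
begin

text \<open>The uniqueness is the Lusin--Souslin theorem: an injective Borel map from a standard Borel
  space to a countably separated one generates the Borel structure of its domain. Here the map is
  \<open>(x, F) \<mapsto> (x, (F (s\<^sub>n x))\<^sub>n)\<close>, for a dense sequence of Borel sections \<open>s\<^sub>n\<close>; every Borel structure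
  as in the theorem makes it Borel. For the existence one pulls back the Borel structure along it,
  for which its image has to be Borel: a sequence \<open>a\<close> comes from a function in \<open>C\<^sub>0(V\<^sub>x)\<close> iff
  \<open>s\<^sub>n x \<mapsto> a\<^sub>n\<close> is uniformly continuous and each \<open>{s\<^sub>n x | \<epsilon> \<le> |a\<^sub>n|}\<close> is totally bounded, and by
  completeness and density both are countable conditions on distances. Local compactness enters
  only through the dense sequence of sections of \<open>C\<^sub>c(V)\<close>, built from maxima of rational multiples
  of bump functions on those balls around \<open>s\<^sub>n x\<close> that are totally bounded.\<close>

section \<open>Analytic subsets of the Baire space\<close>

text \<open>The obstacle that shapes the proof is that nothing may be chosen fibre by fibre: a
  choice made separately in each \<open>V x\<close> has no reason to be Borel in \<open>x\<close>.
  Hence every object over a fibre is a formula in the distances to the points \<open>s n x\<close>: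
  a nearby point is found by a least index, a finite net is bounded by a natural number, and the
  dense family consists of finite rational expressions indexed by codes that do not depend on
  \<open>x\<close>. A bump that would not have compact support is replaced by 0, so that each code
  gives a section over all of \<open>X\<close>. Functions in C_0 are uniformly continuous for the
  given metric of the fibre; this is why their values on the dense sequence can be recognised by
  inequalities. Lusin--Souslin also yields the Borel operations: once the structure is known to be
  the pull-back, a map into the field is Borel as soon as its base point and its values at each
  \<open>s n\<close> are. The separation theorem is proved on the Baire space, where a cylinder
  splits into countably many smaller ones; other standard Borel spaces enter through Borel
  surjections from Borel subsets of it.\<close>

abbreviation baire_space :: "(nat \<Rightarrow> nat) measure" where
  "baire_space \<equiv> Pi\<^sub>M UNIV (\<lambda>_. count_space UNIV)"

text \<open>Images of closed sets, not only of the whole Baire space, so that the empty set is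
  included. The map is continuous on the whole space, so preimages of open sets are open without
  relative topologies.\<close>

definition analytic :: "(nat \<Rightarrow> nat) set \<Rightarrow> bool" where
  "analytic A \<longleftrightarrow> (\<exists>C (g :: (nat \<Rightarrow> nat) \<Rightarrow> (nat \<Rightarrow> nat)).
     closed C \<and> continuous_on UNIV g \<and> A = g ` C)"

text \<open>Serves to code several sequences in a single one: the shift, the rows under a pairing of
  indices and the odd coordinates are all reindexings.\<close>

lemma continuous_on_reindex:
  "continuous_on UNIV (\<lambda>(w :: nat \<Rightarrow> nat) k. w (h k) :: nat)"
  by (intro continuous_on_coordinatewise_then_product continuous_on_product_coordinates)

lemma open_coordinate: "open {w :: nat \<Rightarrow> nat. w i \<in> S}"
proof -
  have "open ((\<lambda>w :: nat \<Rightarrow> nat. w i) -` S)"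
    by (intro open_vimage open_discrete continuous_on_product_coordinates)
  then show ?thesis by (simp add: vimage_def)
qed

lemma closed_coordinate: "closed {w :: nat \<Rightarrow> nat. w i \<in> S}"
  using open_coordinate[of i "- S"] by (simp add: closed_def Compl_eq)

lemma analytic_closed: "closed A \<Longrightarrow> analytic A"
  unfolding analytic_def by (intro exI[of _ A] exI[of _ id]) (auto simp: continuous_on_id)

lemma analytic_image:
  assumes "analytic A" "continuous_on UNIV f"
  shows "analytic (f ` A)"
proof -
  obtain C and g :: "(nat \<Rightarrow> nat) \<Rightarrow> (nat \<Rightarrow> nat)"
    where "closed C" "continuous_on UNIV g" "A = g ` C"
    using assms unfolding analytic_def by blast
  then have "continuous_on UNIV (f \<circ> g)" "f ` A = (f \<circ> g) ` C"
    using assms continuous_on_compose[of UNIV g f] continuous_on_subset[of UNIV f] by auto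
  then show ?thesis using \<open>closed C\<close> unfolding analytic_def by blast
qed

lemma analytic_choice:
  assumes "\<And>n. analytic (A n)"
  shows "\<exists>C (g :: 'i \<Rightarrow> (nat \<Rightarrow> nat) \<Rightarrow> (nat \<Rightarrow> nat)). (\<forall>n. closed (C n)) \<and>
    (\<forall>n. continuous_on UNIV (g n)) \<and> (\<forall>n :: 'i. A n = g n ` C n)"
proof -
  have "\<forall>n. \<exists>p :: (nat \<Rightarrow> nat) set \<times> ((nat \<Rightarrow> nat) \<Rightarrow> (nat \<Rightarrow> nat)).
      closed (fst p) \<and> continuous_on UNIV (snd p) \<and> A n = snd p ` fst p"
    using assms unfolding analytic_def by force
  from choice[OF this] obtain p where p: "\<forall>n. closed (fst (p n)) \<and> continuous_on UNIV (snd (p n)) \<and>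
      A n = (snd (p n) :: (nat \<Rightarrow> nat) \<Rightarrow> (nat \<Rightarrow> nat)) ` fst (p n)" by blast
  show ?thesis
    by (rule exI[of _ "\<lambda>n. fst (p n)"], rule exI[of _ "\<lambda>n. snd (p n)"]) (use p in blast)
qed

text \<open>A point of the union is coded by a number \<open>n\<close> followed by a code for
  \<open>A n\<close>. As the first coordinate is discrete, closedness of \<open>D\<close> and
  continuity of \<open>G\<close> can be checked for each \<open>n\<close> separately.\<close>

lemma analytic_UN:
  assumes "\<And>n :: nat. analytic (A n)"
  shows "analytic (\<Union>n. A n)"
proof -
  obtain C and g :: "nat \<Rightarrow> (nat \<Rightarrow> nat) \<Rightarrow> (nat \<Rightarrow> nat)"
    where C: "\<And>n. closed (C n)" "\<And>n. continuous_on UNIV (g n)" "\<And>n. A n = g n ` C n"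
    using analytic_choice[of A, OF assms] by blast
  define tl where "tl w k = w (Suc k)" for w :: "nat \<Rightarrow> nat" and k
  have tl: "continuous_on UNIV tl" unfolding tl_def by (rule continuous_on_reindex)
  define D where "D = {w. tl w \<in> C (w 0)}"
  define G where "G w = g (w 0) (tl w)" for w
  have "- D = (\<Union>n. {w. w 0 \<in> {n}} \<inter> tl -` (- C n))" by (auto simp: D_def)
  also have "open \<dots>"
    by (intro open_UN open_Int open_coordinate open_vimage tl ballI) (use C in auto)
  finally have "closed D" by (simp add: closed_def)
  moreover have "continuous_on UNIV G"
    unfolding continuous_on_open_vimage[OF open_UNIV]
  proof (intro allI impI)
    fix U :: "(nat \<Rightarrow> nat) set" assume U: "open U"
    have "G -` U \<inter> UNIV = (\<Union>n. {w. w 0 \<in> {n}} \<inter> tl -` (g n -` U))" by (auto simp: G_def)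
    also have "open \<dots>"
      by (intro open_UN open_Int open_coordinate open_vimage tl ballI C U)
    finally show "open (G -` U \<inter> UNIV)" .
  qed
  moreover have "(\<Union>n. A n) = G ` D"
  proof (rule Set.set_eqI, rule iffI)
    fix y assume "y \<in> (\<Union>n. A n)"
    then obtain n z where "z \<in> C n" "y = g n z" using C by auto
    moreover have "tl (case_nat n z) = z" by (rule ext) (simp add: tl_def)
    ultimately have "case_nat n z \<in> D" "G (case_nat n z) = y" by (simp_all add: D_def G_def)
    then show "y \<in> G ` D" by blast
  qed (use C in \<open>auto simp: D_def G_def\<close>)
  ultimately show ?thesis unfolding analytic_def by blast
qed

text \<open>A point of the intersection is coded by one code for every \<open>A n\<close>, stored as
  the rows of a single sequence. That all rows give the same point is a closed condition, being an
  equality of continuous maps.\<close>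

lemma analytic_INT:
  assumes "\<And>n :: nat. analytic (A n)"
  shows "analytic (\<Inter>n. A n)"
proof -
  obtain C and g :: "nat \<Rightarrow> (nat \<Rightarrow> nat) \<Rightarrow> (nat \<Rightarrow> nat)"
    where C: "\<And>n. closed (C n)" "\<And>n. continuous_on UNIV (g n)" "\<And>n. A n = g n ` C n"
    using analytic_choice[of A, OF assms] by blast
  define p where "p n w k = w (prod_encode (n, k))" for w :: "nat \<Rightarrow> nat" and n k
  have p: "continuous_on UNIV (p n)" for n unfolding p_def by (rule continuous_on_reindex)
  have gp: "continuous_on UNIV (\<lambda>w. g n (p n w))" for n
    using continuous_on_compose[OF p continuous_on_subset[OF C(2)]] by (simp add: o_def)
  define D where "D = {w. \<forall>n. p n w \<in> C n \<and> g n (p n w) = g 0 (p 0 w)}"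
  have "closed {w. p n w \<in> C n}" for n
    using closed_vimage[OF C(1) p, of n n] by (simp add: vimage_def)
  moreover have "closed {w. g n (p n w) = g 0 (p 0 w)}" for n
    unfolding fun_eq_iff
    by (intro closed_Collect_all closed_Collect_eq continuous_on_product_then_coordinatewise[OF gp])
  ultimately have "closed D" unfolding D_def
    by (intro closed_Collect_all closed_Collect_conj)
  moreover have "(\<Inter>n. A n) = (\<lambda>w. g 0 (p 0 w)) ` D"
  proof (rule Set.set_eqI, rule iffI)
    fix y assume "y \<in> (\<Inter>n. A n)"
    then have "\<forall>n. \<exists>z. z \<in> C n \<and> y = g n z" using C by auto
    then obtain z where z: "\<And>n. z n \<in> C n" "\<And>n. y = g n (z n)" by metis
    define w where "w j = (case prod_decode j of (n, k) \<Rightarrow> z n k)" for j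
    have "p n w = z n" for n by (rule ext) (simp add: p_def w_def)
    then have "w \<in> D" "g 0 (p 0 w) = y" using z by (auto simp: D_def)
    then show "y \<in> (\<lambda>w. g 0 (p 0 w)) ` D" by blast
  next
    fix y assume "y \<in> (\<lambda>w. g 0 (p 0 w)) ` D"
    then obtain w where w: "w \<in> D" "y = g 0 (p 0 w)" by blast
    have "p n w \<in> C n \<and> g n (p n w) = g 0 (p 0 w)" for n
      using w(1) unfolding D_def by blast
    then have "y \<in> g n ` C n" for n unfolding w(2) by (metis imageI)
    then show "y \<in> (\<Inter>n. A n)" using C(3) by blast
  qed
  ultimately show ?thesis using gp unfolding analytic_def by blast
qed

lemma analytic_sets_baire_space:
  assumes "A \<in> sets baire_space"
  shows "analytic A"
proof -
  have "A \<in> sigma_sets UNIV {{w \<in> UNIV. w i \<in> S} | i (S :: nat set). True}"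
    using assms unfolding sets_PiM_single by (simp add: space_PiM)
  \<comment> \<open>Complements of analytic sets need not be analytic, so the induction over the
    sigma-algebra has to carry the set and its complement together.\<close>
  then have "analytic A \<and> analytic (- A)"
  proof (induction A rule: sigma_sets.induct)
    case (Basic a)
    then obtain i S where a: "a = {w :: nat \<Rightarrow> nat. w i \<in> S}" by auto
    then have "- a = {w. w i \<in> - S}" by auto
    then show ?case unfolding a by (metis analytic_closed closed_coordinate)
  next
    case Empty
    then show ?case by (auto intro: analytic_closed)
  next
    case (Compl a)
    then show ?case by (simp add: Compl_eq_Diff_UNIV[symmetric])
  next
    case (Union a)
    then show ?case by (simp add: analytic_UN analytic_INT)
  qed
  then show ?thesis by blast
qed

section \<open>Separation of disjoint analytic sets by a Borel set\<close>

definition baire_cylinder :: "(nat \<Rightarrow> nat) \<Rightarrow> nat \<Rightarrow> (nat \<Rightarrow> nat) set" where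
  "baire_cylinder w n = {v. \<forall>i<n. v i = w i}"

text \<open>The conclusion holds for all large \<open>m\<close>, so that neighbourhoods of two
  different points can be shrunk to cylinders of a common length.\<close>

lemma open_contains_cylinder:
  assumes "open U" "w \<in> U"
  shows "\<exists>n. \<forall>m\<ge>n. baire_cylinder w m \<subseteq> U"
proof -
  have "openin (product_topology (\<lambda>_. euclidean) UNIV) U"
    using assms by (simp add: open_fun_def)
  from product_topology_open_contains_basis[OF this \<open>w \<in> U\<close>]
  obtain X where X: "w \<in> Pi\<^sub>E UNIV X" "finite {i. X i \<noteq> UNIV}" "Pi\<^sub>E UNIV X \<subseteq> U"
    by auto
  obtain n where n: "\<And>i. X i \<noteq> UNIV \<Longrightarrow> i < n"
    using X(2) finite_nat_set_iff_bounded by auto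
  have "baire_cylinder w m \<subseteq> U" if "m \<ge> n" for m
  proof
    fix v assume v: "v \<in> baire_cylinder w m"
    have "v i \<in> X i" for i
    proof (cases "X i = UNIV")
      case False
      then have "v i = w i" using n[of i] that v by (simp add: baire_cylinder_def)
      then show ?thesis using X(1) by auto
    qed simp
    then show "v \<in> U" using X(3) by auto
  qed
  then show ?thesis by blast
qed

definition baire_separated :: "(nat \<Rightarrow> nat) set \<Rightarrow> (nat \<Rightarrow> nat) set \<Rightarrow> bool" where
  "baire_separated A B \<longleftrightarrow> (\<exists>E\<in>sets baire_space. A \<subseteq> E \<and> E \<inter> B = {})"

text \<open>Used in contrapositive form: if two countable unions cannot be separated, then some
  piece of the first cannot be separated from some piece of the second.\<close>

lemma baire_separated_UN:
  assumes "\<And>(n :: nat) (m :: nat). baire_separated (A n) (B m)"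
  shows "baire_separated (\<Union>n. A n) (\<Union>m. B m)"
proof -
  obtain E where E: "\<And>n m. E n m \<in> sets baire_space" "\<And>n m. A n \<subseteq> E n m"
    "\<And>n m. E n m \<inter> B m = {}"
    using assms unfolding baire_separated_def by metis
  have "(\<Union>n. \<Inter>m. E n m) \<in> sets baire_space"
    using E(1) by (intro sets.countable_UN' sets.countable_INT' image_subsetI) auto
  moreover have "(\<Union>n. A n) \<subseteq> (\<Union>n. \<Inter>m. E n m)" using E(2) by (intro UN_mono INT_greatest) auto
  moreover have "(\<Union>n. \<Inter>m. E n m) \<inter> (\<Union>m. B m) = {}"
  proof -
    have "x \<notin> B m" if "\<forall>m. x \<in> E n m" for x n m using E(3)[of n m] that by blast
    then show ?thesis by (auto simp: disjoint_iff)
  qed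
  ultimately show ?thesis unfolding baire_separated_def by blast
qed

lemma sets_baire_coordinate: "{w. w i \<in> S} \<in> sets baire_space"
proof -
  have "(\<lambda>w. w i) -` S \<inter> space baire_space \<in> sets baire_space"
    by (rule measurable_sets[OF measurable_component_singleton]) auto
  then show ?thesis by (simp add: space_PiM vimage_def)
qed

text \<open>Inseparability of the images is passed on to ever longer cylinders in the two domains,
  which shrink to points \<open>p\<close> and \<open>q\<close>. The values at \<open>p\<close> and
  \<open>q\<close> differ because the sets are disjoint, and by continuity the images of small
  cylinders are then separated by one coordinate.\<close>

theorem lusin_separation:
  assumes "analytic A" "analytic B" "A \<inter> B = {}"
  shows "baire_separated A B"
proof (rule ccontr)
  assume nonsep: "\<not> baire_separated A B"
  obtain C and f :: "(nat \<Rightarrow> nat) \<Rightarrow> (nat \<Rightarrow> nat)" where C: "closed C" "continuous_on UNIV f" "A = f ` C"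
    using assms(1) unfolding analytic_def by blast
  obtain D and g :: "(nat \<Rightarrow> nat) \<Rightarrow> (nat \<Rightarrow> nat)" where D: "closed D" "continuous_on UNIV g" "B = g ` D"
    using assms(2) unfolding analytic_def by blast
  define P where "P n pq \<longleftrightarrow> \<not> baire_separated (f ` (C \<inter> baire_cylinder (fst pq) n))
    (g ` (D \<inter> baire_cylinder (snd pq) n))" for n and pq :: "(nat \<Rightarrow> nat) \<times> (nat \<Rightarrow> nat)"
  have split: "h ` (Z \<inter> baire_cylinder w n) = (\<Union>a. h ` (Z \<inter> baire_cylinder (w(n := a)) (Suc n)))"
    for h :: "(nat \<Rightarrow> nat) \<Rightarrow> (nat \<Rightarrow> nat)" and Z w n
  proof -
    have "v \<in> (\<Union>a. Z \<inter> baire_cylinder (w(n := a)) (Suc n))" if "v \<in> Z \<inter> baire_cylinder w n" for v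
      using that by (auto simp: baire_cylinder_def less_Suc_eq intro!: exI[of _ "v n"])
    moreover have "baire_cylinder (w(n := a)) (Suc n) \<subseteq> baire_cylinder w n" for a
      by (auto simp: baire_cylinder_def)
    ultimately have "Z \<inter> baire_cylinder w n = (\<Union>a. Z \<inter> baire_cylinder (w(n := a)) (Suc n))"
      by blast
    then show ?thesis by (simp only: image_UN)
  qed
  have "\<exists>pq'. P (Suc n) pq' \<and> (\<forall>i<n. fst pq' i = fst pq i \<and> snd pq' i = snd pq i)"
    if "P n pq" for n pq
  proof -
    have "\<exists>a b. \<not> baire_separated (f ` (C \<inter> baire_cylinder ((fst pq)(n := a)) (Suc n)))
        (g ` (D \<inter> baire_cylinder ((snd pq)(n := b)) (Suc n)))"
    proof (rule ccontr)
      assume "\<not> ?thesis"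
      then have "baire_separated (f ` (C \<inter> baire_cylinder ((fst pq)(n := a)) (Suc n)))
        (g ` (D \<inter> baire_cylinder ((snd pq)(n := b)) (Suc n)))" for a b by blast
      then have "baire_separated (\<Union>a. f ` (C \<inter> baire_cylinder ((fst pq)(n := a)) (Suc n)))
        (\<Union>b. g ` (D \<inter> baire_cylinder ((snd pq)(n := b)) (Suc n)))"
        by (rule baire_separated_UN)
      then have "\<not> P n pq" unfolding P_def split[symmetric] by simp
      then show False using that by blast
    qed
    then obtain a b where "P (Suc n) ((fst pq)(n := a), (snd pq)(n := b))"
      unfolding P_def by auto
    then show ?thesis by fastforce
  qed
  moreover have "P 0 (undefined, undefined)"
    using nonsep C(3) D(3) by (simp add: P_def baire_cylinder_def)
  ultimately obtain S where S: "\<And>n. P n (S n)"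
    "\<And>n. \<forall>i<n. fst (S (Suc n)) i = fst (S n) i \<and> snd (S (Suc n)) i = snd (S n) i"
    using dependent_nat_choice[of P "\<lambda>n x y. \<forall>i<n. fst y i = fst x i \<and> snd y i = snd x i"]
    by blast
  \<comment> \<open>Coordinate \<open>i\<close> no longer changes from stage \<open>Suc i\<close>
    on, so reading it there gives the limit branch.\<close>
  define p q where "p i = fst (S (Suc i)) i" and "q i = snd (S (Suc i)) i" for i
  have agree: "fst (S n) i = p i \<and> snd (S n) i = q i" if "i < n" for n i
    using that
  proof (induction n)
    case (Suc n)
    then show ?case using S(2)[of n] by (cases "i = n") (auto simp: p_def q_def)
  qed simp
  have cyl: "baire_cylinder (fst (S n)) n = baire_cylinder p n"
    "baire_cylinder (snd (S n)) n = baire_cylinder q n" for n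
    using agree by (auto simp: baire_cylinder_def)
  have ns: "\<not> baire_separated (f ` (C \<inter> baire_cylinder p n)) (g ` (D \<inter> baire_cylinder q n))" for n
    using S(1)[of n] unfolding P_def cyl .
  \<comment> \<open>The empty set is separated from every set, so inseparability forces the
    cylinders to meet \<open>C\<close> and \<open>D\<close>; closedness then puts \<open>p\<close>
    and \<open>q\<close> into these sets.\<close>
  have ne: "C \<inter> baire_cylinder p n \<noteq> {}" "D \<inter> baire_cylinder q n \<noteq> {}" for n
  proof -
    have "baire_separated {} Y" for Y unfolding baire_separated_def by (intro bexI[of _ "{}"]) auto
    moreover have "baire_separated Y {}" for Y
      unfolding baire_separated_def
      using sets.top[of baire_space] by (intro bexI[of _ UNIV]) (auto simp: space_PiM)
    ultimately show "C \<inter> baire_cylinder p n \<noteq> {}" "D \<inter> baire_cylinder q n \<noteq> {}"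
      using ns[of n] by fastforce+
  qed
  have "p \<in> C"
  proof (rule ccontr)
    assume "p \<notin> C"
    then obtain n where "baire_cylinder p n \<subseteq> - C"
      using open_contains_cylinder[OF open_Compl[OF C(1)], of p] by blast
    then show False using ne(1)[of n] by blast
  qed
  moreover have "q \<in> D"
  proof (rule ccontr)
    assume "q \<notin> D"
    then obtain n where "baire_cylinder q n \<subseteq> - D"
      using open_contains_cylinder[OF open_Compl[OF D(1)], of q] by blast
    then show False using ne(2)[of n] by blast
  qed
  ultimately have "f p \<noteq> g q" using assms(3) C(3) D(3) by blast
  then obtain i where i: "f p i \<noteq> g q i" by blast
  \<comment> \<open>A clopen set: it is Borel, and both it and its complement are open, so that
    continuity applies at \<open>p\<close> and at \<open>q\<close>.\<close>
  define E where "E = {y :: nat \<Rightarrow> nat. y i \<in> {f p i}}"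
  have "open (f -` E)" "open (g -` (- E))"
    unfolding E_def using open_coordinate[of i "{f p i}"] closed_coordinate[of i "{f p i}"]
    by (auto intro!: open_vimage C D simp del: Compl_iff vimage_Collect_eq vimage_Compl
      simp: open_Compl)
  then obtain n m where "\<forall>k\<ge>n. baire_cylinder p k \<subseteq> f -` E" "\<forall>k\<ge>m. baire_cylinder q k \<subseteq> g -` (- E)"
    using open_contains_cylinder[of "f -` E" p] open_contains_cylinder[of "g -` (- E)" q] i
    by (auto simp: E_def)
  then have "baire_cylinder p (max n m) \<subseteq> f -` E" "baire_cylinder q (max n m) \<subseteq> g -` (- E)"
    by auto
  then have "baire_separated (f ` (C \<inter> baire_cylinder p (max n m))) (g ` (D \<inter> baire_cylinder q (max n m)))"
    unfolding baire_separated_def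
    using sets_baire_coordinate[of i "{f p i}"] by (intro bexI[of _ E]) (auto simp: E_def)
  then show False using ns by blast
qed

section \<open>Standard Borel spaces\<close>

lemma sets_baire_two_coordinates: "{w. P (w i) (w j)} \<in> sets baire_space"
proof -
  have "{w. P (w i) (w j)} = (\<Union>a. {w. w i \<in> {a}} \<inter> {w. w j \<in> {b. P a b}})" by auto
  also have "\<dots> \<in> sets baire_space"
    by (intro sets.countable_UN' sets.Int image_subsetI sets_baire_coordinate) auto
  finally show ?thesis .
qed

text \<open>The dense set is given as a sequence, possibly with repetitions, because in a field it
  consists of the values of the sections at a base point.\<close>

locale dense_metric = Metric_space M d for M :: "'a set" and d +
  fixes c :: "nat \<Rightarrow> 'a"
  assumes c_in [simp]: "c n \<in> M"
    and dense_c: "mtopology closure_of (range c) = M"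
begin

lemma approx:
  assumes "x \<in> M" "0 < \<epsilon>"
  shows "\<exists>n. d (c n) x < \<epsilon>"
proof -
  have "x \<in> mtopology closure_of (range c)" using assms dense_c by simp
  then have "\<exists>y\<in>range c. y \<in> mball x \<epsilon>" unfolding metric_closure_of using assms(2) by blast
  then show ?thesis using commute by auto
qed

lemma approx_inverse: "x \<in> M \<Longrightarrow> \<exists>n. d (c n) x < inverse (Suc k)"
  by (rule approx) auto

lemma ball_basis:
  assumes "openin mtopology U" "x \<in> U"
  shows "\<exists>n k. x \<in> mball (c n) (inverse (Suc k)) \<and> mball (c n) (inverse (Suc k)) \<subseteq> U"
proof -
  obtain r where r: "r > 0" "mball x r \<subseteq> U" and x: "x \<in> M"
    using assms openin_mtopology by (metis subsetD)
  obtain k where k: "inverse (real (Suc k)) < r / 2"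
    using reals_Archimedean[of "r / 2"] r by auto
  obtain n where n: "d (c n) x < inverse (Suc k)" using approx_inverse x by blast
  have "mball (c n) (inverse (Suc k)) \<subseteq> mball x r"
  proof
    fix y assume y: "y \<in> mball (c n) (inverse (Suc k))"
    then have "d x y \<le> d x (c n) + d (c n) y" using x by (intro triangle) auto
    then show "y \<in> mball x r" using y n k x commute[of x "c n"] by auto
  qed
  then have "x \<in> mball (c n) (inverse (Suc k)) \<and> mball (c n) (inverse (Suc k)) \<subseteq> U"
    using r n x by auto
  then show ?thesis by blast
qed

end

section \<open>Polish spaces as Borel images of subsets of the Baire space\<close>

lemma polish_top_dense_metric:
  assumes "polish_top T" "topspace T \<noteq> {}"
  obtains d c where "dense_metric (topspace T) d c" "Metric_space.mcomplete (topspace T) d"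
    "Metric_space.mtopology (topspace T) d = T"
proof -
  obtain M d where M: "Metric_space M d" "Metric_space.mcomplete M d"
    and T: "T = Metric_space.mtopology M d"
    using assms by (auto simp: polish_top_def completely_metrizable_space_def)
  interpret Metric_space M d by (rule M)
  have [simp]: "topspace T = M" by (simp add: T)
  obtain C where C: "countable C" "C \<subseteq> M" "mtopology closure_of C = M"
    using assms by (auto simp: polish_top_def separable_space_def T)
  have "C \<noteq> {}" using C assms by auto
  then have "range (from_nat_into C) = C" using C(1) by (rule range_from_nat_into)
  then have "dense_metric M d (from_nat_into C)"
    using C M(1) by (auto simp: dense_metric_def dense_metric_axioms_def)
  then show thesis using that M T by simp
qed

lemma polish_top_second_countable:
  assumes "polish_top T"
  shows "second_countable T"
proof (cases "topspace T = {}")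
  case True
  then show ?thesis
    unfolding second_countable_def by (intro exI[of _ "{}"]) (auto dest: openin_subset)
next
  case False
  obtain d c where dc: "dense_metric (topspace T) d c" "Metric_space.mtopology (topspace T) d = T"
    using polish_top_dense_metric[OF assms False] by metis
  interpret dense_metric "topspace T" d c by (rule dc)
  define B where "B = range (\<lambda>(n, k). mball (c n) (inverse (real (Suc k))))"
  have "countable B" "\<forall>V\<in>B. openin T V" unfolding B_def using dc openin_mball by auto
  moreover have "\<exists>V\<in>B. x \<in> V \<and> V \<subseteq> U" if "openin T U" "x \<in> U" for U x
    using ball_basis[of U x] that dc unfolding B_def by fastforce
  ultimately show ?thesis unfolding second_countable_def by blast
qed

text \<open>A point is coded by the indices of a sequence of dense points converging to it at a
  geometric rate. The rate is a condition on neighbouring coordinates, so the set \<open>D\<close>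
  of codes is Borel, and it bounds the distance from each term to the limit uniformly in the
  code.\<close>

lemma polish_baire_surjection:
  assumes "polish_top T"
  shows "\<exists>D\<in>sets baire_space. \<exists>g. g \<in> measurable (restrict_space baire_space D) (borel_of T) \<and>
    g ` D = topspace T"
proof (cases "topspace T = {}")
  case True
  show ?thesis
    by (rule bexI[of _ "{}"], rule exI[of _ undefined])
      (auto simp: True measurable_def space_restrict_space space_empty_iff sets_restrict_space)
next
  case False
  obtain d c where dc: "dense_metric (topspace T) d c" "Metric_space.mcomplete (topspace T) d"
    "Metric_space.mtopology (topspace T) d = T"
    using polish_top_dense_metric[OF assms False] by metis
  define M where "M = topspace T"
  interpret dense_metric M d c unfolding M_def by (rule dc)
  have T: "T = mtopology" and complete: mcomplete using dc by (simp_all add: M_def)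
  define e where "e n = (1/2::real) ^ n" for n :: nat
  have e0: "e n > 0" and eS: "e (Suc n) = e n / 2" for n by (simp_all add: e_def)
  have e_small: "\<exists>n. e n < r" if "r > 0" for r
    unfolding e_def using real_arch_pow_inv[OF that, of "1/2"] by auto
  define D where "D = (\<Inter>i. {w. d (c (w i)) (c (w (Suc i))) < e i})"
  have D: "D \<in> sets baire_space"
    unfolding D_def by (intro sets.countable_INT' image_subsetI sets_baire_two_coordinates) auto
  \<comment> \<open>The bound is the sum of \<open>e i\<close> over \<open>n \<le> i < m\<close>,
    written in closed form so that it telescopes.\<close>
  have cauchy: "d (c (w n)) (c (w m)) \<le> 2 * e n - 2 * e m" if "w \<in> D" "n \<le> m" for w n m
    using that(2)
  proof (induction m rule: dec_induct)
    case base
    then show ?case by simp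
  next
    case (step m)
    have "d (c (w n)) (c (w (Suc m))) \<le> d (c (w n)) (c (w m)) + d (c (w m)) (c (w (Suc m)))"
      by (intro triangle) auto
    moreover have "d (c (w m)) (c (w (Suc m))) < e m" using that(1) by (auto simp: D_def)
    ultimately show ?case using step.IH eS[of m] by linarith
  qed
  define g where "g w = (SOME x. limitin mtopology (\<lambda>n. c (w n)) x sequentially)" for w
  have lim: "limitin mtopology (\<lambda>n. c (w n)) (g w) sequentially" if w: "w \<in> D" for w
  proof -
    have "MCauchy (\<lambda>n. c (w n))"
      unfolding MCauchy_def
    proof (intro conjI allI impI)
      fix r :: real assume "r > 0"
      then obtain N where N: "e N < r / 4" using e_small[of "r / 4"] by auto
      have "d (c (w n)) (c (w m)) < r" if "N \<le> n" "N \<le> m" for n m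
      proof -
        have "d (c (w n)) (c (w m)) \<le> d (c (w n)) (c (w N)) + d (c (w N)) (c (w m))"
          by (intro triangle) auto
        then show ?thesis
          using cauchy[OF w that(1)] cauchy[OF w that(2)] N e0[of n] e0[of m]
            commute[of "c (w n)" "c (w N)"] by linarith
      qed
      then show "\<exists>N. \<forall>n n'. N \<le> n \<longrightarrow> N \<le> n' \<longrightarrow> d (c (w n)) (c (w n')) < r" by blast
    qed auto
    then obtain x where "limitin mtopology (\<lambda>n. c (w n)) x sequentially"
      using complete unfolding mcomplete_def by blast
    then show ?thesis unfolding g_def by (rule someI)
  qed
  have gM: "g w \<in> M" if "w \<in> D" for w using limitin_mspace[OF lim[OF that]] .
  have g_dist: "d (c (w n)) (g w) \<le> 2 * e n" if w: "w \<in> D" for w n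
  proof (rule field_le_epsilon)
    fix r :: real assume "r > 0"
    then obtain N where N: "\<And>m. m \<ge> N \<Longrightarrow> d (c (w m)) (g w) < r"
      using lim[OF w] unfolding limit_metric_sequentially by blast
    have "d (c (w n)) (g w) \<le> d (c (w n)) (c (w (max n N))) + d (c (w (max n N))) (g w)"
      using gM[OF w] by (intro triangle) auto
    then show "d (c (w n)) (g w) \<le> 2 * e n + r"
      using cauchy[OF w, of n "max n N"] N[of "max n N"] e0[of "max n N"] by simp
  qed
  have "g \<in> measurable (restrict_space baire_space D) (borel_of T)"
    unfolding borel_of_def
  proof (rule measurable_measure_of)
    show "{U. openin T U} \<subseteq> Pow (topspace T)" by (auto dest: openin_subset)
    show "g \<in> space (restrict_space baire_space D) \<rightarrow> topspace T"
      using gM by (auto simp: space_restrict_space M_def)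
    fix U assume "U \<in> {U. openin T U}"
    then have U: "openin mtopology U" by (simp add: T)
    \<comment> \<open>Since \<open>g w\<close> lies within \<open>2 * e i\<close> of
      \<open>c (w i)\<close>, the limit is in \<open>U\<close> iff for some \<open>i\<close> that
      whole closed ball is; this turns the preimage into a countable union of conditions on one
      coordinate.\<close>
    define S where "S i = {n. \<forall>y\<in>M. d (c n) y \<le> 2 * e i \<longrightarrow> y \<in> U}" for i
    have "g -` U \<inter> space (restrict_space baire_space D) = D \<inter> (\<Union>i. {w. w i \<in> S i})"
    proof (rule Set.set_eqI, rule iffI)
      fix w assume "w \<in> g -` U \<inter> space (restrict_space baire_space D)"
      then have w: "w \<in> D" "g w \<in> U" by (auto simp: space_restrict_space)
      then obtain r where r: "r > 0" "mball (g w) r \<subseteq> U"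
        using U openin_mtopology by blast
      obtain i where i: "e i < r / 4" using e_small[of "r / 4"] r by auto
      have "y \<in> U" if "y \<in> M" "d (c (w i)) y \<le> 2 * e i" for y
      proof -
        have "d (g w) y \<le> d (g w) (c (w i)) + d (c (w i)) y"
          using gM[OF w(1)] that by (intro triangle) auto
        then have "d (g w) y < r"
          using g_dist[OF w(1), of i] that(2) i commute[of "g w" "c (w i)"] by linarith
        then show ?thesis using r(2) gM[OF w(1)] that(1) by auto
      qed
      then show "w \<in> D \<inter> (\<Union>i. {w. w i \<in> S i})" using w by (auto simp: S_def)
    next
      fix w assume "w \<in> D \<inter> (\<Union>i. {w. w i \<in> S i})"
      then show "w \<in> g -` U \<inter> space (restrict_space baire_space D)"
        using gM g_dist by (auto simp: S_def space_restrict_space space_PiM)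
    qed
    moreover have "D \<inter> (\<Union>i. {w. w i \<in> S i}) \<in> sets (restrict_space baire_space D)"
      unfolding sets_restrict_space
      by (intro imageI sets.countable_UN' image_subsetI sets_baire_coordinate) auto
    ultimately show "g -` U \<inter> space (restrict_space baire_space D) \<in> sets (restrict_space baire_space D)"
      by simp
  qed
  moreover have "g ` D = topspace T"
  proof
    show "g ` D \<subseteq> topspace T" using gM by (auto simp: M_def)
    show "topspace T \<subseteq> g ` D"
    proof
      fix x assume "x \<in> topspace T"
      then have x: "x \<in> M" by (simp add: M_def)
      \<comment> \<open>With this tolerance two successive terms are at most
        \<open>e i / 4 + e i / 8\<close> apart, so the indices belong to \<open>D\<close>.\<close>
      have "\<exists>n. d (c n) x < e i / 4" for i by (rule approx[OF x]) (simp add: e0)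
      then obtain w where w: "\<And>i. d (c (w i)) x < e i / 4" by metis
      have "d (c (w i)) (c (w (Suc i))) < e i" for i
      proof -
        have "d (c (w i)) (c (w (Suc i))) \<le> d (c (w i)) x + d x (c (w (Suc i)))"
          using x by (intro triangle) auto
        then show ?thesis using w[of i] w[of "Suc i"] eS[of i] e0[of i] commute[of x "c (w (Suc i))"]
          by linarith
      qed
      then have wD: "w \<in> D" by (auto simp: D_def)
      have "d (g w) x \<le> r" if r: "r > 0" for r
      proof -
        obtain i where i: "e i < r / 4" using e_small[of "r / 4"] r by auto
        have "d (g w) x \<le> d (g w) (c (w i)) + d (c (w i)) x"
          using gM[OF wD] x by (intro triangle) auto
        then show ?thesis using g_dist[OF wD, of i] w[of i] i commute[of "g w" "c (w i)"] e0[of i]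
          by linarith
      qed
      then have "d (g w) x \<le> 0" by (rule field_le_epsilon[of "d (g w) x" 0, simplified])
      then have "d (g w) x = 0" using nonneg[of "g w" x] by linarith
      then have "g w = x" using gM[OF wD] x by simp
      then show "x \<in> g ` D" using wD by blast
    qed
  qed
  ultimately show ?thesis using D by blast
qed

section \<open>Standard Borel spaces under isomorphism and restriction\<close>

lemma restrict_restrict_sets:
  "A \<in> sets M \<Longrightarrow> B \<in> sets M \<Longrightarrow> B \<subseteq> A \<Longrightarrow>
    restrict_space (restrict_space M A) B = restrict_space M B"
  by (subst restrict_restrict_space) (simp_all add: sets.Int_space_eq2 Int_absorb1)

lemma measurable_isomorphic_trans:
  assumes "measurable_isomorphic M N" "measurable_isomorphic N K"
  shows "measurable_isomorphic M K"
proof -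
  obtain f g where fg: "f \<in> measurable M N" "g \<in> measurable N M"
    "\<And>x. x \<in> space M \<Longrightarrow> g (f x) = x" "\<And>y. y \<in> space N \<Longrightarrow> f (g y) = y"
    using assms(1) unfolding measurable_isomorphic_def by blast
  obtain h k where hk: "h \<in> measurable N K" "k \<in> measurable K N"
    "\<And>x. x \<in> space N \<Longrightarrow> k (h x) = x" "\<And>y. y \<in> space K \<Longrightarrow> h (k y) = y"
    using assms(2) unfolding measurable_isomorphic_def by blast
  show ?thesis
    unfolding measurable_isomorphic_def
  proof (intro exI conjI ballI)
    show "(\<lambda>x. h (f x)) \<in> measurable M K" using measurable_compose[OF fg(1) hk(1)] .
    show "(\<lambda>x. g (k x)) \<in> measurable K M" using measurable_compose[OF hk(2) fg(2)] .
  qed (use fg hk measurable_space[OF fg(1)] measurable_space[OF hk(2)] in auto)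
qed

lemma standard_borel_isomorphic:
  "measurable_isomorphic M N \<Longrightarrow> standard_borel N \<Longrightarrow> standard_borel M"
  unfolding standard_borel_def using measurable_isomorphic_trans by blast

lemma standard_borelE:
  assumes "standard_borel M"
  obtains P :: "real topology" and S f g where
    "polish_top P" "S \<in> sets (borel_of P)" "f \<in> measurable M (restrict_space (borel_of P) S)"
    "g \<in> measurable (restrict_space (borel_of P) S) M"
    "\<And>x. x \<in> space M \<Longrightarrow> g (f x) = x" "\<And>x. x \<in> space M \<Longrightarrow> f x \<in> S"
    "\<And>y. y \<in> S \<Longrightarrow> f (g y) = y" "\<And>y. y \<in> S \<Longrightarrow> g y \<in> space M" "S \<subseteq> topspace P"
proof -
  obtain P :: "real topology" and S f g where
    *: "polish_top P" "S \<in> sets (borel_of P)" "f \<in> measurable M (restrict_space (borel_of P) S)"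
    "g \<in> measurable (restrict_space (borel_of P) S) M"
    "\<And>x. x \<in> space M \<Longrightarrow> g (f x) = x"
    "\<And>y. y \<in> space (restrict_space (borel_of P) S) \<Longrightarrow> f (g y) = y"
    using assms unfolding standard_borel_def measurable_isomorphic_def by blast
  have S: "S \<subseteq> topspace P" using sets.sets_into_space[OF *(2)] by simp
  then have sp: "space (restrict_space (borel_of P) S) = S" by (auto simp: space_restrict_space)
  show thesis
    by (rule that[OF *(1-5)])
      (use *(6) S sp measurable_space[OF *(3)] measurable_space[OF *(4)] in auto)
qed

lemma standard_borel_restrict_space:
  assumes "standard_borel M" "A \<in> sets M"
  shows "standard_borel (restrict_space M A)"
proof -
  obtain P :: "real topology" and S f g where
    *: "polish_top P" "S \<in> sets (borel_of P)" "f \<in> measurable M (restrict_space (borel_of P) S)"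
    "g \<in> measurable (restrict_space (borel_of P) S) M"
    "\<And>x. x \<in> space M \<Longrightarrow> g (f x) = x" "\<And>x. x \<in> space M \<Longrightarrow> f x \<in> S"
    "\<And>y. y \<in> S \<Longrightarrow> f (g y) = y" "\<And>y. y \<in> S \<Longrightarrow> g y \<in> space M" "S \<subseteq> topspace P"
    using standard_borelE[OF assms(1)] by metis
  have AM: "A \<subseteq> space M" using sets.sets_into_space[OF assms(2)] .
  define S' where "S' = g -` A \<inter> S"
  have "S' = g -` A \<inter> space (restrict_space (borel_of P) S)"
    using *(9) by (auto simp: S'_def space_restrict_space)
  then have "S' \<in> sets (restrict_space (borel_of P) S)"
    using measurable_sets[OF *(4) assms(2)] by simp
  then have S': "S' \<in> sets (borel_of P)"
    using *(2,9) by (subst (asm) sets_restrict_space_iff) (auto simp: Int_absorb2)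
  have rr: "restrict_space (restrict_space (borel_of P) S) S' = restrict_space (borel_of P) S'"
    using *(2) S' by (rule restrict_restrict_sets) (simp add: S'_def)
  have "measurable_isomorphic (restrict_space M A) (restrict_space (borel_of P) S')"
    unfolding measurable_isomorphic_def
  proof (intro exI conjI ballI)
    show "f \<in> measurable (restrict_space M A) (restrict_space (borel_of P) S')"
      unfolding rr[symmetric]
      using * AM by (intro measurable_restrict_space3) (auto simp: S'_def)
    show "g \<in> measurable (restrict_space (borel_of P) S') (restrict_space M A)"
      unfolding rr[symmetric]
      using * by (intro measurable_restrict_space3) (auto simp: S'_def)
  qed (use * AM in \<open>auto simp: space_restrict_space S'_def\<close>)
  then show ?thesis using *(1) S' by (rule_tac standard_borelI)
qed

lemma standard_borel_baire_surjection:
  assumes "standard_borel M"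
  obtains D g where "D \<in> sets baire_space" "g \<in> measurable (restrict_space baire_space D) M"
    "g ` D = space M"
proof -
  obtain P :: "real topology" and S f h where
    *: "polish_top P" "S \<in> sets (borel_of P)" "f \<in> measurable M (restrict_space (borel_of P) S)"
    "h \<in> measurable (restrict_space (borel_of P) S) M"
    "\<And>x. x \<in> space M \<Longrightarrow> h (f x) = x" "\<And>x. x \<in> space M \<Longrightarrow> f x \<in> S"
    "\<And>y. y \<in> S \<Longrightarrow> f (h y) = y" "\<And>y. y \<in> S \<Longrightarrow> h y \<in> space M" "S \<subseteq> topspace P"
    using standard_borelE[OF assms(1)] by metis
  obtain D g where D: "D \<in> sets baire_space"
    and g: "g \<in> measurable (restrict_space baire_space D) (borel_of P)" "g ` D = topspace P"
    using polish_baire_surjection[OF *(1)] by blast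
  define D' where "D' = g -` S \<inter> D"
  have "D' = g -` S \<inter> space (restrict_space baire_space D)"
    by (auto simp: D'_def space_restrict_space space_PiM)
  then have "D' \<in> sets (restrict_space baire_space D)"
    using measurable_sets[OF g(1) *(2)] by simp
  then have D': "D' \<in> sets baire_space"
    using D by (subst (asm) sets_restrict_space_iff) auto
  have rr: "restrict_space (restrict_space baire_space D) D' = restrict_space baire_space D'"
    using D D' by (rule restrict_restrict_sets) (simp add: D'_def)
  have "g \<in> measurable (restrict_space baire_space D') (restrict_space (borel_of P) S)"
    unfolding rr[symmetric] using g(1) by (intro measurable_restrict_space3) (auto simp: D'_def)
  then have "(\<lambda>w. h (g w)) \<in> measurable (restrict_space baire_space D') M"
    using *(4) by (rule measurable_compose)
  moreover have "(\<lambda>w. h (g w)) ` D' = space M"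
  proof
    show "(\<lambda>w. h (g w)) ` D' \<subseteq> space M" using *(8) by (auto simp: D'_def)
    show "space M \<subseteq> (\<lambda>w. h (g w)) ` D'"
    proof
      fix x assume x: "x \<in> space M"
      then obtain w where "w \<in> D" "g w = f x" using g(2) *(6,9) by (metis imageE subsetD)
      then have "w \<in> D'" "x = h (g w)" using *(5,6)[OF x] by (auto simp: D'_def)
      then show "x \<in> (\<lambda>w. h (g w)) ` D'" by blast
    qed
  qed
  ultimately show thesis using that D' by blast
qed

section \<open>Countably separated spaces and the Lusin--Souslin theorem\<close>

definition countably_separated :: "'a measure \<Rightarrow> bool" where
  "countably_separated Y \<longleftrightarrow> (\<exists>U :: nat \<Rightarrow> 'a set. (\<forall>n. U n \<in> sets Y) \<and>
     (\<forall>x\<in>space Y. \<forall>y\<in>space Y. (\<forall>n. x \<in> U n \<longleftrightarrow> y \<in> U n) \<longrightarrow> x = y))"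

lemma countably_separated_polish:
  assumes "polish_top T"
  shows "countably_separated (borel_of T)"
proof -
  obtain B where B: "countable B" "\<And>V. V \<in> B \<Longrightarrow> openin T V"
    "\<And>U x. openin T U \<Longrightarrow> x \<in> U \<Longrightarrow> \<exists>V\<in>B. x \<in> V \<and> V \<subseteq> U"
    using polish_top_second_countable[OF assms] unfolding second_countable_def by metis
  \<comment> \<open>The empty set is added so that the base can be enumerated as a sequence even if
    it is empty; it does not affect separation.\<close>
  define U where "U = from_nat_into (insert {} B)"
  have rU: "range U = insert {} B" unfolding U_def using B(1) by (intro range_from_nat_into) auto
  have sep: "x = y" if xy: "x \<in> topspace T" "y \<in> topspace T" "\<And>n. x \<in> U n \<longleftrightarrow> y \<in> U n" for x y
  proof (rule ccontr)
    assume "x \<noteq> y"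
    moreover have "t1_space T"
      using assms completely_metrizable_imp_metrizable_space metrizable_imp_t1_space
      unfolding polish_top_def by blast
    ultimately obtain W where "openin T W" "x \<in> W" "y \<notin> W"
      using xy unfolding t1_space_def by blast
    then obtain V where "V \<in> B" "x \<in> V" "y \<notin> V" using B(3) by blast
    moreover then obtain n where "V = U n" using rU by (metis insertCI rangeE)
    ultimately show False using xy(3) by blast
  qed
  have "U n \<in> sets (borel_of T)" for n
  proof -
    have "U n = {} \<or> openin T (U n)" using rU B(2) by (metis insertE rangeI)
    then show ?thesis by (auto simp: sets_borel_of)
  qed
  then show ?thesis using sep unfolding countably_separated_def by (intro exI[of _ U]) auto
qed

lemma countably_separated_injection:
  fixes Y :: "'b measure"
  assumes Y: "countably_separated Y" and f: "f \<in> measurable M Y" "inj_on f (space M)"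
  shows "countably_separated M"
proof -
  obtain U :: "nat \<Rightarrow> 'b set" where U0: "\<forall>n. U n \<in> sets Y"
    "\<forall>x\<in>space Y. \<forall>y\<in>space Y. (\<forall>n. x \<in> U n \<longleftrightarrow> y \<in> U n) \<longrightarrow> x = y"
    using Y unfolding countably_separated_def by (elim exE conjE) (rule that)
  have U: "U n \<in> sets Y" for n using U0(1) by blast
  have U_sep: "x = y" if "x \<in> space Y" "y \<in> space Y" "\<forall>n. x \<in> U n \<longleftrightarrow> y \<in> U n" for x y
    using U0(2) that by blast
  have "f x = f y" if "x \<in> space M" "y \<in> space M"
    "\<forall>n. x \<in> f -` U n \<inter> space M \<longleftrightarrow> y \<in> f -` U n \<inter> space M" for x y
    using that measurable_space[OF f(1)] by (intro U_sep) auto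
  then show ?thesis
    unfolding countably_separated_def
    using measurable_sets[OF f(1) U] f(2) by (intro exI[of _ "\<lambda>n. f -` U n \<inter> space M"])
      (auto dest: inj_onD)
qed

lemma standard_borel_countably_separated:
  assumes "standard_borel M"
  shows "countably_separated M"
proof -
  obtain P :: "real topology" and S f g where
    *: "polish_top P" "f \<in> measurable M (restrict_space (borel_of P) S)"
    "\<And>x. x \<in> space M \<Longrightarrow> g (f x) = x"
    using standard_borelE[OF assms] by metis
  have "inj_on f (space M)" using *(3) by (metis inj_onI)
  then show ?thesis
    using *(2) by (intro countably_separated_injection[OF countably_separated_polish[OF *(1)]])
      (simp_all add: measurable_restrict_space2_iff)
qed

text \<open>A Borel map has a Borel graph. A pair of sequences is interleaved into one, with the
  argument in the even and the value in the odd coordinates; the image is then the continuous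
  projection of the Borel set \<open>G\<close> to the odd coordinates.\<close>

lemma analytic_measurable_image:
  assumes D: "D \<in> sets baire_space"
    and f: "f \<in> measurable (restrict_space baire_space D) baire_space"
  shows "analytic (f ` D)"
proof -
  define e o' where "e w i = w (2 * i)" and "o' w i = w (2 * i + 1)" for w :: "nat \<Rightarrow> nat" and i :: nat
  \<comment> \<open>The value off \<open>D\<close> only serves to have a measurable map on the whole
    Baire space; \<open>G\<close> contains the condition \<open>e w \<in> D\<close>, so it is never
    seen.\<close>
  define f' where "f' w = (if w \<in> D then f w else (\<lambda>_. 0))" for w
  have f': "f' \<in> measurable baire_space baire_space"
    unfolding f'_def
    by (subst measurable_restrict_space_iff[symmetric]) (use D f in \<open>auto simp: space_PiM\<close>)
  have e: "e \<in> measurable baire_space baire_space"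
    unfolding e_def by (rule measurable_PiM_single') (auto simp: space_PiM)
  have eq: "{w. g w = h w} \<in> sets baire_space"
    if "g \<in> measurable baire_space (count_space UNIV)" "h \<in> measurable baire_space (count_space UNIV)"
    for g h :: "(nat \<Rightarrow> nat) \<Rightarrow> nat"
  proof -
    have "{w. g w = h w} = (\<Union>n. (g -` {n} \<inter> space baire_space) \<inter> (h -` {n} \<inter> space baire_space))"
      by (auto simp: space_PiM)
    also have "\<dots> \<in> sets baire_space"
      by (intro sets.countable_UN' image_subsetI sets.Int measurable_sets[OF that(1)]
          measurable_sets[OF that(2)]) auto
    finally show ?thesis .
  qed
  define G where "G = (e -` D \<inter> space baire_space) \<inter> (\<Inter>i. {w. w (2 * i + 1) = f' (e w) i})"
  have "G \<in> sets baire_space"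
    unfolding G_def
  proof (rule sets.Int[OF measurable_sets[OF e D]], intro sets.countable_INT' image_subsetI eq)
    fix i
    show "(\<lambda>w. w (2 * i + 1)) \<in> measurable baire_space (count_space UNIV)"
      by (rule measurable_component_singleton) auto
    have "(\<lambda>w. w i) \<in> measurable baire_space (count_space UNIV)"
      by (rule measurable_component_singleton) auto
    then show "(\<lambda>w. f' (e w) i) \<in> measurable baire_space (count_space UNIV)"
      by (rule measurable_compose[OF measurable_compose[OF e f']])
  qed auto
  then have "analytic (o' ` G)"
    unfolding o'_def by (intro analytic_image analytic_sets_baire_space continuous_on_reindex)
  moreover have "f ` D = o' ` G"
  proof (rule Set.set_eqI, rule iffI)
    fix y assume "y \<in> f ` D"
    then obtain z where z: "z \<in> D" "y = f z" by blast
    define w where "w j = (if even j then z (j div 2) else y (j div 2))" for j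
    have "e w = z" "o' w = y" by (rule ext, simp add: e_def o'_def w_def)+
    moreover have "w (2 * i + 1) = y i" for i by (simp add: w_def)
    ultimately have "w \<in> G" using z by (simp add: G_def f'_def space_PiM)
    then show "y \<in> o' ` G" using \<open>o' w = y\<close> by blast
  next
    fix y assume "y \<in> o' ` G"
    then obtain w where w: "w \<in> G" "y = o' w" by blast
    then have "e w \<in> D" by (simp add: G_def)
    moreover have "y = f (e w)"
      using w \<open>e w \<in> D\<close> by (intro ext) (simp add: G_def o'_def f'_def)
    ultimately show "y \<in> f ` D" by blast
  qed
  ultimately show ?thesis by simp
qed

text \<open>Lusin--Souslin: the images of a Borel set and of its complement under the injection are
  disjoint analytic sets, so that the separation theorem applies.\<close>

theorem sets_eq_vimage_algebra:
  fixes Y :: "'b measure"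
  assumes M: "standard_borel M" and Y: "countably_separated Y"
    and f: "f \<in> measurable M Y" "inj_on f (space M)"
  shows "sets M = sets (vimage_algebra (space M) f Y)"
proof
  show "sets (vimage_algebra (space M) f Y) \<subseteq> sets M"
    using f(1) by (intro sets_image_in_sets) auto
  show "sets M \<subseteq> sets (vimage_algebra (space M) f Y)"
  proof
    fix A assume A: "A \<in> sets M"
    obtain U :: "nat \<Rightarrow> 'b set" where U0: "\<forall>n. U n \<in> sets Y"
      "\<forall>x\<in>space Y. \<forall>y\<in>space Y. (\<forall>n. x \<in> U n \<longleftrightarrow> y \<in> U n) \<longrightarrow> x = y"
      using Y unfolding countably_separated_def by (elim exE conjE) (rule that)
    have U: "U n \<in> sets Y" for n using U0(1) by blast
    have U_sep: "x = y" if "x \<in> space Y" "y \<in> space Y" "\<forall>n. x \<in> U n \<longleftrightarrow> y \<in> U n" for x y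
      using U0(2) that by blast
    \<comment> \<open>The characteristic sequence with respect to the separating sets. Countable
      separation says that it is injective, so the question moves from \<open>Y\<close> to the Baire
      space.\<close>
    define h where "h y n = (if y \<in> U n then 1 else 0 :: nat)" for y n
    have h: "h \<in> measurable Y baire_space"
      unfolding h_def
      by (rule measurable_PiM_single') (use U in \<open>auto intro!: measurable_If_set simp: space_PiM\<close>)
    have h_inj: "x = y" if "x \<in> space Y" "y \<in> space Y" "h x = h y" for x y
    proof (rule U_sep[OF that(1,2)], rule allI)
      fix n
      show "x \<in> U n \<longleftrightarrow> y \<in> U n" using fun_cong[OF that(3), of n] by (auto simp: h_def split: if_splits)
    qed
    obtain D g where D: "D \<in> sets baire_space" and g: "g \<in> measurable (restrict_space baire_space D) M"
      "g ` D = space M"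
      using standard_borel_baire_surjection[OF M] by metis
    define k where "k w = h (f (g w))" for w
    have k: "k \<in> measurable (restrict_space baire_space D) baire_space"
      unfolding k_def by (rule measurable_compose[OF measurable_compose[OF g(1) f(1)] h])
    have an: "analytic (k ` (g -` Z \<inter> D))" if Z: "Z \<in> sets M" for Z
    proof -
      define D' where "D' = g -` Z \<inter> D"
      have "D' = g -` Z \<inter> space (restrict_space baire_space D)"
        by (auto simp: D'_def space_restrict_space space_PiM)
      then have "D' \<in> sets (restrict_space baire_space D)"
        using measurable_sets[OF g(1) Z] by simp
      then have D': "D' \<in> sets baire_space"
        using D by (subst (asm) sets_restrict_space_iff) auto
      have rr: "restrict_space (restrict_space baire_space D) D' = restrict_space baire_space D'"
        using D D' by (rule restrict_restrict_sets) (simp add: D'_def)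
      have "k \<in> measurable (restrict_space baire_space D') baire_space"
        unfolding rr[symmetric] using k by (rule measurable_restrict_space1)
      then show ?thesis using analytic_measurable_image[OF D'] by (simp add: D'_def)
    qed
    have "k ` (g -` A \<inter> D) \<inter> k ` (g -` (space M - A) \<inter> D) = {}"
    proof -
      have "g v = g w" if "k v = k w" "v \<in> D" "w \<in> D" for v w
      proof -
        have sp: "g v \<in> space M" "g w \<in> space M" using that g(2) by auto
        then have "f (g v) = f (g w)"
          using that(1) measurable_space[OF f(1)] by (intro h_inj) (auto simp: k_def)
        then show ?thesis using sp f(2) by (simp add: inj_on_def)
      qed
      note same = this
      have False if "v \<in> g -` A \<inter> D" "w \<in> g -` (space M - A) \<inter> D" "k v = k w" for v w
        using same[of v w] that by simp
      then show ?thesis by blast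
    qed
    from lusin_separation[OF an[OF A] an[OF sets.compl_sets[OF A]] this]
    obtain E where E: "E \<in> sets baire_space" "k ` (g -` A \<inter> D) \<subseteq> E"
      "E \<inter> k ` (g -` (space M - A) \<inter> D) = {}"
      unfolding baire_separated_def by blast
    \<comment> \<open>\<open>W\<close> need not be the image of \<open>A\<close> under
      \<open>f\<close>: it only has to contain the image of \<open>A\<close> and to miss the image
      of the complement, which suffices to get \<open>A\<close> back as a preimage.\<close>
    define W where "W = h -` E \<inter> space Y"
    have W: "W \<in> sets Y" unfolding W_def by (rule measurable_sets[OF h E(1)])
    have "A = f -` W \<inter> space M"
    proof (rule Set.set_eqI)
      fix x
      show "x \<in> A \<longleftrightarrow> x \<in> f -` W \<inter> space M"
      proof (cases "x \<in> space M")
        case True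
        then obtain w where w: "w \<in> D" "x = g w" using g(2) by blast
        have "f x \<in> space Y" using measurable_space[OF f(1) True] .
        then have "x \<in> f -` W \<inter> space M \<longleftrightarrow> k w \<in> E" using True w by (simp add: W_def k_def)
        moreover have "k w \<in> E \<longleftrightarrow> x \<in> A" using E(2,3) w True by auto
        ultimately show ?thesis by blast
      next
        case False
        then show ?thesis using sets.sets_into_space[OF A] by auto
      qed
    qed
    then show "A \<in> sets (vimage_algebra (space M) f Y)"
      using in_vimage_algebra[OF W, of f "space M"] by simp
  qed
qed

section \<open>Products and pull-backs of standard Borel spaces\<close>

lemma polish_top_euclidean: "polish_top (euclidean :: 'b :: polish_space topology)"
proof -
  obtain C :: "'b set" where C: "countable C" "\<And>X. open X \<Longrightarrow> X \<noteq> {} \<Longrightarrow> \<exists>d\<in>C. d \<in> X"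
    using countable_dense_exists by blast
  have "closure C = UNIV"
  proof (rule ccontr)
    assume "closure C \<noteq> UNIV"
    then obtain x where "x \<in> C" "x \<in> - closure C" using C(2)[of "- closure C"] by auto
    then show False using closure_subset[of C] by auto
  qed
  then have "separable_space (euclidean :: 'b topology)"
    unfolding separable_space_def using C(1) by (intro exI[of _ C]) auto
  then show ?thesis
    unfolding polish_top_def using completely_metrizable_space_euclidean by blast
qed

lemma polish_top_prod:
  assumes "polish_top S" "polish_top T"
  shows "polish_top (prod_topology S T)"
proof -
  obtain C D where "countable C" "C \<subseteq> topspace S" "S closure_of C = topspace S"
    "countable D" "D \<subseteq> topspace T" "T closure_of D = topspace T"
    using assms unfolding polish_top_def separable_space_def by blast
  then have "separable_space (prod_topology S T)"
    unfolding separable_space_def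
    by (intro exI[of _ "C \<times> D"]) (auto simp: closure_of_Times)
  then show ?thesis
    using assms unfolding polish_top_def completely_metrizable_space_prod_topology by blast
qed

lemma sets_borel_of_euclidean: "sets (borel_of euclidean) = sets borel"
  unfolding sets_borel_of borel_def by simp

text \<open>An open set of the product is a union of open rectangles; taking their sides from
  countable bases leaves only countably many of them, so that the union stays in the product
  sigma-algebra.\<close>

lemma openin_prod_measurable:
  assumes "second_countable S" "second_countable T" "openin (prod_topology S T) U"
  shows "U \<in> sets (borel_of S \<Otimes>\<^sub>M borel_of T)"
proof -
  obtain A where A: "countable A" "\<And>V. V \<in> A \<Longrightarrow> openin S V"
    "\<And>U x. openin S U \<Longrightarrow> x \<in> U \<Longrightarrow> \<exists>V\<in>A. x \<in> V \<and> V \<subseteq> U"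
    using assms(1) unfolding second_countable_def by metis
  obtain B where B: "countable B" "\<And>V. V \<in> B \<Longrightarrow> openin T V"
    "\<And>U x. openin T U \<Longrightarrow> x \<in> U \<Longrightarrow> \<exists>V\<in>B. x \<in> V \<and> V \<subseteq> U"
    using assms(2) unfolding second_countable_def by metis
  define R where "R = {p \<in> A \<times> B. fst p \<times> snd p \<subseteq> U}"
  have "U \<subseteq> (\<Union>p\<in>R. fst p \<times> snd p)"
  proof
    fix z assume z: "z \<in> U"
    obtain x y where xy: "z = (x, y)" by (cases z)
    have "\<exists>V W. openin S V \<and> openin T W \<and> x \<in> V \<and> y \<in> W \<and> V \<times> W \<subseteq> U"
      using assms(3) z unfolding openin_prod_topology_alt xy by simp
    then obtain V W where VW: "openin S V" "openin T W" "x \<in> V" "y \<in> W" "V \<times> W \<subseteq> U"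
      by (elim exE conjE)
    obtain V' where V': "V' \<in> A" "x \<in> V'" "V' \<subseteq> V" using A(3)[OF VW(1,3)] by blast
    obtain W' where W': "W' \<in> B" "y \<in> W'" "W' \<subseteq> W" using B(3)[OF VW(2,4)] by blast
    have "V' \<times> W' \<subseteq> V \<times> W" using V' W' by (intro Sigma_mono)
    then have "(V', W') \<in> R" using V'(1) W'(1) VW(5) by (auto simp: R_def)
    then show "z \<in> (\<Union>p\<in>R. fst p \<times> snd p)" using V'(2) W'(2) xy by force
  qed
  then have "U = (\<Union>p\<in>R. fst p \<times> snd p)" by (auto simp: R_def)
  also have "\<dots> \<in> sets (borel_of S \<Otimes>\<^sub>M borel_of T)"
  proof (intro sets.countable_UN' image_subsetI)
    show "countable R"
      using countable_subset[of R "A \<times> B"] A(1) B(1) by (auto simp: R_def)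
    fix p assume "p \<in> R"
    then show "fst p \<times> snd p \<in> sets (borel_of S \<Otimes>\<^sub>M borel_of T)"
      using A(2) B(2) by (intro pair_measureI) (auto simp: R_def sets_borel_of)
  qed
  finally show ?thesis .
qed

text \<open>Asking only for the Borel sets of \<open>N\<close> allows the product sigma-algebra on
  sequences of complex numbers, which is how the lemma is applied to the target space of the
  evaluation map.\<close>

lemma standard_borel_pair_borel:
  fixes N :: "'b :: polish_space measure"
  assumes X: "standard_borel X" and N: "sets N = sets borel"
  shows "standard_borel (X \<Otimes>\<^sub>M N)"
proof -
  obtain P :: "real topology" and S f g where
    *: "polish_top P" "S \<in> sets (borel_of P)" "f \<in> measurable X (restrict_space (borel_of P) S)"
    "g \<in> measurable (restrict_space (borel_of P) S) X"
    "\<And>x. x \<in> space X \<Longrightarrow> g (f x) = x" "\<And>x. x \<in> space X \<Longrightarrow> f x \<in> S"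
    "\<And>y. y \<in> S \<Longrightarrow> f (g y) = y" "\<And>y. y \<in> S \<Longrightarrow> g y \<in> space X" "S \<subseteq> topspace P"
    using standard_borelE[OF X] by metis
  define E where "E = (euclidean :: 'b topology)"
  define Q where "Q = prod_topology P E"
  have E: "polish_top E" "sets (borel_of E) = sets N"
    using N by (simp_all add: E_def polish_top_euclidean sets_borel_of_euclidean)
  have Q: "polish_top Q" unfolding Q_def by (rule polish_top_prod[OF *(1) E(1)])
  have spN: "space N = UNIV" using sets_eq_imp_space_eq[OF N] by simp
  have topE: "topspace E = UNIV" by (simp add: E_def)
  have fst: "fst \<in> measurable (borel_of Q) (borel_of P)"
    unfolding Q_def by (intro continuous_map_measurable_borel_of continuous_map_fst)
  have snd: "snd \<in> measurable (borel_of Q) N"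
  proof -
    have "snd \<in> measurable (borel_of Q) (borel_of E)"
      unfolding Q_def by (intro continuous_map_measurable_borel_of continuous_map_snd)
    then show ?thesis by (simp cong: measurable_cong_sets add: E(2))
  qed
  have S': "S \<times> UNIV \<in> sets (borel_of Q)"
  proof -
    have "S \<times> UNIV = fst -` S \<inter> space (borel_of Q)"
      using *(9) by (auto simp: Q_def topE)
    then show ?thesis using measurable_sets[OF fst *(2)] by simp
  qed
  have spS': "space (restrict_space (borel_of Q) (S \<times> UNIV)) = S \<times> UNIV"
    using *(9) by (auto simp: space_restrict_space Q_def topE)
  have "measurable_isomorphic (X \<Otimes>\<^sub>M N) (restrict_space (borel_of Q) (S \<times> UNIV))"
    unfolding measurable_isomorphic_def
  proof (intro exI conjI ballI)
    show "(\<lambda>(x, a). (f x, a)) \<in> measurable (X \<Otimes>\<^sub>M N) (restrict_space (borel_of Q) (S \<times> UNIV))"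
    proof (rule measurable_restrict_space2)
      show "(\<lambda>(x, a). (f x, a)) \<in> space (X \<Otimes>\<^sub>M N) \<rightarrow> S \<times> UNIV"
        using *(6) by (auto simp: space_pair_measure)
      show "(\<lambda>(x, a). (f x, a)) \<in> measurable (X \<Otimes>\<^sub>M N) (borel_of Q)"
        unfolding borel_of_def
      proof (rule measurable_measure_of)
        show "{U. openin Q U} \<subseteq> Pow (topspace Q)" by (auto dest: openin_subset)
        show "(\<lambda>(x, a). (f x, a)) \<in> space (X \<Otimes>\<^sub>M N) \<rightarrow> topspace Q"
          using *(6,9) by (auto simp: space_pair_measure Q_def topE)
        fix U assume "U \<in> {U. openin Q U}"
        then have "U \<in> sets (borel_of P \<Otimes>\<^sub>M borel_of E)"
          unfolding Q_def mem_Collect_eq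
          by (rule openin_prod_measurable[OF polish_top_second_countable[OF *(1)]
                polish_top_second_countable[OF E(1)]])
        then have U: "U \<in> sets (borel_of P \<Otimes>\<^sub>M N)"
          using sets_pair_measure_cong[OF refl E(2), of "borel_of P"] by simp
        have "f \<in> measurable X (borel_of P)"
          using *(3) by (simp add: measurable_restrict_space2_iff)
        then have "(\<lambda>(x, a). (f x, a)) \<in> measurable (X \<Otimes>\<^sub>M N) (borel_of P \<Otimes>\<^sub>M N)"
          by measurable
        from measurable_sets[OF this U]
        show "(\<lambda>(x, a). (f x, a)) -` U \<inter> space (X \<Otimes>\<^sub>M N) \<in> sets (X \<Otimes>\<^sub>M N)" .
      qed
    qed
    have "fst \<in> measurable (restrict_space (borel_of Q) (S \<times> UNIV)) (restrict_space (borel_of P) S)"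
      using fst by (rule measurable_restrict_space3) auto
    from measurable_compose[OF this *(4)]
    have "(\<lambda>x. g (fst x)) \<in> measurable (restrict_space (borel_of Q) (S \<times> UNIV)) X" .
    then show "(\<lambda>x. (g (fst x), snd x)) \<in> measurable (restrict_space (borel_of Q) (S \<times> UNIV)) (X \<Otimes>\<^sub>M N)"
      using measurable_restrict_space1[OF snd] by (rule measurable_Pair)
  qed (use *(5-8) spS' in \<open>auto simp: space_pair_measure\<close>)
  then show ?thesis using Q S' by (rule_tac standard_borelI)
qed

text \<open>By injectivity \<open>f\<close> is an isomorphism from the pulled-back structure onto
  the trace of \<open>Y\<close> on the image, and this trace is standard because the image is
  Borel.\<close>

lemma standard_borel_vimage_algebra:
  assumes Y: "standard_borel Y" and I: "f ` Z \<in> sets Y" and inj: "inj_on f Z"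
  shows "standard_borel (vimage_algebra Z f Y)"
proof (rule standard_borel_isomorphic)
  show "standard_borel (restrict_space Y (f ` Z))"
    by (rule standard_borel_restrict_space[OF Y I])
  have fZ: "f ` Z \<subseteq> space Y" using sets.sets_into_space[OF I] .
  then have sp: "space (restrict_space Y (f ` Z)) = f ` Z" by (auto simp: space_restrict_space)
  show "measurable_isomorphic (vimage_algebra Z f Y) (restrict_space Y (f ` Z))"
    unfolding measurable_isomorphic_def
  proof (intro exI conjI ballI)
    show "f \<in> measurable (vimage_algebra Z f Y) (restrict_space Y (f ` Z))"
      using fZ by (intro measurable_restrict_space2 measurable_vimage_algebra1) auto
    show "inv_into Z f \<in> measurable (restrict_space Y (f ` Z)) (vimage_algebra Z f Y)"
    proof (rule measurable_vimage_algebra2)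
      show "inv_into Z f \<in> space (restrict_space Y (f ` Z)) \<rightarrow> Z"
        unfolding sp by (auto intro: inv_into_into)
      have "(\<lambda>x. x) \<in> measurable (restrict_space Y (f ` Z)) Y"
        by (intro measurable_restrict_space1 measurable_ident_sets refl)
      then show "(\<lambda>x. f (inv_into Z f x)) \<in> measurable (restrict_space Y (f ` Z)) Y"
        by (rule subst[OF measurable_cong, rotated -1]) (simp add: sp f_inv_into_f)
    qed
  qed (use inj sp in \<open>auto simp: f_inv_into_f\<close>)
qed

section \<open>Functions on a Polish space seen along a dense sequence\<close>

text \<open>In the following, \<open>D n m\<close> is the distance of the \<open>n\<close>-th and \<open>m\<close>-th point of a dense sequence.
  All conditions are countable, so that they become Borel conditions along a field.\<close>

definition totally_bounded_indices :: "(nat \<Rightarrow> nat \<Rightarrow> real) \<Rightarrow> (nat \<Rightarrow> bool) \<Rightarrow> bool" where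
  "totally_bounded_indices D J \<longleftrightarrow>
     (\<forall>k. \<exists>N. \<forall>n. J n \<longrightarrow> (\<exists>m. m \<le> N \<and> J m \<and> D m n < inverse (real (Suc k))))"

definition unif_cont_values :: "(nat \<Rightarrow> nat \<Rightarrow> real) \<Rightarrow> (nat \<Rightarrow> complex) \<Rightarrow> bool" where
  "unif_cont_values D a \<longleftrightarrow> (\<forall>k. \<exists>l. \<forall>n m. D n m < inverse (real (Suc l)) \<longrightarrow>
     cmod (a n - a m) < inverse (real (Suc k)))"

definition vanishing_values :: "(nat \<Rightarrow> nat \<Rightarrow> real) \<Rightarrow> (nat \<Rightarrow> complex) \<Rightarrow> bool" where
  "vanishing_values D a \<longleftrightarrow>
     (\<forall>k. totally_bounded_indices D (\<lambda>n. inverse (real (Suc k)) \<le> cmod (a n)))"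

lemma C0_set_bounded:
  assumes "F \<in> C0_set T"
  shows "\<exists>b. \<forall>v\<in>topspace T. cmod (F v) \<le> b"
proof -
  have F: "continuous_map T euclidean F" using assms by (simp add: C0_set_def)
  have "\<forall>\<epsilon>>0. \<exists>K. compactin T K \<and> (\<forall>v \<in> topspace T - K. cmod (F v) < \<epsilon>)"
    using assms by (simp add: C0_set_def)
  then obtain K where K: "compactin T K" "\<And>v. v \<in> topspace T - K \<Longrightarrow> cmod (F v) < 1"
    by (meson zero_less_one)
  have "compact (F ` K)" using image_compactin[OF K(1) F] by simp
  then obtain b where b: "\<And>z. z \<in> F ` K \<Longrightarrow> cmod z \<le> b"
    using compact_imp_bounded bounded_iff by metis
  have "cmod (F v) \<le> max b 1" if "v \<in> topspace T" for v
    using b[of "F v"] K(2)[of v] that by (cases "v \<in> K") force+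
  then show ?thesis by blast
qed

lemma Cc_set_subset_C0_set: "Cc_set T \<subseteq> C0_set T"
proof
  fix F assume F: "F \<in> Cc_set T"
  define K where "K = T closure_of {v \<in> topspace T. F v \<noteq> 0}"
  have "compactin T K" using F by (simp add: Cc_set_def K_def)
  moreover have "F v = 0" if "v \<in> topspace T - K" for v
  proof (rule ccontr)
    assume "F v \<noteq> 0"
    then have "v \<in> K" unfolding K_def using that closure_of_subset[of "{v \<in> topspace T. F v \<noteq> 0}" T] by blast
    then show False using that by simp
  qed
  ultimately have "\<forall>\<epsilon>>0. \<exists>K. compactin T K \<and> (\<forall>v\<in>topspace T - K. cmod (F v) < \<epsilon>)"
    by (intro allI impI exI[of _ K]) auto
  then show "F \<in> C0_set T" using F by (simp add: Cc_set_def C0_set_def)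
qed

locale complete_dense_metric = dense_metric +
  assumes complete: mcomplete
begin

abbreviation D :: "nat \<Rightarrow> nat \<Rightarrow> real" where "D n m \<equiv> d (c n) (c m)"

text \<open>A finite net of points \<open>c n\<close> comes from a finite set of indices, which has
  an upper bound \<open>N\<close>. So the quantifier over finite sets becomes one over natural
  numbers.\<close>

lemma totally_bounded_indices_iff:
  "totally_bounded_indices D J \<longleftrightarrow> mtotally_bounded (c ` {n. J n})"
proof
  assume J: "totally_bounded_indices D J"
  show "mtotally_bounded (c ` {n. J n})"
    unfolding mtotally_bounded_def
  proof (intro allI impI)
    fix \<epsilon> :: real assume "\<epsilon> > 0"
    then obtain k where k: "inverse (real (Suc k)) < \<epsilon>" using reals_Archimedean by blast
    obtain N where N: "\<And>n. J n \<Longrightarrow> \<exists>m. m \<le> N \<and> J m \<and> D m n < inverse (real (Suc k))"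
      using J unfolding totally_bounded_indices_def by blast
    have "c n \<in> (\<Union>x\<in>c ` {m. m \<le> N \<and> J m}. mball x \<epsilon>)" if n: "J n" for n
    proof -
      obtain m where m: "m \<le> N" "J m" "D m n < inverse (real (Suc k))" using N[OF n] by blast
      then have "c n \<in> mball (c m) \<epsilon>" using k by simp
      then show ?thesis using m by blast
    qed
    then show "\<exists>K. finite K \<and> K \<subseteq> c ` {n. J n} \<and> c ` {n. J n} \<subseteq> (\<Union>x\<in>K. mball x \<epsilon>)"
      by (intro exI[of _ "c ` {m. m \<le> N \<and> J m}"]) auto
  qed
next
  assume J: "mtotally_bounded (c ` {n. J n})"
  show "totally_bounded_indices D J"
    unfolding totally_bounded_indices_def
  proof
    fix k
    have pos: "inverse (real (Suc k)) > 0" by simp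
    obtain K where K: "finite K" "K \<subseteq> c ` {n. J n}"
      "c ` {n. J n} \<subseteq> (\<Union>x\<in>K. mball x (inverse (real (Suc k))))"
      using J[unfolded mtotally_bounded_def, rule_format, OF pos] by (elim exE conjE) (rule that)
    obtain L where L: "finite L" "L \<subseteq> {n. J n}" "K = c ` L"
      using finite_subset_image[OF K(1,2)] by (elim exE conjE) (rule that)
    obtain N where N: "\<forall>n\<in>L. n \<le> N"
      using L(1) unfolding finite_nat_set_iff_bounded_le by blast
    have "\<exists>m. m \<le> N \<and> J m \<and> D m n < inverse (real (Suc k))" if "J n" for n
    proof -
      have "c n \<in> (\<Union>x\<in>K. mball x (inverse (real (Suc k))))" using K(3) that by blast
      then obtain m where "m \<in> L" "c n \<in> mball (c m) (inverse (real (Suc k)))"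
        unfolding L(3) by blast
      then have "m \<le> N \<and> J m \<and> D m n < inverse (real (Suc k))" using N L(2) by auto
      then show ?thesis by blast
    qed
    then show "\<exists>N. \<forall>n. J n \<longrightarrow> (\<exists>m. m \<le> N \<and> J m \<and> D m n < inverse (real (Suc k)))" by blast
  qed
qed

lemma continuous_map_euclidean_iff:
  fixes F :: "'a \<Rightarrow> 'b :: metric_space"
  shows "continuous_map mtopology euclidean F \<longleftrightarrow>
    (\<forall>x\<in>M. \<forall>\<epsilon>>0. \<exists>\<delta>>0. \<forall>y. y \<in> M \<and> d x y < \<delta> \<longrightarrow> dist (F x) (F y) < \<epsilon>)"
  using metric_continuous_map[OF Met_TC.Metric_space_axioms, of F] by simp

text \<open>The least index depends measurably on the point when the fibre varies, which an
  arbitrary choice need not do.\<close>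

definition near :: "'a \<Rightarrow> nat \<Rightarrow> nat" where
  "near v k = (LEAST n. d (c n) v < inverse (real (Suc k)))"

lemma near: "v \<in> M \<Longrightarrow> d (c (near v k)) v < inverse (real (Suc k))"
  unfolding near_def by (rule LeastI_ex) (rule approx_inverse)

lemma near_eventually:
  assumes "v \<in> M" "\<delta> > 0"
  shows "\<forall>\<^sub>F k in sequentially. d (c (near v k)) v < \<delta>"
proof -
  obtain k where "inverse (real (Suc k)) < \<delta>" using reals_Archimedean[OF assms(2)] by blast
  then have "d (c (near v l)) v < \<delta>" if "l \<ge> k" for l
  proof -
    have "inverse (real (Suc l)) \<le> inverse (real (Suc k))" using that by simp
    then show ?thesis using near[OF assms(1), of l] \<open>inverse (real (Suc k)) < \<delta>\<close> by linarith
  qed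
  then show ?thesis unfolding eventually_sequentially by blast
qed

lemma tendsto_near:
  fixes F :: "'a \<Rightarrow> 'b :: metric_space"
  assumes "continuous_map mtopology euclidean F" "v \<in> M"
  shows "(\<lambda>k. F (c (near v k))) \<longlonglongrightarrow> F v"
proof (rule tendstoI)
  fix \<epsilon> :: real assume "\<epsilon> > 0"
  then obtain \<delta> where \<delta>: "\<delta> > 0" "\<And>y. y \<in> M \<Longrightarrow> d v y < \<delta> \<Longrightarrow> dist (F v) (F y) < \<epsilon>"
    using assms unfolding continuous_map_euclidean_iff by blast
  show "\<forall>\<^sub>F k in sequentially. dist (F (c (near v k))) (F v) < \<epsilon>"
    using near_eventually[OF assms(2) \<delta>(1)]
  proof (rule eventually_mono)
    fix k assume "d (c (near v k)) v < \<delta>"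
    then show "dist (F (c (near v k))) (F v) < \<epsilon>"
      using \<delta>(2)[of "c (near v k)"] by (simp add: dist_commute commute)
  qed
qed

lemma C0_setD:
  assumes "F \<in> C0_set mtopology"
  shows "F \<in> extensional M" "continuous_map mtopology euclidean F"
    "\<And>\<epsilon>. \<epsilon> > 0 \<Longrightarrow> \<exists>K. compactin mtopology K \<and> (\<forall>v \<in> M - K. cmod (F v) < \<epsilon>)"
  using assms by (simp_all add: C0_set_def)

lemma C0_set_eqI:
  assumes "F \<in> C0_set mtopology" "G \<in> C0_set mtopology" "\<And>n. F (c n) = G (c n)"
  shows "F = G"
proof (rule extensionalityI[OF C0_setD(1)[OF assms(1)] C0_setD(1)[OF assms(2)]])
  fix v assume v: "v \<in> M"
  have "(\<lambda>k. G (c (near v k))) \<longlonglongrightarrow> F v"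
    using tendsto_near[OF C0_setD(2)[OF assms(1)] v] assms(3) by simp
  then show "F v = G v"
    using tendsto_near[OF C0_setD(2)[OF assms(2)] v] LIMSEQ_unique by blast
qed

text \<open>This makes an upper bound on the supremum norm a countable condition on the values,
  hence a Borel condition along the field.\<close>

lemma C0_le_iff:
  assumes "F \<in> C0_set mtopology"
  shows "(\<forall>v\<in>M. cmod (F v) \<le> r) \<longleftrightarrow> (\<forall>n. cmod (F (c n)) \<le> r)"
proof
  assume r: "\<forall>n. cmod (F (c n)) \<le> r"
  show "\<forall>v\<in>M. cmod (F v) \<le> r"
  proof
    fix v assume "v \<in> M"
    then have "(\<lambda>k. cmod (F (c (near v k)))) \<longlonglongrightarrow> cmod (F v)"
      by (intro tendsto_norm tendsto_near C0_setD(2)[OF assms])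
    then show "cmod (F v) \<le> r" using r by (intro LIMSEQ_le_const2) auto
  qed
qed simp

text \<open>Outside a compact set \<open>K\<close> any two values are close since both are small. If
  one of the points is in \<open>K\<close>, a Lebesgue number of a suitable cover of
  \<open>K\<close> controls the other, which may lie outside \<open>K\<close>.\<close>

lemma C0_uniformly_continuous:
  assumes F: "F \<in> C0_set mtopology" and \<epsilon>: "\<epsilon> > 0"
  shows "\<exists>\<delta>>0. \<forall>x\<in>M. \<forall>y\<in>M. d x y < \<delta> \<longrightarrow> cmod (F x - F y) < \<epsilon>"
proof -
  obtain K where K: "compactin mtopology K" "\<And>v. v \<in> M - K \<Longrightarrow> cmod (F v) < \<epsilon> / 2"
    using C0_setD(3)[OF F, of "\<epsilon> / 2"] \<epsilon> by auto
  \<comment> \<open>Two points in the same \<open>U z\<close> have values within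
    \<open>\<epsilon> / 2\<close> of \<open>F z\<close>, so their values differ by less than
    \<open>\<epsilon>\<close>.\<close>
  define U where "U x = {y \<in> M. F y \<in> ball (F x) (\<epsilon> / 2)}" for x
  have U: "openin mtopology (U x)" for x
    unfolding U_def
    using openin_continuous_map_preimage[OF C0_setD(2)[OF F], of "ball (F x) (\<epsilon> / 2)"] by simp
  have KM: "K \<subseteq> M" using compactin_subset_topspace[OF K(1)] by simp
  have "x \<in> U x" if "x \<in> M" for x using that \<epsilon> by (simp add: U_def)
  then have cover: "K \<subseteq> \<Union>(range U)" using KM by blast
  obtain \<delta> where \<delta>: "\<delta> > 0" "\<And>x. x \<in> K \<Longrightarrow> \<exists>V\<in>range U. mball x \<delta> \<subseteq> V"
    using lebesgue_number[OF K(1) cover] U by blast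
  have inK: "cmod (F x - F y) < \<epsilon>" if xy: "x \<in> K" "y \<in> M" "d x y < \<delta>" for x y
  proof -
    obtain z where z: "mball x \<delta> \<subseteq> U z" using \<delta>(2)[OF xy(1)] by blast
    have "x \<in> mball x \<delta>" "y \<in> mball x \<delta>" using xy KM \<delta>(1) by auto
    then have "x \<in> U z" "y \<in> U z" using z by blast+
    then have "dist (F z) (F x) < \<epsilon> / 2" "dist (F z) (F y) < \<epsilon> / 2" by (simp_all add: U_def)
    then have "dist (F x) (F y) < \<epsilon>" using dist_triangle_half_r by blast
    then show ?thesis by (simp add: dist_norm)
  qed
  have "cmod (F x - F y) < \<epsilon>" if xy: "x \<in> M" "y \<in> M" "d x y < \<delta>" for x y
  proof -
    consider "x \<in> K" | "y \<in> K" | "x \<in> M - K" "y \<in> M - K" using xy by blast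
    then show ?thesis
    proof cases
      case 1
      then show ?thesis using inK xy by blast
    next
      case 2
      then show ?thesis using inK[of y x] xy by (simp add: commute norm_minus_commute)
    next
      case 3
      then show ?thesis using K(2)[of x] K(2)[of y] norm_triangle_ineq4[of "F x" "F y"] by simp
    qed
  qed
  then show ?thesis using \<delta>(1) by blast
qed

lemma C0_values:
  assumes F: "F \<in> C0_set mtopology"
  shows "unif_cont_values D (\<lambda>n. F (c n))" "vanishing_values D (\<lambda>n. F (c n))"
proof -
  show "unif_cont_values D (\<lambda>n. F (c n))"
    unfolding unif_cont_values_def
  proof
    fix k
    obtain \<delta> where \<delta>: "\<delta> > 0" "\<forall>x\<in>M. \<forall>y\<in>M. d x y < \<delta> \<longrightarrow> cmod (F x - F y) < inverse (real (Suc k))"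
      using C0_uniformly_continuous[OF F, of "inverse (real (Suc k))"] by auto
    obtain l where l: "inverse (real (Suc l)) < \<delta>" using reals_Archimedean[OF \<delta>(1)] by blast
    have "cmod (F (c n) - F (c m)) < inverse (real (Suc k))" if "D n m < inverse (real (Suc l))" for n m
      using \<delta>(2) that l by simp
    then show "\<exists>l. \<forall>n m. D n m < inverse (real (Suc l)) \<longrightarrow>
        cmod (F (c n) - F (c m)) < inverse (real (Suc k))"
      by blast
  qed
  show "vanishing_values D (\<lambda>n. F (c n))"
    unfolding vanishing_values_def totally_bounded_indices_iff
  proof
    fix k
    obtain K where K: "compactin mtopology K" "\<And>v. v \<in> M - K \<Longrightarrow> cmod (F v) < inverse (real (Suc k))"
      using C0_setD(3)[OF F, of "inverse (real (Suc k))"] by auto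
    have "c n \<in> K" if "inverse (real (Suc k)) \<le> cmod (F (c n))" for n
      using K(2)[of "c n"] that by force
    then show "mtotally_bounded (c ` {n. inverse (real (Suc k)) \<le> cmod (F (c n))})"
      using compactin_imp_mtotally_bounded[OF K(1)] by (rule_tac mtotally_bounded_subset) auto
  qed
qed

text \<open>The converse of \<open>C0_values\<close>: uniform continuity makes the values along
  \<open>near v\<close> a Cauchy sequence, whose limit defines \<open>F v\<close>; vanishing at
  infinity then comes from total boundedness together with completeness.\<close>

lemma C0_extension:
  assumes uc: "unif_cont_values D a" and van: "vanishing_values D a"
  shows "\<exists>F\<in>C0_set mtopology. \<forall>n. F (c n) = a n"
proof -
  have uc': "\<exists>\<delta>>0. \<forall>n m. D n m < \<delta> \<longrightarrow> cmod (a n - a m) < \<epsilon>" if \<epsilon>: "\<epsilon> > 0" for \<epsilon>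
  proof -
    obtain k where k: "inverse (real (Suc k)) < \<epsilon>" using reals_Archimedean[OF \<epsilon>] by blast
    obtain l where l: "\<forall>n m. D n m < inverse (real (Suc l)) \<longrightarrow> cmod (a n - a m) < inverse (real (Suc k))"
      using uc unfolding unif_cont_values_def by blast
    show ?thesis
      using l k by (intro exI[of _ "inverse (real (Suc l))"]) (auto intro: less_trans)
  qed
  define F where "F = (\<lambda>v\<in>M. lim (\<lambda>k. a (near v k)))"
  have lim: "(\<lambda>k. a (near v k)) \<longlonglongrightarrow> F v" if v: "v \<in> M" for v
  proof -
    have "Cauchy (\<lambda>k. a (near v k))"
      unfolding Cauchy_def
    proof (intro allI impI)
      fix \<epsilon> :: real assume "\<epsilon> > 0"
      then obtain \<delta> where \<delta>: "\<delta> > 0" "\<forall>n m. D n m < \<delta> \<longrightarrow> cmod (a n - a m) < \<epsilon>"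
        using uc' by blast
      then obtain N where N: "\<And>k. k \<ge> N \<Longrightarrow> d (c (near v k)) v < \<delta> / 2"
        using near_eventually[OF v, of "\<delta> / 2"] unfolding eventually_sequentially by auto
      have "dist (a (near v k)) (a (near v l)) < \<epsilon>" if "k \<ge> N" "l \<ge> N" for k l
      proof -
        have "D (near v k) (near v l) \<le> d (c (near v k)) v + d v (c (near v l))"
          using v by (intro triangle) auto
        then have "D (near v k) (near v l) < \<delta>"
          using N[OF that(1)] N[OF that(2)] commute[of v "c (near v l)"] by linarith
        then show ?thesis using \<delta>(2) by (simp add: dist_norm)
      qed
      then show "\<exists>N. \<forall>m\<ge>N. \<forall>n\<ge>N. dist (a (near v m)) (a (near v n)) < \<epsilon>" by blast
    qed
    then have "convergent (\<lambda>k. a (near v k))" by (rule Cauchy_convergent)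
    then show ?thesis using v by (simp add: F_def convergent_LIMSEQ_iff)
  qed
  \<comment> \<open>This estimate between given values and limit values drives the rest: it yields
    that \<open>F\<close> extends \<open>a\<close>, that \<open>F\<close> is continuous, and that a
    large value of \<open>F\<close> forces large values \<open>a n\<close> at nearby points.\<close>
  have F_near: "\<exists>\<delta>>0. \<forall>n. \<forall>v\<in>M. d (c n) v < \<delta> \<longrightarrow> cmod (a n - F v) \<le> \<epsilon>" if \<epsilon>: "\<epsilon> > 0" for \<epsilon>
  proof -
    obtain \<delta> where \<delta>: "\<delta> > 0" "\<forall>n m. D n m < \<delta> \<longrightarrow> cmod (a n - a m) < \<epsilon>"
      using uc'[OF \<epsilon>] by blast
    have "cmod (a n - F v) \<le> \<epsilon>" if v: "v \<in> M" "d (c n) v < \<delta> / 2" for n v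
    proof (rule tendsto_upperbound)
      show "(\<lambda>k. cmod (a n - a (near v k))) \<longlonglongrightarrow> cmod (a n - F v)"
        by (intro tendsto_intros lim v)
      show "\<forall>\<^sub>F k in sequentially. cmod (a n - a (near v k)) \<le> \<epsilon>"
        using near_eventually[OF v(1), of "\<delta> / 2"] \<delta>(1)
      proof (rule_tac eventually_mono)
        fix k assume "d (c (near v k)) v < \<delta> / 2"
        moreover have "D n (near v k) \<le> d (c n) v + d v (c (near v k))"
          using v by (intro triangle) auto
        ultimately have "D n (near v k) < \<delta>" using v(2) commute[of v "c (near v k)"] by linarith
        then show "cmod (a n - a (near v k)) \<le> \<epsilon>" using \<delta>(2) by (simp add: less_imp_le)
      qed auto
    qed auto
    then show ?thesis using \<delta>(1) by (intro exI[of _ "\<delta> / 2"]) auto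
  qed
  have F_c: "F (c n) = a n" for n
  proof -
    have "cmod (a n - F (c n)) \<le> 0 + \<epsilon>" if "\<epsilon> > 0" for \<epsilon>
      using F_near[OF that] by force
    then have "cmod (a n - F (c n)) \<le> 0" by (rule field_le_epsilon)
    then show ?thesis by simp
  qed
  have cont: "continuous_map mtopology euclidean F"
    unfolding continuous_map_euclidean_iff
  proof (intro ballI allI impI)
    fix v and \<epsilon> :: real assume v: "v \<in> M" and "\<epsilon> > 0"
    then obtain \<delta> where \<delta>: "\<delta> > 0" "\<forall>n. \<forall>v\<in>M. d (c n) v < \<delta> \<longrightarrow> cmod (a n - F v) \<le> \<epsilon> / 3"
      using F_near[of "\<epsilon> / 3"] by auto
    obtain n where n: "d (c n) v < \<delta> / 2" using approx[OF v, of "\<delta> / 2"] \<delta>(1) by auto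
    have "dist (F v) (F w) < \<epsilon>" if w: "w \<in> M" "d v w < \<delta> / 2" for w
    proof -
      have "d (c n) w \<le> d (c n) v + d v w" using v w by (intro triangle) auto
      then have "d (c n) w < \<delta>" "d (c n) v < \<delta>" using n w \<delta>(1) by linarith+
      then have "cmod (a n - F v) \<le> \<epsilon> / 3" "cmod (a n - F w) \<le> \<epsilon> / 3"
        using \<delta>(2) v w by blast+
      then have "dist (F v) (F w) \<le> \<epsilon> / 3 + \<epsilon> / 3"
        using dist_triangle3[of "F v" "F w" "a n"] by (simp add: dist_norm)
      then show ?thesis using \<open>\<epsilon> > 0\<close> by linarith
    qed
    then show "\<exists>\<delta>>0. \<forall>y. y \<in> M \<and> d v y < \<delta> \<longrightarrow> dist (F v) (F y) < \<epsilon>"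
      using \<delta>(1) by (intro exI[of _ "\<delta> / 2"]) auto
  qed
  have "\<exists>K. compactin mtopology K \<and> (\<forall>v\<in>M - K. cmod (F v) < \<epsilon>)" if \<epsilon>: "\<epsilon> > 0" for \<epsilon>
  proof -
    obtain k where k: "inverse (real (Suc k)) < \<epsilon> / 2"
      using reals_Archimedean[of "\<epsilon> / 2"] \<epsilon> by auto
    \<comment> \<open>Half of \<open>\<epsilon>\<close> is kept in reserve: if
      \<open>cmod (F v)\<close> is at least \<open>\<epsilon>\<close>, then \<open>a n\<close> is
      still at least \<open>\<epsilon> / 2\<close> in modulus at dense points arbitrarily close to
      \<open>v\<close>, so \<open>v\<close> lies in the closure of \<open>S\<close>.\<close>
    define S where "S = c ` {n. inverse (real (Suc k)) \<le> cmod (a n)}"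
    have "mtotally_bounded S"
      using van unfolding vanishing_values_def totally_bounded_indices_iff S_def by blast
    then have "compactin mtopology (mtopology closure_of S)"
      using mtotally_bounded_eq_compact_closure_of[OF complete] by blast
    moreover have "cmod (F v) < \<epsilon>" if v: "v \<in> M - mtopology closure_of S" for v
    proof (rule ccontr)
      assume F\<epsilon>: "\<not> cmod (F v) < \<epsilon>"
      obtain \<delta> where \<delta>: "\<delta> > 0" "\<forall>n. \<forall>v\<in>M. d (c n) v < \<delta> \<longrightarrow> cmod (a n - F v) \<le> \<epsilon> / 2"
        using F_near[of "\<epsilon> / 2"] \<epsilon> by auto
      have "\<exists>y\<in>S. y \<in> mball v r" if r: "r > 0" for r
      proof -
        obtain n where n: "d (c n) v < min r \<delta>" using approx[of v "min r \<delta>"] v r \<delta>(1) by auto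
        then have "cmod (a n - F v) \<le> \<epsilon> / 2" using \<delta>(2) v by simp
        then have "\<epsilon> / 2 \<le> cmod (a n)"
          using F\<epsilon> norm_triangle_ineq2[of "F v" "a n"] norm_minus_commute[of "F v" "a n"] by linarith
        then have "c n \<in> S" using k by (auto simp: S_def)
        moreover have "c n \<in> mball v r" using n v commute[of v "c n"] by simp
        ultimately show ?thesis by blast
      qed
      then have "v \<in> mtopology closure_of S" unfolding metric_closure_of using v by blast
      then show False using v by blast
    qed
    ultimately show ?thesis by blast
  qed
  then have "F \<in> C0_set mtopology" using cont by (simp add: C0_set_def F_def)
  then show ?thesis using F_c by blast
qed

lemma Cc_set_iff_mtotally_bounded:
  "F \<in> Cc_set mtopology \<longleftrightarrow> F \<in> extensional M \<and> continuous_map mtopology euclidean F \<and>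
    mtotally_bounded {v \<in> M. F v \<noteq> 0}"
  unfolding Cc_set_def mtotally_bounded_eq_compact_closure_of[OF complete] by auto

text \<open>The set where \<open>F\<close> does not vanish is open, so the dense points in it are
  dense in it; total boundedness passes from them to their closure and hence to the whole
  set.\<close>

lemma Cc_iff_values:
  assumes F: "F \<in> C0_set mtopology"
  shows "F \<in> Cc_set mtopology \<longleftrightarrow> totally_bounded_indices D (\<lambda>n. F (c n) \<noteq> 0)"
  unfolding totally_bounded_indices_iff
proof
  assume "F \<in> Cc_set mtopology"
  then show "mtotally_bounded (c ` {n. F (c n) \<noteq> 0})"
    unfolding Cc_set_iff_mtotally_bounded by (auto elim!: mtotally_bounded_subset)
next
  assume "mtotally_bounded (c ` {n. F (c n) \<noteq> 0})"
  then have tb: "mtotally_bounded (mtopology closure_of (c ` {n. F (c n) \<noteq> 0}))"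
    by (rule mtotally_bounded_closure_of)
  have "{v \<in> M. F v \<noteq> 0} \<subseteq> mtopology closure_of (c ` {n. F (c n) \<noteq> 0})"
  proof
    fix v assume "v \<in> {v \<in> M. F v \<noteq> 0}"
    then have v: "v \<in> M" "F v \<noteq> 0" by auto
    have "\<exists>y\<in>c ` {n. F (c n) \<noteq> 0}. y \<in> mball v r" if r: "r > 0" for r
    proof -
      have "\<forall>\<^sub>F k in sequentially. F (c (near v k)) \<noteq> 0 \<and> d (c (near v k)) v < r"
        using tendsto_imp_eventually_ne[OF tendsto_near[OF C0_setD(2)[OF F] v(1)] v(2)]
          near_eventually[OF v(1) r] by (rule eventually_conj)
      then obtain k where "F (c (near v k)) \<noteq> 0" "d (c (near v k)) v < r"
        using eventually_happens'[OF sequentially_bot] by blast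
      then show ?thesis using v(1) by (intro bexI[of _ "c (near v k)"]) (auto simp: commute)
    qed
    then show "v \<in> mtopology closure_of (c ` {n. F (c n) \<noteq> 0})"
      unfolding metric_closure_of using v by blast
  qed
  then have "mtotally_bounded {v \<in> M. F v \<noteq> 0}" by (rule mtotally_bounded_subset[OF tb])
  then show "F \<in> Cc_set mtopology"
    unfolding Cc_set_iff_mtotally_bounded using C0_setD[OF F] by blast
qed

end

section \<open>A countable dense family of compactly supported functions\<close>

text \<open>As a function of the distance \<open>r\<close> to the \<open>n\<close>-th point it is 1
  up to half of the radius \<open>1/(k+1)\<close> and falls linearly to 0 at the full radius. If the
  ball is not totally bounded, it is 0: in this way every pair \<open>n\<close>, \<open>k\<close>
  gives compact support, with no choice of good radii.\<close>

definition bump :: "(nat \<Rightarrow> nat \<Rightarrow> real) \<Rightarrow> nat \<Rightarrow> nat \<Rightarrow> real \<Rightarrow> real" where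
  "bump D n k r = (if totally_bounded_indices D (\<lambda>m. D n m < inverse (real (Suc k)))
     then max 0 (min 1 (2 - 2 * real (Suc k) * r)) else 0)"

text \<open>The parameter \<open>\<delta>\<close> is the sequence of distances of a point to the dense sequence.\<close>

fun bump_max :: "(nat \<Rightarrow> nat \<Rightarrow> real) \<Rightarrow> (nat \<Rightarrow> real) \<Rightarrow> (rat \<times> nat \<times> nat) list \<Rightarrow> real" where
  "bump_max D \<delta> [] = 0"
| "bump_max D \<delta> ((q, n, k) # l) = max (bump_max D \<delta> l) (of_rat q * bump D n k (\<delta> n))"

text \<open>Four lists, for the positive and negative parts of the real and of the imaginary part.
  The type is countable, so its elements can be numbered independently of the fibre.\<close>

type_synonym bump_code =
  "((rat \<times> nat \<times> nat) list \<times> (rat \<times> nat \<times> nat) list) \<times>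
   ((rat \<times> nat \<times> nat) list \<times> (rat \<times> nat \<times> nat) list)"

definition bump_fun :: "(nat \<Rightarrow> nat \<Rightarrow> real) \<Rightarrow> (nat \<Rightarrow> real) \<Rightarrow> bump_code \<Rightarrow> complex" where
  "bump_fun D \<delta> = (\<lambda>((l1, l2), (l3, l4)).
     Complex (bump_max D \<delta> l1 - bump_max D \<delta> l2) (bump_max D \<delta> l3 - bump_max D \<delta> l4))"

lemma bump_max_nonneg: "0 \<le> bump_max D \<delta> l"
  by (induction D \<delta> l rule: bump_max.induct) auto

lemma bump_max_ge: "(q, n, k) \<in> set l \<Longrightarrow> of_rat q * bump D n k (\<delta> n) \<le> bump_max D \<delta> l"
  by (induction D \<delta> l rule: bump_max.induct) auto

lemma bump_max_le:
  "0 \<le> b \<Longrightarrow> (\<And>q n k. (q, n, k) \<in> set l \<Longrightarrow> of_rat q * bump D n k (\<delta> n) \<le> b) \<Longrightarrow> bump_max D \<delta> l \<le> b"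
  by (induction D \<delta> l rule: bump_max.induct) auto

lemma continuous_map_comp_euclidean:
  assumes "continuous_map T euclidean F" "continuous_on UNIV g"
  shows "continuous_map T euclidean (\<lambda>v. g (F v))"
  using continuous_map_compose[OF assms(1), of euclidean g] assms(2) by (simp add: o_def)

context complete_dense_metric
begin

lemma continuous_map_mdist: "x \<in> M \<Longrightarrow> continuous_map mtopology euclidean (\<lambda>v. d x v)"
  unfolding continuous_map_euclidean_iff
proof (intro ballI allI impI)
  fix v and \<epsilon> :: real assume x: "x \<in> M" and v: "v \<in> M" and "\<epsilon> > 0"
  moreover have "dist (d x v) (d x w) \<le> d v w" if "w \<in> M" for w
    using triangle[OF x v that] triangle[OF x that v] commute[of v w] by (simp add: dist_real_def abs_le_iff)
  ultimately show "\<exists>\<delta>>0. \<forall>y. y \<in> M \<and> d v y < \<delta> \<longrightarrow> dist (d x v) (d x y) < \<epsilon>"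
    by (intro exI[of _ \<epsilon>]) (auto intro: le_less_trans)
qed

lemma continuous_map_bump: "continuous_map mtopology euclideanreal (\<lambda>v. bump D n k (d (c n) v))"
proof (cases "totally_bounded_indices D (\<lambda>m. D n m < inverse (real (Suc k)))")
  case True
  have "continuous_on UNIV (\<lambda>r. max 0 (min 1 (2 - 2 * real (Suc k) * r)))"
    by (intro continuous_intros)
  then show ?thesis
    unfolding bump_def using True continuous_map_comp_euclidean[OF continuous_map_mdist[OF c_in]] by simp
qed (simp add: bump_def)

lemma continuous_map_bump_max:
  "continuous_map mtopology euclideanreal (\<lambda>v. bump_max D (\<lambda>n. d (c n) v) l)"
proof (induction l)
  case (Cons a l)
  obtain q n k where a: "a = (q, n, k)" by (cases a)
  show ?case
    unfolding a bump_max.simps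
    by (intro continuous_map_real_max Cons continuous_map_real_mult_left continuous_map_bump)
qed simp

lemma mtotally_bounded_bump: "mtotally_bounded {v \<in> M. bump D n k (d (c n) v) \<noteq> 0}"
proof (cases "totally_bounded_indices D (\<lambda>m. D n m < inverse (real (Suc k)))")
  case True
  define S where "S = c ` {m. D n m < inverse (real (Suc k))}"
  have "mtotally_bounded (mtopology closure_of S)"
    using True unfolding totally_bounded_indices_iff S_def by (rule mtotally_bounded_closure_of)
  moreover have "{v \<in> M. bump D n k (d (c n) v) \<noteq> 0} \<subseteq> mtopology closure_of S"
  proof
    fix v assume "v \<in> {v \<in> M. bump D n k (d (c n) v) \<noteq> 0}"
    then have v: "v \<in> M" and "2 - 2 * real (Suc k) * d (c n) v > 0"
      by (auto simp: bump_def max_def min_def split: if_splits)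
    then have dv: "d (c n) v < inverse (real (Suc k))"
      by (simp add: field_simps)
    have "\<exists>y\<in>S. y \<in> mball v r" if r: "r > 0" for r
    proof -
      \<comment> \<open>A dense point within \<open>e\<close> of \<open>v\<close> is both
        \<open>r\<close>-close to \<open>v\<close> and still inside the ball around
        \<open>c n\<close>, by the margin that \<open>v\<close> has to its boundary.\<close>
      define e where "e = min r (inverse (real (Suc k)) - d (c n) v)"
      have "e > 0" using r dv by (simp add: e_def)
      then obtain m where m: "d (c m) v < e" using approx[OF v] by blast
      have "D n m \<le> d (c n) v + d v (c m)" using v by (intro triangle) auto
      then have "D n m < inverse (real (Suc k))" using m commute[of v "c m"] by (simp add: e_def)
      then have "c m \<in> S" by (simp add: S_def)
      moreover have "c m \<in> mball v r" using m v commute[of v "c m"] by (simp add: e_def)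
      ultimately show ?thesis by blast
    qed
    then show "v \<in> mtopology closure_of S" unfolding metric_closure_of using v by blast
  qed
  ultimately show ?thesis by (rule mtotally_bounded_subset)
qed (simp add: bump_def)

lemma mtotally_bounded_bump_max:
  "mtotally_bounded {v \<in> M. bump_max D (\<lambda>n. d (c n) v) l \<noteq> 0}"
proof (induction l)
  case (Cons a l)
  obtain q n k where a: "a = (q, n, k)" by (cases a)
  have "{v \<in> M. bump_max D (\<lambda>n. d (c n) v) (a # l) \<noteq> 0} \<subseteq>
      {v \<in> M. bump_max D (\<lambda>n. d (c n) v) l \<noteq> 0} \<union> {v \<in> M. bump D n k (d (c n) v) \<noteq> 0}"
    by (auto simp: a)
  with mtotally_bounded_Un[OF Cons mtotally_bounded_bump] show ?case by (rule mtotally_bounded_subset)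
qed simp

definition bump_section :: "bump_code \<Rightarrow> 'a \<Rightarrow> complex" where
  "bump_section p = (\<lambda>v\<in>M. bump_fun D (\<lambda>n. d (c n) v) p)"

lemma bump_section_in_Cc: "bump_section p \<in> Cc_set mtopology"
proof -
  obtain l1 l2 l3 l4 where p: "p = ((l1, l2), (l3, l4))" by (metis prod.exhaust)
  let ?b = "\<lambda>l v. bump_max D (\<lambda>n. d (c n) v) l"
  have "continuous_map mtopology euclidean (\<lambda>v. bump_fun D (\<lambda>n. d (c n) v) p)"
  proof -
    have "continuous_map mtopology euclideanreal (\<lambda>v. ?b l v - ?b l' v)" for l l'
      by (intro continuous_map_diff continuous_map_bump_max)
    then have "continuous_map mtopology euclidean (\<lambda>v. complex_of_real (?b l v - ?b l' v))" for l l'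
      by (rule continuous_map_comp_euclidean) (intro continuous_intros)
    moreover from this have "continuous_map mtopology euclidean (\<lambda>v. \<i> * complex_of_real (?b l v - ?b l' v))" for l l'
      by (rule continuous_map_comp_euclidean) (intro continuous_intros)
    ultimately have "continuous_map mtopology euclidean
        (\<lambda>v. complex_of_real (?b l1 v - ?b l2 v) + \<i> * complex_of_real (?b l3 v - ?b l4 v))"
      by (intro continuous_map_add)
    moreover have "bump_fun D (\<lambda>n. d (c n) v) p =
        complex_of_real (?b l1 v - ?b l2 v) + \<i> * complex_of_real (?b l3 v - ?b l4 v)" for v
      by (simp add: p bump_fun_def complex_eq_iff)
    ultimately show ?thesis by (simp only:)
  qed
  then have "continuous_map mtopology euclidean (bump_section p)"
    by (rule continuous_map_eq) (simp add: bump_section_def)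
  moreover have "mtotally_bounded {v \<in> M. bump_section p v \<noteq> 0}"
  proof (rule mtotally_bounded_subset)
    show "mtotally_bounded (({v \<in> M. ?b l1 v \<noteq> 0} \<union> {v \<in> M. ?b l2 v \<noteq> 0}) \<union>
        ({v \<in> M. ?b l3 v \<noteq> 0} \<union> {v \<in> M. ?b l4 v \<noteq> 0}))"
      by (intro mtotally_bounded_Un mtotally_bounded_bump_max)
  qed (auto simp: bump_section_def p bump_fun_def complex_eq_iff)
  ultimately show ?thesis
    unfolding Cc_set_iff_mtotally_bounded by (simp add: bump_section_def)
qed

lemma bump_range: "0 \<le> bump D n k r" "bump D n k r \<le> 1"
  by (auto simp: bump_def)

lemma bump_eq_0: "inverse (real (Suc k)) \<le> r \<Longrightarrow> bump D n k r = 0"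
  by (auto simp: bump_def field_simps)

lemma bump_eq_1:
  "totally_bounded_indices D (\<lambda>m. D n m < inverse (real (Suc k))) \<Longrightarrow>
    r < inverse (real (Suc k)) / 2 \<Longrightarrow> bump D n k r = 1"
  by (auto simp: bump_def field_simps)

text \<open>A nonnegative function is approximated from below: around each point take a rational constant
  slightly below the function times a bump, and cover the compact set where the function is
  not small.\<close>

lemma bump_max_approx:
  assumes lc: "locally_compact_space mtopology"
    and h: "continuous_map mtopology euclideanreal h" "\<And>v. v \<in> M \<Longrightarrow> 0 \<le> h v"
    and K: "compactin mtopology K" "\<And>v. v \<in> M - K \<Longrightarrow> h v < \<epsilon>" and \<epsilon>: "\<epsilon> > 0"
  shows "\<exists>l. \<forall>v\<in>M. \<bar>h v - bump_max D (\<lambda>n. d (c n) v) l\<bar> \<le> \<epsilon>"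
proof -
  \<comment> \<open>The admissible triples: on the whole ball \<open>h\<close> stays between
    \<open>q\<close> and \<open>q + \<epsilon>\<close>, so that \<open>q\<close> times the bump is
    below \<open>h\<close> everywhere; on the half ball \<open>U\<close>, where the bump is 1, it is
    within \<open>\<epsilon>\<close> of \<open>h\<close>.\<close>
  define G where "G = {(q :: rat, n, k).
    totally_bounded_indices D (\<lambda>m. D n m < inverse (real (Suc k))) \<and>
    (\<forall>w\<in>mball (c n) (inverse (real (Suc k))). of_rat q \<le> h w \<and> h w \<le> of_rat q + \<epsilon>)}"
  define U where "U = (\<lambda>(q :: rat, n, k). mball (c n) (inverse (real (Suc k)) / 2))"
  have cover: "\<exists>t\<in>G. v \<in> U t" if v: "v \<in> M" for v
  proof -
    obtain \<delta> where \<delta>: "\<delta> > 0" "\<And>w. w \<in> M \<Longrightarrow> d v w < \<delta> \<Longrightarrow> dist (h v) (h w) < \<epsilon> / 4"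
      using h(1)[unfolded continuous_map_euclidean_iff, rule_format, OF v, of "\<epsilon> / 4"] \<epsilon> by auto
    obtain W L where L: "openin mtopology W" "compactin mtopology L" "v \<in> W" "W \<subseteq> L"
      using lc v unfolding locally_compact_space_def by auto
    obtain r where r: "r > 0" "mball v r \<subseteq> W" using L(1,3) openin_mtopology by blast
    obtain k where k: "inverse (real (Suc k)) < min \<delta> r / 2"
      using reals_Archimedean[of "min \<delta> r / 2"] \<delta>(1) r(1) by auto
    define \<rho> where "\<rho> = inverse (real (Suc k))"
    have \<rho>: "\<rho> > 0" "2 * \<rho> < \<delta>" "2 * \<rho> < r" using k by (auto simp: \<rho>_def)
    obtain n where n: "d (c n) v < \<rho> / 2" using approx[OF v, of "\<rho> / 2"] \<rho> by auto
    have near_v: "d v w < 2 * \<rho>" if w: "w \<in> M" "d (c n) w < \<rho>" for w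
    proof -
      have "d v w \<le> d v (c n) + d (c n) w" using v w by (intro triangle) auto
      then show ?thesis using n w \<rho>(1) commute[of v "c n"] by linarith
    qed
    have "c ` {m. D n m < \<rho>} \<subseteq> L"
    proof
      fix y assume "y \<in> c ` {m. D n m < \<rho>}"
      then have "y \<in> M" "d v y < 2 * \<rho>" using near_v by auto
      then have "y \<in> mball v r" using v \<rho>(3) by simp
      then show "y \<in> L" using r(2) L(4) by blast
    qed
    then have "mtotally_bounded (c ` {m. D n m < \<rho>})"
      by (rule mtotally_bounded_subset[OF compactin_imp_mtotally_bounded[OF L(2)]])
    then have tb: "totally_bounded_indices D (\<lambda>m. D n m < \<rho>)"
      unfolding totally_bounded_indices_iff .
    \<comment> \<open>On the ball \<open>h\<close> varies by less than \<open>\<epsilon> / 4\<close>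
      from \<open>h v\<close>; hence \<open>q\<close> is taken at least
      \<open>\<epsilon> / 4\<close> below \<open>h v\<close>, and at most
      \<open>\<epsilon> / 2\<close> below so as to remain within \<open>\<epsilon>\<close> of
      \<open>h\<close>.\<close>
    obtain q :: rat where q: "h v - \<epsilon> / 2 < of_rat q" "of_rat q < h v - \<epsilon> / 4"
      using of_rat_dense[of "h v - \<epsilon> / 2" "h v - \<epsilon> / 4"] \<epsilon> by auto
    have "of_rat q \<le> h w \<and> h w \<le> of_rat q + \<epsilon>" if w: "w \<in> mball (c n) \<rho>" for w
    proof -
      have "d v w < \<delta>" using near_v[of w] w \<rho>(2) by auto
      then have "dist (h v) (h w) < \<epsilon> / 4" using \<delta>(2) w by auto
      then have "h v - h w < \<epsilon> / 4" "h w - h v < \<epsilon> / 4" unfolding dist_real_def by linarith+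
      then show ?thesis using q \<epsilon> by linarith
    qed
    then have "(q, n, k) \<in> G" using tb by (simp add: G_def \<rho>_def)
    moreover have "v \<in> U (q, n, k)" using n v by (simp add: U_def \<rho>_def)
    ultimately show ?thesis by blast
  qed
  have KM: "K \<subseteq> M" using compactin_subset_topspace[OF K(1)] by simp
  have "K \<subseteq> \<Union>(U ` G)" using cover KM by blast
  moreover have "\<forall>V\<in>U ` G. openin mtopology V" by (auto simp: U_def)
  ultimately obtain \<F> where \<F>: "finite \<F>" "\<F> \<subseteq> U ` G" "K \<subseteq> \<Union>\<F>"
    using K(1) unfolding compactin_def by meson
  obtain H where H: "H \<subseteq> G" "finite H" "\<F> = U ` H"
    using finite_subset_image[OF \<F>(1,2)] by blast
  obtain l where l: "set l = H" using finite_list[OF H(2)] by blast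
  have "\<bar>h v - bump_max D (\<lambda>n. d (c n) v) l\<bar> \<le> \<epsilon>" if v: "v \<in> M" for v
  proof -
    have upper: "bump_max D (\<lambda>n. d (c n) v) l \<le> h v"
    proof (rule bump_max_le[OF h(2)[OF v]])
      fix q n k assume "(q, n, k) \<in> set l"
      then have g: "(q, n, k) \<in> G" using l H by blast
      show "of_rat q * bump D n k (d (c n) v) \<le> h v"
      proof (cases "d (c n) v < inverse (real (Suc k))")
        case True
        then have "of_rat q \<le> h v" using g v by (simp add: G_def)
        \<comment> \<open>\<open>q\<close> may be negative; in that case the product is at most 0,
          which is below \<open>h v\<close> by nonnegativity.\<close>
        moreover have "of_rat q * bump D n k (d (c n) v) \<le> max 0 (of_rat q) * 1"
          by (rule mult_mono) (use bump_range in auto)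
        ultimately show ?thesis using h(2)[OF v] by simp
      next
        case False
        then show ?thesis using bump_eq_0[of k "d (c n) v" n] h(2)[OF v] by simp
      qed
    qed
    have lower: "h v \<le> bump_max D (\<lambda>n. d (c n) v) l + \<epsilon>"
    proof (cases "v \<in> K")
      case True
      then obtain t where t: "t \<in> H" "v \<in> U t" using \<F>(3) H(3) by blast
      obtain q n k where qnk: "t = (q, n, k)" by (cases t)
      have g: "(q, n, k) \<in> G" using t H qnk by blast
      have dv: "d (c n) v < inverse (real (Suc k)) / 2" using t(2) by (simp add: U_def qnk)
      moreover have "0 \<le> d (c n) v" by simp
      ultimately have "d (c n) v < inverse (real (Suc k))" by linarith
      then have "h v \<le> of_rat q + \<epsilon>" using g v by (simp add: G_def)
      moreover have "bump D n k (d (c n) v) = 1"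
        using g dv by (intro bump_eq_1) (simp_all add: G_def)
      ultimately show ?thesis
        using bump_max_ge[of q n k l D "\<lambda>n. d (c n) v"] t(1) l qnk by simp
    next
      case False
      then have "h v < \<epsilon>" using K(2) v by blast
      then show ?thesis using bump_max_nonneg[of D "\<lambda>n. d (c n) v" l] by linarith
    qed
    show ?thesis using upper lower by linarith
  qed
  then show ?thesis by blast
qed

text \<open>The positive and negative parts of the real and imaginary parts of \<open>F\<close> are
  dominated by its modulus, so they vanish at infinity with the same compact set. Each is
  approximated up to \<open>\<epsilon> / 4\<close>, and the four errors add up to
  \<open>\<epsilon>\<close>.\<close>

lemma bump_section_dense:
  assumes lc: "locally_compact_space mtopology" and F: "F \<in> C0_set mtopology" and \<epsilon>: "\<epsilon> > 0"
  shows "\<exists>p. \<forall>v\<in>M. cmod (F v - bump_section p v) \<le> \<epsilon>"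
proof -
  obtain K where K: "compactin mtopology K" "\<And>v. v \<in> M - K \<Longrightarrow> cmod (F v) < \<epsilon> / 4"
    using C0_setD(3)[OF F, of "\<epsilon> / 4"] \<epsilon> by auto
  have part: "\<exists>l. \<forall>v\<in>M. \<bar>max 0 (g (F v)) - bump_max D (\<lambda>n. d (c n) v) l\<bar> \<le> \<epsilon> / 4"
    if g: "continuous_on UNIV g" "\<And>z. g z \<le> cmod z" for g :: "complex \<Rightarrow> real"
  proof (rule bump_max_approx[OF lc _ _ K(1)])
    have "continuous_on UNIV (\<lambda>z. max 0 (g z))" using g(1) by (intro continuous_intros)
    then show "continuous_map mtopology euclideanreal (\<lambda>v. max 0 (g (F v)))"
      by (rule continuous_map_comp_euclidean[OF C0_setD(2)[OF F]])
    show "max 0 (g (F v)) < \<epsilon> / 4" if "v \<in> M - K" for v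
      using K(2)[OF that] g(2)[of "F v"] \<epsilon> by simp
  qed (use \<epsilon> in auto)
  have cont: "continuous_on UNIV (\<lambda>z. Re z)" "continuous_on UNIV (\<lambda>z. - Re z)"
    "continuous_on UNIV (\<lambda>z. Im z)" "continuous_on UNIV (\<lambda>z. - Im z)"
    by (intro continuous_intros)+
  have le: "Re z \<le> cmod z" "- Re z \<le> cmod z" "Im z \<le> cmod z" "- Im z \<le> cmod z" for z
    using abs_Re_le_cmod[of z] abs_Im_le_cmod[of z] by linarith+
  obtain l1 where l1: "\<forall>v\<in>M. \<bar>max 0 (Re (F v)) - bump_max D (\<lambda>n. d (c n) v) l1\<bar> \<le> \<epsilon> / 4"
    using part[OF cont(1) le(1)] by blast
  obtain l2 where l2: "\<forall>v\<in>M. \<bar>max 0 (- Re (F v)) - bump_max D (\<lambda>n. d (c n) v) l2\<bar> \<le> \<epsilon> / 4"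
    using part[OF cont(2) le(2)] by blast
  obtain l3 where l3: "\<forall>v\<in>M. \<bar>max 0 (Im (F v)) - bump_max D (\<lambda>n. d (c n) v) l3\<bar> \<le> \<epsilon> / 4"
    using part[OF cont(3) le(3)] by blast
  obtain l4 where l4: "\<forall>v\<in>M. \<bar>max 0 (- Im (F v)) - bump_max D (\<lambda>n. d (c n) v) l4\<bar> \<le> \<epsilon> / 4"
    using part[OF cont(4) le(4)] by blast
  define p :: bump_code where "p = ((l1, l2), (l3, l4))"
  have "cmod (F v - bump_section p v) \<le> \<epsilon>" if v: "v \<in> M" for v
  proof -
    have parts: "\<bar>x - (a - b)\<bar> \<le> \<epsilon> / 2"
      if "\<bar>max 0 x - a\<bar> \<le> \<epsilon> / 4" "\<bar>max 0 (- x) - b\<bar> \<le> \<epsilon> / 4" for x a b :: real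
      using that unfolding max_def abs_le_iff by (auto split: if_splits)
    have "\<bar>Re (F v - bump_section p v)\<bar> \<le> \<epsilon> / 2"
      using parts[OF bspec[OF l1 v] bspec[OF l2 v]] v by (simp add: bump_section_def p_def bump_fun_def)
    moreover have "\<bar>Im (F v - bump_section p v)\<bar> \<le> \<epsilon> / 2"
      using parts[OF bspec[OF l3 v] bspec[OF l4 v]] v by (simp add: bump_section_def p_def bump_fun_def)
    ultimately show ?thesis using cmod_le[of "F v - bump_section p v"] by linarith
  qed
  then show ?thesis by blast
qed

end

section \<open>The normed spaces of continuous functions\<close>

lemma C0_set_continuous: "F \<in> C0_set T \<Longrightarrow> continuous_map T euclidean F"
  and C0_set_extensional: "F \<in> C0_set T \<Longrightarrow> F \<in> extensional (topspace T)"
  and C0_set_small: "F \<in> C0_set T \<Longrightarrow> \<epsilon> > 0 \<Longrightarrow>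
    \<exists>K. compactin T K \<and> (\<forall>v \<in> topspace T - K. cmod (F v) < \<epsilon>)"
  by (simp_all add: C0_set_def)

lemma continuous_map_restrict:
  "continuous_map T euclidean H \<Longrightarrow> continuous_map T euclidean (\<lambda>v\<in>topspace T. H v)"
  by (rule continuous_map_eq) auto

lemma continuous_map_complex_mult:
  fixes F G :: "'v \<Rightarrow> complex"
  assumes "continuous_map T euclidean F" "continuous_map T euclidean G"
  shows "continuous_map T euclidean (\<lambda>v. F v * G v)"
  using assms by (simp add: continuous_map_atin tendsto_mult)

text \<open>Scalar multiples, conjugates and products with a bounded factor are all dominated by a
  function in C_0, so one argument gives closure under these operations.\<close>

lemma C0_set_dominated:
  assumes F: "F \<in> C0_set T" and H: "continuous_map T euclidean H"
    and le: "\<And>v. v \<in> topspace T \<Longrightarrow> cmod (H v) \<le> b * cmod (F v)"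
  shows "(\<lambda>v\<in>topspace T. H v) \<in> C0_set T"
proof -
  have "\<exists>K. compactin T K \<and> (\<forall>v \<in> topspace T - K. cmod (H v) < \<epsilon>)" if \<epsilon>: "\<epsilon> > 0" for \<epsilon>
  proof -
    \<comment> \<open>The denominator is positive also for \<open>b = 0\<close> and for negative
      \<open>b\<close>.\<close>
    obtain K where K: "compactin T K" "\<And>v. v \<in> topspace T - K \<Longrightarrow> cmod (F v) < \<epsilon> / (\<bar>b\<bar> + 1)"
      using C0_set_small[OF F, of "\<epsilon> / (\<bar>b\<bar> + 1)"] \<epsilon> by auto
    have "cmod (H v) < \<epsilon>" if v: "v \<in> topspace T - K" for v
    proof -
      have "cmod (H v) \<le> (\<bar>b\<bar> + 1) * cmod (F v)"
      proof -
        have "b * cmod (F v) \<le> (\<bar>b\<bar> + 1) * cmod (F v)" by (intro mult_right_mono) auto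
        then show ?thesis using le[of v] v by auto
      qed
      also have "\<dots> < \<epsilon>" using K(2)[OF v] by (simp add: field_simps)
      finally show ?thesis .
    qed
    then show ?thesis using K(1) by blast
  qed
  then show ?thesis unfolding C0_set_def using continuous_map_restrict[OF H] by simp
qed

lemma C0_set_add:
  assumes F: "F \<in> C0_set T" and G: "G \<in> C0_set T"
  shows "(\<lambda>v\<in>topspace T. F v + G v) \<in> C0_set T"
proof -
  have "\<exists>K. compactin T K \<and> (\<forall>v \<in> topspace T - K. cmod (F v + G v) < \<epsilon>)" if \<epsilon>: "\<epsilon> > 0" for \<epsilon>
  proof -
    obtain K where K: "compactin T K" "\<And>v. v \<in> topspace T - K \<Longrightarrow> cmod (F v) < \<epsilon> / 2"
      using C0_set_small[OF F, of "\<epsilon> / 2"] \<epsilon> by auto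
    obtain L where L: "compactin T L" "\<And>v. v \<in> topspace T - L \<Longrightarrow> cmod (G v) < \<epsilon> / 2"
      using C0_set_small[OF G, of "\<epsilon> / 2"] \<epsilon> by auto
    have "cmod (F v + G v) < \<epsilon>" if "v \<in> topspace T - (K \<union> L)" for v
      using K(2)[of v] L(2)[of v] that norm_triangle_ineq[of "F v" "G v"] by simp
    then show ?thesis using compactin_Un[OF K(1) L(1)] by blast
  qed
  moreover have "continuous_map T euclidean (\<lambda>v\<in>topspace T. F v + G v)"
    using F G by (intro continuous_map_restrict continuous_map_add C0_set_continuous)
  ultimately show ?thesis unfolding C0_set_def by simp
qed

lemma C0_set_smult:
  assumes "F \<in> C0_set T"
  shows "(\<lambda>v\<in>topspace T. z * F v) \<in> C0_set T"
proof (rule C0_set_dominated[OF assms, of _ "cmod z"])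
  show "continuous_map T euclidean (\<lambda>v. z * F v)"
    by (rule continuous_map_comp_euclidean[OF C0_set_continuous[OF assms]]) (intro continuous_intros)
qed (simp add: norm_mult)

lemma C0_set_cnj:
  assumes "F \<in> C0_set T"
  shows "(\<lambda>v\<in>topspace T. cnj (F v)) \<in> C0_set T"
proof (rule C0_set_dominated[OF assms, of _ 1])
  show "continuous_map T euclidean (\<lambda>v. cnj (F v))"
    by (rule continuous_map_comp_euclidean[OF C0_set_continuous[OF assms]]) (intro continuous_intros)
qed simp

lemma C0_set_mult:
  assumes F: "F \<in> C0_set T" and G: "G \<in> C0_set T"
  shows "(\<lambda>v\<in>topspace T. F v * G v) \<in> C0_set T"
proof -
  obtain b where b: "\<forall>v\<in>topspace T. cmod (F v) \<le> b" using C0_set_bounded[OF F] by blast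
  show ?thesis
  proof (rule C0_set_dominated[OF G, of _ b])
    show "continuous_map T euclidean (\<lambda>v. F v * G v)"
      by (intro continuous_map_complex_mult C0_set_continuous F G)
  qed (use b in \<open>auto simp: norm_mult intro!: mult_right_mono\<close>)
qed

lemma C0_set_zero: "(\<lambda>v\<in>topspace T. 0) \<in> C0_set T"
  unfolding C0_set_def by (auto intro: continuous_map_restrict exI[of _ "{}"])

lemma C0_set_minus: "F \<in> C0_set T \<Longrightarrow> (\<lambda>v\<in>topspace T. - F v) \<in> C0_set T"
  using C0_set_smult[of F T "-1"] by simp

lemma Cc_set_support:
  assumes "F \<in> extensional (topspace T)" "continuous_map T euclidean F" "compactin T K"
    "T closure_of {v \<in> topspace T. F v \<noteq> 0} \<subseteq> K"
  shows "F \<in> Cc_set T"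
  using assms closed_compactin[OF assms(3,4)] by (simp add: Cc_set_def)

lemma Cc_set_add:
  assumes F: "F \<in> Cc_set T" and G: "G \<in> Cc_set T"
  shows "(\<lambda>v\<in>topspace T. F v + G v) \<in> Cc_set T"
proof (rule Cc_set_support)
  show "continuous_map T euclidean (\<lambda>v\<in>topspace T. F v + G v)"
    using F G by (intro continuous_map_restrict continuous_map_add) (auto simp: Cc_set_def)
  show "compactin T (T closure_of {v \<in> topspace T. F v \<noteq> 0} \<union> T closure_of {v \<in> topspace T. G v \<noteq> 0})"
    using F G by (intro compactin_Un) (auto simp: Cc_set_def)
  show "T closure_of {v \<in> topspace T. (\<lambda>v\<in>topspace T. F v + G v) v \<noteq> 0} \<subseteq>
      T closure_of {v \<in> topspace T. F v \<noteq> 0} \<union> T closure_of {v \<in> topspace T. G v \<noteq> 0}"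
    unfolding closure_of_Un[symmetric] by (rule closure_of_mono) auto
qed auto

lemma Cc_set_smult:
  assumes F: "F \<in> Cc_set T"
  shows "(\<lambda>v\<in>topspace T. z * F v) \<in> Cc_set T"
proof (rule Cc_set_support)
  show "continuous_map T euclidean (\<lambda>v\<in>topspace T. z * F v)"
    using F by (intro continuous_map_restrict continuous_map_complex_mult) (auto simp: Cc_set_def)
  show "compactin T (T closure_of {v \<in> topspace T. F v \<noteq> 0})"
    using F by (auto simp: Cc_set_def)
  show "T closure_of {v \<in> topspace T. (\<lambda>v\<in>topspace T. z * F v) v \<noteq> 0} \<subseteq>
      T closure_of {v \<in> topspace T. F v \<noteq> 0}"
    by (rule closure_of_mono) auto
qed auto

lemma Cc_set_zero: "(\<lambda>v\<in>topspace T. 0) \<in> Cc_set T"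
  by (rule Cc_set_support[where K = "{}"]) (auto intro: continuous_map_restrict)

lemma cring_complex_ring: "cring complex_ring"
proof (rule cringI)
  show "abelian_group complex_ring"
    by (rule abelian_groupI) (auto simp: complex_ring_def intro: exI[of _ "- _"] add.left_inverse)
  show "comm_monoid complex_ring"
    by (rule comm_monoidI) (auto simp: complex_ring_def)
qed (auto simp: complex_ring_def distrib_right)

section \<open>The supremum norm on subspaces of C_0\<close>

definition sup_norm :: "'v topology \<Rightarrow> ('v \<Rightarrow> complex) \<Rightarrow> real" where
  "sup_norm T F = (SUP v\<in>topspace T. cmod (F v))"

lemma sup_norm_restrict [simp]: "sup_norm T (\<lambda>v\<in>topspace T. F v) = sup_norm T F"
  by (simp add: sup_norm_def cong: SUP_cong)

text \<open>The supremum of reals is meaningful because functions in C_0 are bounded and the space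
  is nonempty. Later estimates of norms and distances are reduced to points through this
  equivalence.\<close>

lemma sup_norm_le_iff:
  assumes "topspace T \<noteq> {}" "F \<in> C0_set T"
  shows "sup_norm T F \<le> b \<longleftrightarrow> (\<forall>v\<in>topspace T. cmod (F v) \<le> b)"
proof -
  have "bdd_above ((\<lambda>v. cmod (F v)) ` topspace T)"
    using C0_set_bounded[OF assms(2)] by (auto simp: bdd_above_def)
  then show ?thesis unfolding sup_norm_def by (rule cSUP_le_iff[OF assms(1)])
qed

lemma sup_norm_upper:
  assumes "F \<in> C0_set T" "v \<in> topspace T"
  shows "cmod (F v) \<le> sup_norm T F"
proof -
  have "topspace T \<noteq> {}" using assms(2) by blast
  from sup_norm_le_iff[OF this assms(1), of "sup_norm T F"] show ?thesis using assms(2) by blast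
qed

lemma sup_norm_nonneg:
  assumes "topspace T \<noteq> {}" "F \<in> C0_set T"
  shows "0 \<le> sup_norm T F"
proof -
  obtain v where "v \<in> topspace T" using assms(1) by blast
  then show ?thesis using sup_norm_upper[OF assms(2)] norm_ge_zero order_trans by blast
qed

lemma C0_alg_simps [simp]:
  "carrier (C0_alg T) = C0_set T"
  "mult (C0_alg T) = (\<lambda>F G. \<lambda>v\<in>topspace T. F v * G v)"
  "zero (C0_alg T) = (\<lambda>v\<in>topspace T. 0)"
  "add (C0_alg T) = (\<lambda>F G. \<lambda>v\<in>topspace T. F v + G v)"
  "smult (C0_alg T) = (\<lambda>c F. \<lambda>v\<in>topspace T. c * F v)"
  "nrm (C0_alg T) = sup_norm T"
  "adj (C0_alg T) = (\<lambda>F. \<lambda>v\<in>topspace T. cnj (F v))"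
  by (simp_all add: C0_alg_def sup_norm_def fun_eq_iff)

text \<open>The algebra \<open>C\<^sub>0\<close> and the normed space \<open>C\<^sub>c\<close> are treated at once, as subspaces \<open>S\<close> of \<open>C\<^sub>0\<close>.\<close>

locale C0_subspace =
  fixes T :: "'v topology" and S :: "('v \<Rightarrow> complex) set"
  assumes nonempty: "topspace T \<noteq> {}"
    and sub: "S \<subseteq> C0_set T"
    and add_closed: "\<And>F G. F \<in> S \<Longrightarrow> G \<in> S \<Longrightarrow> (\<lambda>v\<in>topspace T. F v + G v) \<in> S"
    and smult_closed: "\<And>z F. F \<in> S \<Longrightarrow> (\<lambda>v\<in>topspace T. z * F v) \<in> S"
    and zero_closed: "(\<lambda>v\<in>topspace T. 0) \<in> S"
begin

definition E :: "('v \<Rightarrow> complex) normed_star" where "E = (C0_alg T)\<lparr>carrier := S\<rparr>"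

lemma E_simps [simp]:
  "carrier E = S"
  "zero E = (\<lambda>v\<in>topspace T. 0)"
  "add E = (\<lambda>F G. \<lambda>v\<in>topspace T. F v + G v)"
  "smult E = (\<lambda>c F. \<lambda>v\<in>topspace T. c * F v)"
  "nrm E = sup_norm T"
  by (simp_all add: E_def)

lemma ext_eqI:
  assumes "F \<in> S" "G \<in> S" "\<And>v. v \<in> topspace T \<Longrightarrow> F v = G v"
  shows "F = G"
  using assms sub by (intro extensionalityI[of _ "topspace T"]) (auto intro: C0_set_extensional)

lemma restrict_self: "F \<in> S \<Longrightarrow> (\<lambda>v\<in>topspace T. F v) = F"
  using sub C0_set_extensional by (intro extensional_restrict) blast

lemma neg_closed: "F \<in> S \<Longrightarrow> (\<lambda>v\<in>topspace T. - F v) \<in> S"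
  using smult_closed[of F "-1"] by simp

lemma abelian_group_E: "abelian_group E"
proof (rule abelian_groupI)
  fix F assume "F \<in> carrier E"
  then show "\<exists>G\<in>carrier E. G \<oplus>\<^bsub>E\<^esub> F = \<zero>\<^bsub>E\<^esub>"
    using neg_closed[of F] by (intro bexI[of _ "\<lambda>v\<in>topspace T. - F v"]) (auto simp: fun_eq_iff)
next
  fix F assume "F \<in> carrier E"
  then have F: "F \<in> S" by simp
  have "\<zero>\<^bsub>E\<^esub> \<oplus>\<^bsub>E\<^esub> F = (\<lambda>v\<in>topspace T. F v)" by (auto simp: fun_eq_iff)
  then show "\<zero>\<^bsub>E\<^esub> \<oplus>\<^bsub>E\<^esub> F = F" using restrict_self[OF F] by simp
qed (auto simp: add_closed zero_closed fun_eq_iff)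

lemma module_E: "Module.module complex_ring E"
proof (rule moduleI)
  fix F assume "F \<in> carrier E"
  then have F: "F \<in> S" by simp
  have "\<one>\<^bsub>complex_ring\<^esub> \<odot>\<^bsub>E\<^esub> F = (\<lambda>v\<in>topspace T. F v)"
    by (auto simp: fun_eq_iff complex_ring_def)
  then show "\<one>\<^bsub>complex_ring\<^esub> \<odot>\<^bsub>E\<^esub> F = F" using restrict_self[OF F] by simp
next
  show "cring complex_ring" "abelian_group E" by (rule cring_complex_ring abelian_group_E)+
qed (auto simp: smult_closed complex_ring_def fun_eq_iff algebra_simps)

text \<open>The additive inverse of a record group is given by a description, so subtraction has to
  be identified with the pointwise one before \<open>norm_dist\<close> can be computed.\<close>

lemma minus_E:
  assumes "F \<in> S" "G \<in> S"
  shows "F \<ominus>\<^bsub>E\<^esub> G = (\<lambda>v\<in>topspace T. F v - G v)"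
proof -
  interpret abelian_group E by (rule abelian_group_E)
  have "\<ominus>\<^bsub>E\<^esub> G = (\<lambda>v\<in>topspace T. - G v)"
    by (rule minus_equality) (use assms neg_closed in \<open>auto simp: fun_eq_iff\<close>)
  then show ?thesis by (auto simp: a_minus_def fun_eq_iff)
qed

lemma diff_C0: "F \<in> S \<Longrightarrow> G \<in> S \<Longrightarrow> (\<lambda>v\<in>topspace T. F v - G v) \<in> C0_set T"
  using C0_set_add[of F T "\<lambda>v\<in>topspace T. - G v"] C0_set_minus[of G T] sub
  by (auto cong: restrict_cong)

lemma norm_dist_E:
  assumes "F \<in> S" "G \<in> S"
  shows "norm_dist E F G = sup_norm T (\<lambda>v\<in>topspace T. F v - G v)"
  using assms minus_E[OF assms] by (simp add: norm_dist_def)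

lemma norm_dist_le_iff:
  assumes "F \<in> S" "G \<in> S"
  shows "norm_dist E F G \<le> b \<longleftrightarrow> (\<forall>v\<in>topspace T. cmod (F v - G v) \<le> b)"
  unfolding norm_dist_E[OF assms] sup_norm_le_iff[OF nonempty diff_C0[OF assms]] by simp

lemma norm_dist_upper:
  assumes "F \<in> S" "G \<in> S" "v \<in> topspace T"
  shows "cmod (F v - G v) \<le> norm_dist E F G"
  using norm_dist_le_iff[OF assms(1,2), of "norm_dist E F G"] assms(3) by simp

lemma complex_normed_space_E: "complex_normed_space E"
  unfolding complex_normed_space_def
proof (intro conjI ballI allI module_E)
  fix F assume "F \<in> carrier E"
  then have F: "F \<in> S" "F \<in> C0_set T" using sub by auto
  show "0 \<le> nrm E F" using sup_norm_nonneg[OF nonempty F(2)] by simp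
  show "nrm E F = 0 \<longleftrightarrow> F = \<zero>\<^bsub>E\<^esub>"
  proof
    assume "nrm E F = 0"
    then have "cmod (F v) \<le> 0" if "v \<in> topspace T" for v
      using sup_norm_upper[OF F(2) that] by simp
    then show "F = \<zero>\<^bsub>E\<^esub>" using ext_eqI[OF F(1) zero_closed] by simp
  next
    assume "F = \<zero>\<^bsub>E\<^esub>"
    then show "nrm E F = 0" using nonempty by (simp add: sup_norm_def)
  qed
next
  fix z F assume "F \<in> carrier E"
  then have F: "F \<in> C0_set T" using sub by auto
  have "sup_norm T (\<lambda>v. z * F v) = cmod z * sup_norm T F"
  proof (rule antisym)
    have zF: "(\<lambda>v\<in>topspace T. z * F v) \<in> C0_set T" by (rule C0_set_smult[OF F])
    have "sup_norm T (\<lambda>v\<in>topspace T. z * F v) \<le> cmod z * sup_norm T F"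
      unfolding sup_norm_le_iff[OF nonempty zF]
      using sup_norm_upper[OF F] by (auto simp: norm_mult intro!: mult_left_mono)
    then show "sup_norm T (\<lambda>v. z * F v) \<le> cmod z * sup_norm T F" by simp
    show "cmod z * sup_norm T F \<le> sup_norm T (\<lambda>v. z * F v)"
    proof (cases "z = 0")
      case False
      have "sup_norm T F \<le> sup_norm T (\<lambda>v. z * F v) / cmod z"
        unfolding sup_norm_le_iff[OF nonempty F]
        using sup_norm_upper[OF zF] False by (auto simp: norm_mult field_simps)
      then show ?thesis using False by (simp add: field_simps)
    next
      case True
      then show ?thesis using nonempty by (simp add: sup_norm_def)
    qed
  qed
  then show "nrm E (z \<odot>\<^bsub>E\<^esub> F) = cmod z * nrm E F" by simp
next
  fix F G assume "F \<in> carrier E" "G \<in> carrier E"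
  then have FG: "F \<in> C0_set T" "G \<in> C0_set T" using sub by auto
  have "sup_norm T (\<lambda>v\<in>topspace T. F v + G v) \<le> sup_norm T F + sup_norm T G"
    unfolding sup_norm_le_iff[OF nonempty C0_set_add[OF FG]]
    using sup_norm_upper[OF FG(1)] sup_norm_upper[OF FG(2)]
    by (auto intro!: norm_triangle_mono)
  then show "nrm E (F \<oplus>\<^bsub>E\<^esub> G) \<le> nrm E F + nrm E G" by simp
qed

lemma Metric_space_E: "Metric_space S (norm_dist E)"
proof
  fix F G
  show "0 \<le> norm_dist E F G"
    using norm_dist_E[of F G] sup_norm_nonneg[OF nonempty diff_C0, of F G]
    by (cases "F \<in> S \<and> G \<in> S") (auto simp: norm_dist_def)
  show "norm_dist E F G = norm_dist E G F"
    using norm_dist_E[of F G] norm_dist_E[of G F]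
    by (cases "F \<in> S \<and> G \<in> S") (auto simp: norm_dist_def sup_norm_def norm_minus_commute cong: SUP_cong)
  show "norm_dist E F G = 0 \<longleftrightarrow> F = G" if "F \<in> S" "G \<in> S"
  proof
    assume "norm_dist E F G = 0"
    then show "F = G" using norm_dist_upper[OF that] by (intro ext_eqI[OF that]) fastforce
  next
    assume "F = G"
    then show "norm_dist E F G = 0"
      using norm_dist_E[of F G] that nonempty by (simp add: sup_norm_def)
  qed
  fix H
  show "norm_dist E F H \<le> norm_dist E F G + norm_dist E G H" if "F \<in> S" "G \<in> S" "H \<in> S"
    unfolding norm_dist_le_iff[OF that(1,3)]
  proof
    fix v assume v: "v \<in> topspace T"
    have "cmod (F v - H v) \<le> cmod (F v - G v) + cmod (G v - H v)"
      using norm_triangle_ineq[of "F v - G v" "G v - H v"] by simp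
    then show "cmod (F v - H v) \<le> norm_dist E F G + norm_dist E G H"
      using norm_dist_upper[OF that(1,2) v] norm_dist_upper[OF that(2,3) v] by linarith
  qed
qed

lemma dense_in_norm_topology:
  assumes "A \<subseteq> S" "\<And>F \<epsilon>. F \<in> S \<Longrightarrow> \<epsilon> > 0 \<Longrightarrow> \<exists>G\<in>A. \<forall>v\<in>topspace T. cmod (F v - G v) \<le> \<epsilon>"
  shows "norm_topology E closure_of A = topspace (norm_topology E)"
proof -
  interpret Metric_space S "norm_dist E" by (rule Metric_space_E)
  have "\<exists>G\<in>A. G \<in> mball F r" if F: "F \<in> S" and r: "r > 0" for F r
  proof -
    obtain G where "G \<in> A" "\<forall>v\<in>topspace T. cmod (F v - G v) \<le> r / 2"
      using assms(2)[OF F, of "r / 2"] r by auto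
    then show ?thesis
      using norm_dist_le_iff[of F G "r / 2"] F r assms(1) by (intro bexI[of _ G]) auto
  qed
  then show ?thesis unfolding norm_topology_def E_simps metric_closure_of by auto
qed

end

lemma C0_subspace_C0: "topspace T \<noteq> {} \<Longrightarrow> C0_subspace T (C0_set T)"
  by unfold_locales (auto intro: C0_set_add C0_set_smult C0_set_zero)

lemma C0_subspace_Cc: "topspace T \<noteq> {} \<Longrightarrow> C0_subspace T (Cc_set T)"
  using Cc_set_subset_C0_set by unfold_locales (auto intro: Cc_set_add Cc_set_smult Cc_set_zero)

lemma E_C0: "topspace T \<noteq> {} \<Longrightarrow> C0_subspace.E T (C0_set T) = C0_alg T"
  unfolding C0_subspace.E_def[OF C0_subspace_C0] by (simp add: C0_alg_def)

section \<open>Completeness and the C*-identity\<close>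

lemma complex_banach_space_C0:
  assumes ne: "topspace T \<noteq> {}"
  shows "complex_banach_space (C0_alg T)"
proof -
  interpret C0_subspace T "C0_set T" by (rule C0_subspace_C0[OF ne])
  interpret N: Metric_space "C0_set T" "norm_dist E" by (rule Metric_space_E)
  have "N.mcomplete"
    unfolding N.mcomplete_def
  proof (intro allI impI)
    fix \<sigma> assume \<sigma>: "N.MCauchy \<sigma>"
    then have \<sigma>C: "\<sigma> n \<in> C0_set T" for n unfolding N.MCauchy_def by blast
    have cauchy: "\<exists>N. \<forall>n\<ge>N. \<forall>m\<ge>N. \<forall>v\<in>topspace T. cmod (\<sigma> n v - \<sigma> m v) < \<epsilon>"
      if \<epsilon>: "\<epsilon> > 0" for \<epsilon>
    proof -
      obtain N where N: "\<forall>n n'. N \<le> n \<longrightarrow> N \<le> n' \<longrightarrow> norm_dist E (\<sigma> n) (\<sigma> n') < \<epsilon>"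
        using \<sigma> \<epsilon> unfolding N.MCauchy_def by blast
      have "cmod (\<sigma> n v - \<sigma> m v) < \<epsilon>" if "n \<ge> N" "m \<ge> N" "v \<in> topspace T" for n m v
        using norm_dist_upper[OF \<sigma>C \<sigma>C that(3), of n m] N[rule_format, OF that(1,2)] by linarith
      then show ?thesis by blast
    qed
    define F where "F = (\<lambda>v\<in>topspace T. lim (\<lambda>n. \<sigma> n v))"
    have lim: "(\<lambda>n. \<sigma> n v) \<longlonglongrightarrow> F v" if v: "v \<in> topspace T" for v
    proof -
      have "Cauchy (\<lambda>n. \<sigma> n v)"
        unfolding Cauchy_def dist_norm
      proof (intro allI impI)
        fix \<epsilon> :: real assume "\<epsilon> > 0"
        then obtain N where "\<forall>n\<ge>N. \<forall>m\<ge>N. \<forall>v\<in>topspace T. cmod (\<sigma> n v - \<sigma> m v) < \<epsilon>"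
          using cauchy by blast
        then show "\<exists>N. \<forall>m\<ge>N. \<forall>n\<ge>N. cmod (\<sigma> m v - \<sigma> n v) < \<epsilon>" using v by blast
      qed
      then show ?thesis using v Cauchy_convergent by (simp add: F_def convergent_LIMSEQ_iff)
    qed
    have unif: "\<exists>N. \<forall>n\<ge>N. \<forall>v\<in>topspace T. cmod (\<sigma> n v - F v) \<le> \<epsilon>" if \<epsilon>: "\<epsilon> > 0" for \<epsilon>
    proof -
      obtain N where N: "\<forall>n\<ge>N. \<forall>m\<ge>N. \<forall>v\<in>topspace T. cmod (\<sigma> n v - \<sigma> m v) < \<epsilon>"
        using cauchy[OF \<epsilon>] by blast
      have "cmod (\<sigma> n v - F v) \<le> \<epsilon>" if n: "n \<ge> N" and v: "v \<in> topspace T" for n v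
      proof (rule LIMSEQ_le_const2)
        show "(\<lambda>m. cmod (\<sigma> n v - \<sigma> m v)) \<longlonglongrightarrow> cmod (\<sigma> n v - F v)"
          by (intro tendsto_intros lim v)
        show "\<exists>N. \<forall>m\<ge>N. cmod (\<sigma> n v - \<sigma> m v) \<le> \<epsilon>"
          using N n v by (intro exI[of _ N]) (auto intro: less_imp_le)
      qed
      then show ?thesis by blast
    qed
    have "continuous_map T Met_TC.mtopology F"
    proof (rule Met_TC.continuous_map_uniform_limit[where F = sequentially and f = \<sigma>])
      show "\<forall>\<^sub>F n in sequentially. continuous_map T Met_TC.mtopology (\<sigma> n)"
        using C0_set_continuous[OF \<sigma>C] by simp
      fix \<epsilon> :: real assume "\<epsilon> > 0"
      then obtain N where N: "\<forall>n\<ge>N. \<forall>v\<in>topspace T. cmod (\<sigma> n v - F v) \<le> \<epsilon> / 2"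
        using unif[of "\<epsilon> / 2"] by auto
      have "dist (\<sigma> n v) (F v) < \<epsilon>" if "n \<ge> N" "v \<in> topspace T" for n v
      proof -
        have "cmod (\<sigma> n v - F v) \<le> \<epsilon> / 2" using N that by blast
        then show ?thesis using \<open>\<epsilon> > 0\<close> by (simp add: dist_norm)
      qed
      then show "\<forall>\<^sub>F n in sequentially. \<forall>x\<in>topspace T. F x \<in> UNIV \<and> dist (\<sigma> n x) (F x) < \<epsilon>"
        unfolding eventually_sequentially by blast
    qed simp
    then have cont: "continuous_map T euclidean F" by simp
    have "\<exists>K. compactin T K \<and> (\<forall>v \<in> topspace T - K. cmod (F v) < \<epsilon>)" if \<epsilon>: "\<epsilon> > 0" for \<epsilon>
    proof -
      \<comment> \<open>A single member of the sequence that is uniformly close to the limit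
        supplies the compact set.\<close>
      obtain n where n: "\<forall>v\<in>topspace T. cmod (\<sigma> n v - F v) \<le> \<epsilon> / 2"
        using unif[of "\<epsilon> / 2"] \<epsilon> by auto
      obtain K where K: "compactin T K" "\<forall>v \<in> topspace T - K. cmod (\<sigma> n v) < \<epsilon> / 2"
        using C0_set_small[OF \<sigma>C, of "\<epsilon> / 2" n] \<epsilon> by auto
      have "cmod (F v) < \<epsilon>" if v: "v \<in> topspace T - K" for v
      proof -
        have "cmod (\<sigma> n v - F v) \<le> \<epsilon> / 2" "cmod (\<sigma> n v) < \<epsilon> / 2" using n K(2) v by auto
        then show ?thesis
          using norm_triangle_ineq2[of "F v" "\<sigma> n v"] norm_minus_commute[of "F v" "\<sigma> n v"] by linarith
      qed
      then show ?thesis using K(1) by blast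
    qed
    then have FC: "F \<in> C0_set T" using cont by (simp add: C0_set_def F_def)
    have "limitin N.mtopology \<sigma> F sequentially"
      unfolding N.limit_metric_sequentially
    proof (intro conjI allI impI FC)
      fix \<epsilon> :: real assume "\<epsilon> > 0"
      then obtain N where N: "\<forall>n\<ge>N. \<forall>v\<in>topspace T. cmod (\<sigma> n v - F v) \<le> \<epsilon> / 2"
        using unif[of "\<epsilon> / 2"] by auto
      have "norm_dist E (\<sigma> n) F < \<epsilon>" if "n \<ge> N" for n
        using norm_dist_le_iff[OF \<sigma>C FC, of n "\<epsilon> / 2"] N that \<open>\<epsilon> > 0\<close> by auto
      then show "\<exists>N. \<forall>n\<ge>N. \<sigma> n \<in> C0_set T \<and> norm_dist E (\<sigma> n) F < \<epsilon>" using \<sigma>C by blast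
    qed
    then show "\<exists>x. limitin N.mtopology \<sigma> x sequentially" by blast
  qed
  then show ?thesis
    using complex_normed_space_E unfolding complex_banach_space_def E_C0[OF ne] by simp
qed

lemma cstar_algebra_C0:
  assumes ne: "topspace T \<noteq> {}"
  shows "cstar_algebra (C0_alg T)"
proof -
  have restrict: "(\<lambda>v\<in>topspace T. F v) = F" if "F \<in> C0_set T" for F
    using C0_set_extensional[OF that] by (rule extensional_restrict)
  have "sup_norm T (\<lambda>v\<in>topspace T. F v * G v) \<le> sup_norm T F * sup_norm T G"
    if "F \<in> C0_set T" "G \<in> C0_set T" for F G
    unfolding sup_norm_le_iff[OF ne C0_set_mult[OF that]]
    using sup_norm_upper[OF that(1)] sup_norm_upper[OF that(2)] sup_norm_nonneg[OF ne that(1)]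
    by (auto simp: norm_mult intro!: mult_mono)
  moreover have "sup_norm T (\<lambda>v\<in>topspace T. cnj (F v) * F v) = (sup_norm T F)\<^sup>2"
    if F: "F \<in> C0_set T" for F
  proof (rule antisym)
    have "(\<lambda>v\<in>topspace T. (\<lambda>v\<in>topspace T. cnj (F v)) v * F v) \<in> C0_set T"
      by (rule C0_set_mult[OF C0_set_cnj[OF F] F])
    then have FF: "(\<lambda>v\<in>topspace T. cnj (F v) * F v) \<in> C0_set T" by (simp cong: restrict_cong)
    let ?s = "sup_norm T (\<lambda>v\<in>topspace T. cnj (F v) * F v)"
    show "?s \<le> (sup_norm T F)\<^sup>2"
      unfolding sup_norm_le_iff[OF ne FF]
      using sup_norm_upper[OF F] by (auto simp: norm_mult power2_eq_square intro!: mult_mono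
          sup_norm_nonneg[OF ne F])
    \<comment> \<open>A square cannot be taken through the supremum directly; with the square root
      on the other side the claim becomes a pointwise bound.\<close>
    have "sup_norm T F \<le> sqrt ?s"
      unfolding sup_norm_le_iff[OF ne F]
    proof
      fix v assume v: "v \<in> topspace T"
      have "(cmod (F v))\<^sup>2 \<le> ?s"
        using sup_norm_upper[OF FF v] v by (simp add: norm_mult power2_eq_square)
      then show "cmod (F v) \<le> sqrt ?s" by (rule real_le_rsqrt)
    qed
    then have "(sup_norm T F)\<^sup>2 \<le> (sqrt ?s)\<^sup>2"
      by (rule power_mono) (rule sup_norm_nonneg[OF ne F])
    also have "\<dots> = ?s" using sup_norm_nonneg[OF ne FF] by simp
    finally show "(sup_norm T F)\<^sup>2 \<le> ?s" .
  qed
  ultimately show ?thesis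
    unfolding cstar_algebra_def C0_alg_simps
    using complex_banach_space_C0[OF ne] C0_set_mult C0_set_cnj
    by (auto simp: fun_eq_iff algebra_simps restrict cong: restrict_cong)
qed

section \<open>The field of function spaces\<close>

text \<open>All quantifiers range over natural numbers. Both the distances and the index set depend
  on the parameter, since both vary along the field.\<close>

lemma measurable_totally_bounded_indices:
  assumes [measurable]: "\<And>n m. (\<lambda>w. D w n m) \<in> borel_measurable N"
    and [measurable]: "\<And>n. Measurable.pred N (\<lambda>w. J w n)"
  shows "Measurable.pred N (\<lambda>w. totally_bounded_indices (D w) (J w))"
  unfolding totally_bounded_indices_def by measurable

lemma measurable_unif_cont_values:
  assumes [measurable]: "\<And>n m. (\<lambda>w. D w n m) \<in> borel_measurable N"
    and [measurable]: "\<And>n. (\<lambda>w. a w n) \<in> borel_measurable N"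
  shows "Measurable.pred N (\<lambda>w. unif_cont_values (D w) (a w))"
  unfolding unif_cont_values_def by measurable

lemma measurable_vanishing_values:
  assumes D: "\<And>n m. (\<lambda>w. D w n m) \<in> borel_measurable N"
    and [measurable]: "\<And>n. (\<lambda>w. a w n) \<in> borel_measurable N"
  shows "Measurable.pred N (\<lambda>w. vanishing_values (D w) (a w))"
proof -
  have [measurable]: "Measurable.pred N (\<lambda>w. totally_bounded_indices (D w)
      (\<lambda>n. inverse (real (Suc k)) \<le> cmod (a w n)))" for k
    by (rule measurable_totally_bounded_indices[OF D]) measurable
  show ?thesis unfolding vanishing_values_def by measurable
qed

lemma measurable_bump_fun:
  assumes D: "\<And>n m. (\<lambda>w. D w n m) \<in> borel_measurable N"
    and \<delta> [measurable]: "\<And>n. (\<lambda>w. \<delta> w n) \<in> borel_measurable N"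
  shows "(\<lambda>w. bump_fun (D w) (\<delta> w) p) \<in> borel_measurable N"
proof -
  note D [measurable]
  have [measurable]: "(\<lambda>w. bump (D w) n k (\<delta> w n)) \<in> borel_measurable N" for n k
  proof -
    have [measurable]: "Measurable.pred N (\<lambda>w. totally_bounded_indices (D w)
        (\<lambda>m. D w n m < inverse (real (Suc k))))"
      by (rule measurable_totally_bounded_indices[OF D]) measurable
    show ?thesis unfolding bump_def by measurable
  qed
  have [measurable]: "(\<lambda>w. bump_max (D w) (\<delta> w) l) \<in> borel_measurable N" for l
  proof (induction l)
    case (Cons a l)
    note Cons [measurable]
    obtain q n k where a: "a = (q, n, k)" by (cases a)
    show ?case unfolding a bump_max.simps by measurable
  qed simp
  obtain l1 l2 l3 l4 where p: "p = ((l1, l2), (l3, l4))" by (metis prod.exhaust)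
  have "(\<lambda>w. bump_fun (D w) (\<delta> w) p) = (\<lambda>w.
      complex_of_real (bump_max (D w) (\<delta> w) l1 - bump_max (D w) (\<delta> w) l2) +
      \<i> * complex_of_real (bump_max (D w) (\<delta> w) l3 - bump_max (D w) (\<delta> w) l4))"
    by (simp add: fun_eq_iff p bump_fun_def complex_eq_iff)
  also have "\<dots> \<in> borel_measurable N" by measurable
  finally show ?thesis .
qed

lemma measurable_fibre_product:
  assumes "f \<in> measurable N B" "g \<in> measurable N B'" "\<And>w. w \<in> space N \<Longrightarrow> fst (f w) = fst (g w)"
  shows "(\<lambda>w. (f w, g w)) \<in> measurable N (fibre_product B B')"
  unfolding fibre_product_def using assms by (intro measurable_restrict_space2 measurable_Pair) auto

lemma measurable_fibre_product_fst: "fst \<in> measurable (fibre_product B B') B"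
  and measurable_fibre_product_snd: "snd \<in> measurable (fibre_product B B') B'"
  unfolding fibre_product_def by (intro measurable_restrict_space1 measurable_fst measurable_snd)+

lemma space_fibre_product:
  "space (fibre_product B B') = {(v, w). v \<in> space B \<and> w \<in> space B' \<and> fst v = fst w}"
  by (auto simp: fibre_product_def space_restrict_space space_pair_measure)

text \<open>The metrics and sections that \<open>borel_field_polish\<close> only asserts to exist
  are fixed here. In each fibre they form a \<open>complete_dense_metric\<close>, through which the
  results on a single space become available.\<close>

locale polish_field =
  fixes X :: "'x measure" and V :: "'x \<Rightarrow> 'v topology" and BV :: "('x \<times> 'v) measure"
    and d :: "'x \<Rightarrow> 'v \<Rightarrow> 'v \<Rightarrow> real" and s :: "nat \<Rightarrow> 'x \<Rightarrow> 'v"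
  assumes standard_X: "standard_borel X"
    and space_BV: "space BV = Sigma (space X) (\<lambda>x. topspace (V x))"
    and fst_BV: "fst \<in> measurable BV X"
    and d_measurable: "(\<lambda>((x, v), (y, w)). d x v w) \<in> borel_measurable (fibre_product BV BV)"
    and s_measurable: "\<And>n. (\<lambda>x. (x, s n x)) \<in> measurable X BV"
    and fibre: "\<And>x. x \<in> space X \<Longrightarrow> complete_dense_metric (topspace (V x)) (d x) (\<lambda>n. s n x)"
    and mtopology_eq: "\<And>x. x \<in> space X \<Longrightarrow> Metric_space.mtopology (topspace (V x)) (d x) = V x"
begin

lemma s_in: "x \<in> space X \<Longrightarrow> s n x \<in> topspace (V x)"
  using measurable_space[OF s_measurable, of x n] space_BV by simp

lemma topspace_nonempty: "x \<in> space X \<Longrightarrow> topspace (V x) \<noteq> {}"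
  using s_in by blast

lemma dist_measurable:
  assumes "f \<in> measurable N BV" "g \<in> measurable N BV" "\<And>w. w \<in> space N \<Longrightarrow> fst (f w) = fst (g w)"
  shows "(\<lambda>w. d (fst (f w)) (snd (f w)) (snd (g w))) \<in> borel_measurable N"
  using measurable_compose[OF measurable_fibre_product[OF assms] d_measurable]
  by (simp add: case_prod_beta')

section \<open>The structure pulled back from the values at the sections\<close>

definition DX :: "'x \<Rightarrow> nat \<Rightarrow> nat \<Rightarrow> real" where "DX x n m = d x (s n x) (s m x)"

lemma DX_measurable: "(\<lambda>x. DX x n m) \<in> borel_measurable X"
  using dist_measurable[OF s_measurable[of n] s_measurable[of m]] by (simp add: DX_def)

definition Z :: "('x \<times> ('v \<Rightarrow> complex)) set" where "Z = Sigma (space X) (\<lambda>x. C0_set (V x))"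

definition Y :: "('x \<times> (nat \<Rightarrow> complex)) measure" where "Y = X \<Otimes>\<^sub>M (\<Pi>\<^sub>M _\<in>UNIV. borel)"

definition \<Phi> :: "'x \<times> ('v \<Rightarrow> complex) \<Rightarrow> 'x \<times> (nat \<Rightarrow> complex)" where
  "\<Phi> = (\<lambda>(x, F). (x, \<lambda>n. F (s n x)))"

lemma standard_Y: "standard_borel Y"
  unfolding Y_def by (rule standard_borel_pair_borel[OF standard_X sets_PiM_equal_borel])

lemma space_Y: "space Y = space X \<times> UNIV"
  by (simp add: Y_def space_pair_measure space_PiM)

lemma inj_on_\<Phi>: "inj_on \<Phi> Z"
proof (rule inj_onI)
  fix p q assume pq: "p \<in> Z" "q \<in> Z" "\<Phi> p = \<Phi> q"
  obtain x F G where p: "p = (x, F)" and q: "q = (x, G)"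
    using pq(3) by (cases p, cases q) (auto simp: \<Phi>_def)
  have x: "x \<in> space X" using pq(1) by (simp add: p Z_def)
  interpret complete_dense_metric "topspace (V x)" "d x" "\<lambda>n. s n x" by (rule fibre[OF x])
  have "F = G"
  proof (rule C0_set_eqI)
    show "F (s n x) = G (s n x)" for n
      using pq(3) fun_cong[of "\<lambda>n. F (s n x)" "\<lambda>n. G (s n x)" n] by (simp add: p q \<Phi>_def)
  qed (use pq in \<open>auto simp: p q Z_def mtopology_eq[OF x]\<close>)
  then show "p = q" by (simp add: p q)
qed

text \<open>In each fibre this is \<open>C0_values\<close> in one direction and
  \<open>C0_extension\<close> in the other.\<close>

lemma image_\<Phi>: "\<Phi> ` Z = {w \<in> space Y. unif_cont_values (DX (fst w)) (snd w) \<and> vanishing_values (DX (fst w)) (snd w)}"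
proof (rule Set.set_eqI)
  fix w :: "'x \<times> (nat \<Rightarrow> complex)"
  obtain x a where w: "w = (x, a)" by (cases w)
  show "w \<in> \<Phi> ` Z \<longleftrightarrow>
      w \<in> {w \<in> space Y. unif_cont_values (DX (fst w)) (snd w) \<and> vanishing_values (DX (fst w)) (snd w)}"
  proof (cases "x \<in> space X")
    case x: True
    interpret F: complete_dense_metric "topspace (V x)" "d x" "\<lambda>n. s n x" by (rule fibre[OF x])
    have Dx: "DX x = F.D" by (simp add: DX_def fun_eq_iff)
    have "w \<in> \<Phi> ` Z \<longleftrightarrow> (\<exists>F\<in>C0_set F.mtopology. \<forall>n. a n = F (s n x))"
      by (auto simp: w \<Phi>_def Z_def x mtopology_eq[OF x] image_iff fun_eq_iff)
    also have "\<dots> \<longleftrightarrow> unif_cont_values (DX x) a \<and> vanishing_values (DX x) a"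
    proof
      assume "\<exists>F\<in>C0_set F.mtopology. \<forall>n. a n = F (s n x)"
      then obtain F where F: "F \<in> C0_set F.mtopology" "a = (\<lambda>n. F (s n x))" by (metis ext)
      show "unif_cont_values (DX x) a \<and> vanishing_values (DX x) a"
        using F.C0_values[OF F(1)] by (simp add: Dx F(2))
    next
      assume "unif_cont_values (DX x) a \<and> vanishing_values (DX x) a"
      then show "\<exists>F\<in>C0_set F.mtopology. \<forall>n. a n = F (s n x)"
        using F.C0_extension[of a] by (auto simp: Dx eq_commute)
    qed
    finally show ?thesis using x by (simp add: w space_Y)
  next
    case False
    then show ?thesis by (auto simp: w space_Y \<Phi>_def Z_def)
  qed
qed

lemma image_\<Phi>_sets: "\<Phi> ` Z \<in> sets Y"
proof -
  have "fst \<in> measurable Y X" unfolding Y_def by (rule measurable_fst)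
  from measurable_compose[OF this DX_measurable]
  have [measurable]: "(\<lambda>w. DX (fst w) n m) \<in> borel_measurable Y" for n m .
  have [measurable]: "(\<lambda>w. snd w n) \<in> borel_measurable Y" for n
    unfolding Y_def by measurable
  have "Measurable.pred Y (\<lambda>w. unif_cont_values (DX (fst w)) (snd w) \<and> vanishing_values (DX (fst w)) (snd w))"
    by (intro pred_intros_logic measurable_unif_cont_values measurable_vanishing_values) measurable
  then show ?thesis unfolding image_\<Phi> by (simp add: pred_def)
qed

definition B0 :: "('x \<times> ('v \<Rightarrow> complex)) measure" where "B0 = vimage_algebra Z \<Phi> Y"

lemma space_B0: "space B0 = Z"
  by (simp add: B0_def)

lemma \<Phi>_B0: "\<Phi> \<in> measurable B0 Y"
  unfolding B0_def
proof (rule measurable_vimage_algebra1)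
  show "\<Phi> \<in> Z \<rightarrow> space Y" using sets.sets_into_space[OF image_\<Phi>_sets] by blast
qed

text \<open>\<open>F v\<close> is the limit of \<open>F\<close> along the first points of the dense sequence that are
  \<open>1/(k+1)\<close>-close to \<open>v\<close>.\<close>

lemma eval_B0: "(\<lambda>((x, F), (y, v)). F v) \<in> borel_measurable (fibre_product B0 BV)"
proof -
  define N where "N = fibre_product B0 BV"
  have fst_N: "fst \<in> measurable N B0" and snd_N: "snd \<in> measurable N BV"
    unfolding N_def by (rule measurable_fibre_product_fst measurable_fibre_product_snd)+
  have x_N: "(\<lambda>w. fst (snd w)) \<in> measurable N X" by (rule measurable_compose[OF snd_N fst_BV])
  have [measurable]: "(\<lambda>w. d (fst (snd w)) (s n (fst (snd w))) (snd (snd w))) \<in> borel_measurable N" for n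
    using dist_measurable[OF measurable_compose[OF x_N s_measurable[of n]] snd_N] by simp
  have [measurable]: "(\<lambda>w. snd (\<Phi> (fst w)) n) \<in> borel_measurable N" for n
  proof -
    have "(\<lambda>z. snd z n) \<in> borel_measurable Y" unfolding Y_def by measurable
    then show ?thesis by (rule measurable_compose[OF measurable_compose[OF fst_N \<Phi>_B0]])
  qed
  define near where "near w k = (LEAST n. d (fst (snd w)) (s n (fst (snd w))) (snd (snd w)) <
      inverse (real (Suc k)))" for w :: "('x \<times> ('v \<Rightarrow> complex)) \<times> 'x \<times> 'v" and k
  have "(\<lambda>w. near w k) \<in> measurable N (count_space UNIV)" for k
    unfolding near_def by measurable
  then have "(\<lambda>w. snd (\<Phi> (fst w)) (near w k)) \<in> borel_measurable N" for k
    by (rule measurable_compose_countable[rotated]) measurable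
  then have "(\<lambda>w. snd (fst w) (snd (snd w))) \<in> borel_measurable N"
  proof (rule borel_measurable_LIMSEQ_metric)
    fix w assume "w \<in> space N"
    then obtain x F v where w: "w = ((x, F), (x, v))" and x: "x \<in> space X"
      and F: "F \<in> C0_set (V x)" and v: "v \<in> topspace (V x)"
      by (auto simp: N_def space_fibre_product space_B0 Z_def space_BV)
    interpret F: complete_dense_metric "topspace (V x)" "d x" "\<lambda>n. s n x" by (rule fibre[OF x])
    have "(\<lambda>k. F (s (F.near v k) x)) \<longlonglongrightarrow> F v"
      using F v by (intro F.tendsto_near F.C0_setD) (simp_all add: mtopology_eq[OF x])
    then show "(\<lambda>k. snd (\<Phi> (fst w)) (near w k)) \<longlonglongrightarrow> snd (fst w) (snd (snd w))"
      by (simp add: w \<Phi>_def near_def F.near_def)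
  qed
  then show ?thesis by (simp add: N_def case_prod_beta')
qed

lemma C0_borel_structure_B0: "C0_borel_structure X V BV B0"
proof -
  have "standard_borel B0"
    unfolding B0_def by (rule standard_borel_vimage_algebra[OF standard_Y image_\<Phi>_sets inj_on_\<Phi>])
  moreover have "fst \<in> measurable B0 X"
  proof -
    have "fst \<in> measurable Y X" unfolding Y_def by (rule measurable_fst)
    from measurable_compose[OF \<Phi>_B0 this] show ?thesis by (simp add: \<Phi>_def case_prod_beta')
  qed
  ultimately show ?thesis
    unfolding C0_borel_structure_def using eval_B0 by (simp add: space_B0 Z_def)
qed

section \<open>Uniqueness and Borel operations for an arbitrary admissible structure\<close>

context
  fixes B :: "('x \<times> ('v \<Rightarrow> complex)) measure"
  assumes B: "C0_borel_structure X V BV B"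
begin

lemma standard_B: "standard_borel B" and space_B: "space B = Z" and fst_B: "fst \<in> measurable B X"
  and eval_B: "(\<lambda>((x, F), (y, v)). F v) \<in> borel_measurable (fibre_product B BV)"
  using B by (simp_all add: C0_borel_structure_def Z_def)

text \<open>Evaluation is composed with the map that pairs a function with the point of
  \<open>s n\<close> over its base point; this pair lies in the fibre product because
  \<open>s n\<close> is a section.\<close>

lemma eval_section_measurable: "(\<lambda>w. snd w (s n (fst w))) \<in> borel_measurable B"
proof -
  have "(\<lambda>w. (w, (fst w, s n (fst w)))) \<in> measurable B (fibre_product B BV)"
    by (rule measurable_fibre_product[OF measurable_ident_sets[OF refl]
          measurable_compose[OF fst_B s_measurable]]) simp
  from measurable_compose[OF this eval_B] show ?thesis by (simp add: case_prod_beta')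
qed

lemma \<Phi>_B: "\<Phi> \<in> measurable B Y"
proof -
  have "(\<lambda>w. (fst w, \<lambda>n. snd w (s n (fst w)))) \<in> measurable B Y"
    unfolding Y_def
    by (intro measurable_Pair fst_B measurable_PiM_single' eval_section_measurable) auto
  then show ?thesis by (simp add: \<Phi>_def case_prod_beta')
qed

text \<open>The map \<open>\<Phi>\<close> and its target \<open>Y\<close> do not depend on
  \<open>B\<close>, so Lusin--Souslin identifies every admissible structure with the same
  pull-back.\<close>

lemma sets_B: "sets B = sets B0"
  unfolding B0_def
  using sets_eq_vimage_algebra[OF standard_B standard_borel_countably_separated[OF standard_Y] \<Phi>_B]
    inj_on_\<Phi> by (simp add: space_B)

text \<open>The criterion by which the operations and the dense sections are shown to be Borel: in a
  pulled-back structure only the base point and the countably many values at the sections have to be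
  tested.\<close>

lemma measurable_BI:
  assumes "\<And>w. w \<in> space N \<Longrightarrow> f w \<in> space X \<and> g w \<in> C0_set (V (f w))"
    and "f \<in> measurable N X" and "\<And>n. (\<lambda>w. g w (s n (f w))) \<in> borel_measurable N"
  shows "(\<lambda>w. (f w, g w)) \<in> measurable N B"
proof -
  have "(\<lambda>w. \<Phi> (f w, g w)) \<in> measurable N Y"
    unfolding Y_def \<Phi>_def case_prod_conv using assms(2,3)
    by (intro measurable_Pair measurable_PiM_single') auto
  moreover have "(\<lambda>w. (f w, g w)) \<in> space N \<rightarrow> Z" using assms(1) by (auto simp: Z_def)
  ultimately have "(\<lambda>w. (f w, g w)) \<in> measurable N B0"
    unfolding B0_def by (rule_tac measurable_vimage_algebra2)
  then show ?thesis using measurable_cong_sets[OF refl sets_B] by blast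
qed

context
  fixes N :: "'n measure" and p
  assumes p: "p \<in> measurable N B"
begin

lemma p_space: "w \<in> space N \<Longrightarrow> fst (p w) \<in> space X \<and> snd (p w) \<in> C0_set (V (fst (p w)))"
  using measurable_space[OF p] by (fastforce simp: space_B Z_def)

lemma p_fst: "(\<lambda>w. fst (p w)) \<in> measurable N X"
  by (rule measurable_compose[OF p fst_B])

lemma p_eval: "(\<lambda>w. snd (p w) (s n (fst (p w)))) \<in> borel_measurable N"
  by (rule measurable_compose[OF p eval_section_measurable])

text \<open>Operations are treated along a Borel family \<open>p\<close> over any space
  \<open>N\<close>. The same lemmas then serve fibre products, products with the scalars, and the
  restricted structure on C_c.\<close>

lemma pointwise_measurable:
  assumes "\<And>w. w \<in> space N \<Longrightarrow> (\<lambda>v\<in>topspace (V (fst (p w))). h w v) \<in> C0_set (V (fst (p w)))"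
    and "\<And>n. (\<lambda>w. h w (s n (fst (p w)))) \<in> borel_measurable N"
  shows "(\<lambda>w. (fst (p w), \<lambda>v\<in>topspace (V (fst (p w))). h w v)) \<in> measurable N B"
proof (rule measurable_BI[OF _ p_fst])
  fix n
  have "(\<lambda>w. (\<lambda>v\<in>topspace (V (fst (p w))). h w v) (s n (fst (p w)))) \<in> borel_measurable N \<longleftrightarrow>
      (\<lambda>w. h w (s n (fst (p w)))) \<in> borel_measurable N"
    using p_space s_in by (intro measurable_cong) auto
  then show "(\<lambda>w. (\<lambda>v\<in>topspace (V (fst (p w))). h w v) (s n (fst (p w)))) \<in> borel_measurable N"
    using assms(2) by simp
qed (use p_space assms(1) in blast)

lemma smult_measurable:
  assumes [measurable]: "c \<in> borel_measurable N"
  shows "(\<lambda>w. (fst (p w), \<lambda>v\<in>topspace (V (fst (p w))). c w * snd (p w) v)) \<in> measurable N B"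
  using p_space p_eval by (intro pointwise_measurable C0_set_smult borel_measurable_times assms) auto

lemma adj_measurable:
  "(\<lambda>w. (fst (p w), \<lambda>v\<in>topspace (V (fst (p w))). cnj (snd (p w) v))) \<in> measurable N B"
proof (intro pointwise_measurable C0_set_cnj)
  have "(cnj :: complex \<Rightarrow> complex) \<in> borel_measurable borel"
    by (intro borel_measurable_continuous_onI continuous_intros)
  then show "(\<lambda>w. cnj (snd (p w) (s n (fst (p w))))) \<in> borel_measurable N" for n
    by (rule measurable_compose[OF p_eval])
qed (use p_space in blast)

lemma norm_measurable: "(\<lambda>w. sup_norm (V (fst (p w))) (snd (p w))) \<in> borel_measurable N"
proof (rule borel_measurable_iff_le[THEN iffD2], rule allI)
  fix r
  have eq: "sup_norm (V (fst (p w))) (snd (p w)) \<le> r \<longleftrightarrow> (\<forall>n. cmod (snd (p w) (s n (fst (p w)))) \<le> r)"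
    if w: "w \<in> space N" for w
  proof -
    obtain x F where xF: "p w = (x, F)" by (cases "p w")
    have x: "x \<in> space X" and F: "F \<in> C0_set (V x)" using p_space[OF w] by (simp_all add: xF)
    interpret F: complete_dense_metric "topspace (V x)" "d x" "\<lambda>n. s n x" by (rule fibre[OF x])
    show ?thesis
      using F.C0_le_iff[of F r] F sup_norm_le_iff[OF topspace_nonempty[OF x] F]
      by (simp add: xF mtopology_eq[OF x])
  qed
  note p_eval [measurable]
  have "{w \<in> space N. sup_norm (V (fst (p w))) (snd (p w)) \<le> r} =
      {w \<in> space N. \<forall>n. cmod (snd (p w) (s n (fst (p w)))) \<le> r}"
    using eq by blast
  also have "\<dots> \<in> sets N" by measurable
  finally show "{w \<in> space N. sup_norm (V (fst (p w))) (snd (p w)) \<le> r} \<in> sets N" .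
qed

context
  fixes q
  assumes q: "q \<in> measurable N B" and same: "\<And>w. w \<in> space N \<Longrightarrow> fst (p w) = fst (q w)"
begin

lemma q_eval: "(\<lambda>w. snd (q w) (s n (fst (p w)))) \<in> borel_measurable N"
proof -
  have "(\<lambda>w. snd (q w) (s n (fst (p w)))) \<in> borel_measurable N \<longleftrightarrow>
      (\<lambda>w. snd (q w) (s n (fst (q w)))) \<in> borel_measurable N"
    using same by (intro measurable_cong) simp
  then show ?thesis using measurable_compose[OF q eval_section_measurable] by simp
qed

lemma q_space: "w \<in> space N \<Longrightarrow> snd (q w) \<in> C0_set (V (fst (p w)))"
  using measurable_space[OF q] same by (fastforce simp: space_B Z_def)

lemma add_measurable:
  "(\<lambda>w. (fst (p w), \<lambda>v\<in>topspace (V (fst (p w))). snd (p w) v + snd (q w) v)) \<in> measurable N B"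
  using p_space q_space
  by (intro pointwise_measurable C0_set_add borel_measurable_add p_eval q_eval) auto

lemma mult_measurable:
  "(\<lambda>w. (fst (p w), \<lambda>v\<in>topspace (V (fst (p w))). snd (p w) v * snd (q w) v)) \<in> measurable N B"
  using p_space q_space
  by (intro pointwise_measurable C0_set_mult borel_measurable_times p_eval q_eval) auto

end

end

end

end

section \<open>Dense Borel sections and the Borel fields C_0 and C_c\<close>

context polish_field
begin

text \<open>The function \<open>bump_section\<close> of the fibre, written as an explicit expression
  in \<open>x\<close> so that its dependence on the base point can be seen to be Borel.\<close>

definition code_section :: "nat \<Rightarrow> 'x \<Rightarrow> 'v \<Rightarrow> complex" where
  "code_section j x = (\<lambda>v\<in>topspace (V x). bump_fun (DX x) (\<lambda>n. d x (s n x) v) (from_nat j))"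

lemma code_section_eq:
  assumes x: "x \<in> space X"
  shows "code_section j x =
    complete_dense_metric.bump_section (topspace (V x)) (d x) (\<lambda>n. s n x) (from_nat j)"
proof -
  interpret F: complete_dense_metric "topspace (V x)" "d x" "\<lambda>n. s n x" by (rule fibre[OF x])
  show ?thesis unfolding code_section_def F.bump_section_def DX_def ..
qed

lemma code_section_in_Cc: "x \<in> space X \<Longrightarrow> code_section j x \<in> Cc_set (V x)"
  unfolding code_section_eq
  using complete_dense_metric.bump_section_in_Cc[OF fibre] mtopology_eq by metis

lemma code_section_dense:
  assumes lc: "locally_compact_space (V x)" and x: "x \<in> space X"
    and F: "F \<in> C0_set (V x)" and \<epsilon>: "\<epsilon> > 0"
  shows "\<exists>j. \<forall>v\<in>topspace (V x). cmod (F v - code_section j x v) \<le> \<epsilon>"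
proof -
  interpret F: complete_dense_metric "topspace (V x)" "d x" "\<lambda>n. s n x" by (rule fibre[OF x])
  obtain p where "\<forall>v\<in>topspace (V x). cmod (F v - F.bump_section p v) \<le> \<epsilon>"
    using F.bump_section_dense[of F \<epsilon>] lc F \<epsilon> by (auto simp: mtopology_eq[OF x])
  moreover have "F.bump_section p = code_section (to_nat p) x"
    by (simp add: code_section_eq[OF x])
  ultimately show ?thesis by auto
qed

context
  fixes B :: "('x \<times> ('v \<Rightarrow> complex)) measure"
  assumes B: "C0_borel_structure X V BV B"
begin

lemma borel_section_code_section: "(\<lambda>x. (x, code_section j x)) \<in> measurable X B"
proof (rule measurable_BI[OF B])
  show "x \<in> space X \<and> code_section j x \<in> C0_set (V x)" if "x \<in> space X" for x
    using that code_section_in_Cc Cc_set_subset_C0_set by blast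
  fix n
  \<comment> \<open>At the point \<open>s n x\<close> the distances to the dense sequence are
    themselves entries of \<open>DX x\<close>, so the value depends on \<open>x\<close> only through
    Borel functions.\<close>
  have "(\<lambda>x. bump_fun (DX x) (\<lambda>m. DX x m n) (from_nat j)) \<in> borel_measurable X"
    by (intro measurable_bump_fun DX_measurable)
  moreover have "(\<lambda>x. code_section j x (s n x)) \<in> borel_measurable X \<longleftrightarrow>
      (\<lambda>x. bump_fun (DX x) (\<lambda>m. DX x m n) (from_nat j)) \<in> borel_measurable X"
    by (intro measurable_cong) (simp add: code_section_def s_in DX_def)
  ultimately show "(\<lambda>x. code_section j x (s n x)) \<in> borel_measurable X" by simp
qed (rule measurable_ident_sets[OF refl])

text \<open>By \<open>Cc_iff_values\<close> membership in C_c is total boundedness of the indices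
  with nonzero value, a countable condition on Borel data.\<close>

lemma Cc_sets: "Sigma (space X) (\<lambda>x. Cc_set (V x)) \<in> sets B"
proof -
  have "Sigma (space X) (\<lambda>x. Cc_set (V x)) =
      {w \<in> space B. totally_bounded_indices (DX (fst w)) (\<lambda>n. snd w (s n (fst w)) \<noteq> 0)}"
  proof (rule Set.set_eqI)
    fix w :: "'x \<times> ('v \<Rightarrow> complex)"
    obtain x F where w: "w = (x, F)" by (cases w)
    have "F \<in> Cc_set (V x) \<longleftrightarrow> F \<in> C0_set (V x) \<and> totally_bounded_indices (DX x) (\<lambda>n. F (s n x) \<noteq> 0)"
      if x: "x \<in> space X"
    proof -
      interpret F: complete_dense_metric "topspace (V x)" "d x" "\<lambda>n. s n x" by (rule fibre[OF x])
      have "DX x = F.D" by (simp add: DX_def fun_eq_iff)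
      then show ?thesis
        using F.Cc_iff_values[of F] Cc_set_subset_C0_set[of "V x"] by (auto simp: mtopology_eq[OF x])
    qed
    then show "w \<in> Sigma (space X) (\<lambda>x. Cc_set (V x)) \<longleftrightarrow>
        w \<in> {w \<in> space B. totally_bounded_indices (DX (fst w)) (\<lambda>n. snd w (s n (fst w)) \<noteq> 0)}"
      by (auto simp: w space_B[OF B] Z_def)
  qed
  also have "\<dots> \<in> sets B"
  proof -
    note eval_section_measurable[OF B, measurable]
    have "Measurable.pred B (\<lambda>w. totally_bounded_indices (DX (fst w)) (\<lambda>n. snd w (s n (fst w)) \<noteq> 0))"
      by (rule measurable_totally_bounded_indices[OF measurable_compose[OF fst_B[OF B] DX_measurable]])
        measurable
    then show ?thesis by (simp add: pred_def)
  qed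
  finally show ?thesis .
qed

context
  assumes lc: "\<And>x. x \<in> space X \<Longrightarrow> locally_compact_space (V x)"
begin

text \<open>Applied with \<open>S\<close> equal to C_0 and to C_c. The same sections serve both:
  they lie in \<open>S\<close> because it contains C_c, and they are dense in it because they
  approximate all of C_0.\<close>

lemma borel_field_normed_subspace:
  fixes S :: "'v topology \<Rightarrow> ('v \<Rightarrow> complex) set"
  assumes S: "\<And>x. x \<in> space X \<Longrightarrow> C0_subspace (V x) (S (V x))"
    and Cc: "\<And>x. x \<in> space X \<Longrightarrow> Cc_set (V x) \<subseteq> S (V x)"
    and meas: "Sigma (space X) (\<lambda>x. S (V x)) \<in> sets B"
  shows "borel_field_normed X (\<lambda>x. C0_alg (V x)\<lparr>carrier := S (V x)\<rparr>)
    (restrict_space B (Sigma (space X) (\<lambda>x. S (V x))))"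
proof -
  define A where "A = Sigma (space X) (\<lambda>x. S (V x))"
  define R where "R = restrict_space B A"
  define E where "E x = C0_alg (V x)\<lparr>carrier := S (V x)\<rparr>" for x
  have E: "C0_subspace.E (V x) (S (V x)) = E x" if "x \<in> space X" for x
    unfolding E_def C0_subspace.E_def[OF S[OF that]] ..
  have space_R: "space R = A"
    using sets.sets_into_space[OF meas] by (auto simp: R_def A_def space_restrict_space)
  have to_R: "f \<in> measurable N R" if "f \<in> measurable N B" "\<And>w. w \<in> space N \<Longrightarrow> f w \<in> A"
    for f and N :: "'n measure"
    unfolding R_def using that by (intro measurable_restrict_space2) auto
  have from_R: "f \<in> measurable N B" if "f \<in> measurable N R" for f and N :: "'n measure"
    using that unfolding R_def by (simp add: measurable_restrict_space2_iff)
  have id_R: "(\<lambda>w. w) \<in> measurable R B" by (rule from_R[OF measurable_ident_sets[OF refl]])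
  have "borel_field_normed X E R"
    unfolding borel_field_normed_def
  proof (intro conjI ballI)
    show "standard_borel R"
      unfolding R_def A_def by (rule standard_borel_restrict_space[OF standard_B[OF B] meas])
    show "complex_normed_space (E x)" if "x \<in> space X" for x
      using C0_subspace.complex_normed_space_E[OF S[OF that]] E[OF that] by simp
    show "space R = Sigma (space X) (\<lambda>x. carrier (E x))"
      by (simp add: space_R A_def E_def)
    show "fst \<in> measurable R X" by (rule measurable_compose[OF id_R fst_B[OF B]])
    show "(\<lambda>(x, u). nrm (E x) u) \<in> borel_measurable R"
      using norm_measurable[OF B id_R] by (simp add: E_def case_prod_beta')
    show "(\<lambda>((x, u), (y, w)). (x, u \<oplus>\<^bsub>E x\<^esub> w)) \<in> measurable (fibre_product R R) R"
    proof (rule to_R)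
      have "(\<lambda>z. (fst (fst z), \<lambda>v\<in>topspace (V (fst (fst z))). snd (fst z) v + snd (snd z) v))
          \<in> measurable (fibre_product R R) B"
        by (rule add_measurable[OF B from_R[OF measurable_fibre_product_fst]
              from_R[OF measurable_fibre_product_snd]]) (auto simp: space_fibre_product)
      then show "(\<lambda>((x, u), (y, w)). (x, u \<oplus>\<^bsub>E x\<^esub> w)) \<in> measurable (fibre_product R R) B"
        by (simp add: E_def case_prod_beta')
    qed (auto simp: space_fibre_product space_R A_def E_def intro: C0_subspace.add_closed[OF S])
    show "(\<lambda>(c, (x, u)). (x, c \<odot>\<^bsub>E x\<^esub> u)) \<in> measurable ((borel :: complex measure) \<Otimes>\<^sub>M R) R"
    proof (rule to_R)
      have "(\<lambda>z. (fst (snd z), \<lambda>v\<in>topspace (V (fst (snd z))). fst z * snd (snd z) v))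
          \<in> measurable ((borel :: complex measure) \<Otimes>\<^sub>M R) B"
        by (rule smult_measurable[OF B from_R[OF measurable_snd] measurable_fst])
      then show "(\<lambda>(c, (x, u)). (x, c \<odot>\<^bsub>E x\<^esub> u)) \<in> measurable ((borel :: complex measure) \<Otimes>\<^sub>M R) B"
        by (simp add: E_def case_prod_beta')
    qed (auto simp: space_pair_measure space_R A_def E_def intro: C0_subspace.smult_closed[OF S])
    have "dense_borel_sections X (\<lambda>x. norm_topology (E x)) R code_section"
      unfolding dense_borel_sections_def borel_section_def
    proof (intro conjI allI ballI)
      show "(\<lambda>x. (x, code_section n x)) \<in> measurable X R" for n
        by (rule to_R[OF borel_section_code_section]) (use Cc code_section_in_Cc in \<open>auto simp: A_def\<close>)
      fix x assume x: "x \<in> space X"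
      interpret C0_subspace "V x" "S (V x)" by (rule S[OF x])
      show "norm_topology (E x) closure_of range (\<lambda>n. code_section n x) = topspace (norm_topology (E x))"
        unfolding E[OF x, symmetric]
      proof (rule dense_in_norm_topology)
        show "range (\<lambda>n. code_section n x) \<subseteq> S (V x)" using Cc[OF x] code_section_in_Cc[OF x] by blast
        fix F and \<epsilon> :: real assume "F \<in> S (V x)" "\<epsilon> > 0"
        then show "\<exists>G\<in>range (\<lambda>n. code_section n x). \<forall>v\<in>topspace (V x). cmod (F v - G v) \<le> \<epsilon>"
          using code_section_dense[OF lc[OF x] x, of F \<epsilon>] sub by blast
      qed
    qed
    then show "\<exists>s. dense_borel_sections X (\<lambda>x. norm_topology (E x)) R s" by blast
  qed (rule standard_X)
  moreover have "E = (\<lambda>x. C0_alg (V x)\<lparr>carrier := S (V x)\<rparr>)" by (rule ext) (simp add: E_def)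
  ultimately show ?thesis by (simp only: R_def A_def)
qed

lemma borel_field_cstar_C0: "borel_field_cstar X (\<lambda>x. C0_alg (V x)) B"
proof -
  have sp: "Sigma (space X) (\<lambda>x. C0_set (V x)) = space B" by (simp add: space_B[OF B] Z_def)
  have "borel_field_normed X (\<lambda>x. C0_alg (V x)\<lparr>carrier := C0_set (V x)\<rparr>)
      (restrict_space B (Sigma (space X) (\<lambda>x. C0_set (V x))))"
  proof (rule borel_field_normed_subspace)
    show "C0_subspace (V x) (C0_set (V x))" if "x \<in> space X" for x
      by (rule C0_subspace_C0[OF topspace_nonempty[OF that]])
  qed (simp_all add: sp Cc_set_subset_C0_set)
  moreover have "(\<lambda>x. C0_alg (V x)\<lparr>carrier := C0_set (V x)\<rparr>) = (\<lambda>x. C0_alg (V x))"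
    by (simp add: C0_alg_def)
  \<comment> \<open>An equality of measures, not only of their measurable sets, so that the field
    property can be rewritten along it.\<close>
  moreover have "restrict_space B (space B) = B"
  proof -
    have "(\<inter>) (space B) ` sets B = (\<lambda>A. A) ` sets B"
      by (rule image_cong[OF refl]) (rule sets.Int_space_eq1)
    then show ?thesis unfolding restrict_space_def by (simp add: measure_of_of_measure)
  qed
  ultimately have normed: "borel_field_normed X (\<lambda>x. C0_alg (V x)) B" by (simp add: sp)
  have "(\<lambda>z. (fst (fst z), \<lambda>v\<in>topspace (V (fst (fst z))). snd (fst z) v * snd (snd z) v))
      \<in> measurable (fibre_product B B) B"
    by (rule mult_measurable[OF B measurable_fibre_product_fst measurable_fibre_product_snd])
      (auto simp: space_fibre_product)
  then have "(\<lambda>((x, a), (y, b)). (x, a \<otimes>\<^bsub>C0_alg (V x)\<^esub> b)) \<in> measurable (fibre_product B B) B"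
    by (simp add: case_prod_beta')
  moreover have "(\<lambda>(x, a). (x, adj (C0_alg (V x)) a)) \<in> measurable B B"
    using adj_measurable[OF B measurable_ident_sets[OF refl]] by (simp add: case_prod_beta')
  ultimately show ?thesis
    unfolding borel_field_cstar_def borel_field_banach_def
    by (intro conjI ballI normed complex_banach_space_C0 cstar_algebra_C0 topspace_nonempty)
qed

lemma borel_field_normed_Cc:
  "borel_field_normed X (\<lambda>x. Cc_alg (V x)) (restrict_space B (Sigma (space X) (\<lambda>x. Cc_set (V x))))"
  unfolding Cc_alg_def
proof (rule borel_field_normed_subspace)
  show "C0_subspace (V x) (Cc_set (V x))" if "x \<in> space X" for x
    by (rule C0_subspace_Cc[OF topspace_nonempty[OF that]])
qed (simp_all add: Cc_sets)

end

end

end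

lemma borel_field_polishE:
  assumes "borel_field_polish X V BV"
  obtains d s where "polish_field X V BV d s"
proof -
  note unfolded = assms[unfolded borel_field_polish_def]
  have X: "standard_borel X" and BV: "space BV = Sigma (space X) (\<lambda>x. topspace (V x))"
    "fst \<in> measurable BV X"
    using unfolded by - (elim conjE, assumption)+
  obtain d where d: "(\<lambda>((x, v), (y, w)). d x v w) \<in> borel_measurable (fibre_product BV BV)"
    and dx: "\<forall>x\<in>space X. Metric_space (topspace (V x)) (d x) \<and>
      Metric_space.mcomplete (topspace (V x)) (d x) \<and>
      separable_space (Metric_space.mtopology (topspace (V x)) (d x)) \<and>
      Metric_space.mtopology (topspace (V x)) (d x) = V x"
    using unfolded by (elim conjE exE) (rule that)
  obtain s where s: "dense_borel_sections X V BV s"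
    using unfolded by (elim conjE exE) (rule that)
  have sB: "(\<lambda>x. (x, s n x)) \<in> measurable X BV" for n
    using s by (simp add: dense_borel_sections_def borel_section_def)
  have "polish_field X V BV d s"
  proof (rule polish_field.intro)
    fix x assume x: "x \<in> space X"
    interpret M: Metric_space "topspace (V x)" "d x" using bspec[OF dx x] by blast
    have "s n x \<in> topspace (V x)" for n
      using measurable_space[OF sB x, of n] BV(1) by simp
    moreover have "M.mtopology closure_of range (\<lambda>n. s n x) = topspace (V x)"
      using s x bspec[OF dx x] by (simp add: dense_borel_sections_def)
    ultimately show "complete_dense_metric (topspace (V x)) (d x) (\<lambda>n. s n x)"
      using bspec[OF dx x] by unfold_locales auto
  qed (use X BV d sB dx in auto)
  then show thesis by (rule that)
qed

theorem proposition10p6: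
  fixes X :: "'x measure" and V :: "'x \<Rightarrow> 'v topology" and BV :: "('x \<times> 'v) measure"
  assumes "borel_field_polish X V BV"
    and "\<And>x. x \<in> space X \<Longrightarrow> locally_compact_space (V x)"
  shows "(\<exists>B. C0_borel_structure X V BV B) \<and>
    (\<forall>B B'. C0_borel_structure X V BV B \<longrightarrow> C0_borel_structure X V BV B' \<longrightarrow> sets B = sets B') \<and>
    (\<forall>B. C0_borel_structure X V BV B \<longrightarrow>
       borel_field_cstar X (\<lambda>x. C0_alg (V x)) B \<and>
       Sigma (space X) (\<lambda>x. Cc_set (V x)) \<in> sets B \<and>
       borel_field_normed X (\<lambda>x. Cc_alg (V x))
         (restrict_space B (Sigma (space X) (\<lambda>x. Cc_set (V x)))))"
proof -
  obtain d s where "polish_field X V BV d s" using borel_field_polishE[OF assms(1)] .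
  then interpret polish_field X V BV d s .
  show ?thesis
  proof (intro conjI allI impI)
    show "\<exists>B. C0_borel_structure X V BV B" using C0_borel_structure_B0 by (rule exI)
    show "sets B = sets B'" if "C0_borel_structure X V BV B" "C0_borel_structure X V BV B'" for B B'
      using sets_B[OF that(1)] sets_B[OF that(2)] by simp
    fix B assume B: "C0_borel_structure X V BV B"
    show "borel_field_cstar X (\<lambda>x. C0_alg (V x)) B"
      by (rule borel_field_cstar_C0[OF B]) (rule assms(2))
    show "Sigma (space X) (\<lambda>x. Cc_set (V x)) \<in> sets B"
      by (rule Cc_sets[OF B])
    show "borel_field_normed X (\<lambda>x. Cc_alg (V x))
        (restrict_space B (Sigma (space X) (\<lambda>x. Cc_set (V x))))"
      by (rule borel_field_normed_Cc[OF B]) (rule assms(2))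
  qed
qed

end
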